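(* Let $A$ be a unital associative Banach algebra, and set $$Q(A):=\{a\in A\mid a^2=a\},\qquad \mathcal{G}(A):=\{(a,b)\in A\times A\mid aba=a,\ bab=b\}.$$ Then the groupoid $\mathcal{G}(A)\rightrightarrows Q(A)$, with source and target maps $\mathbf{s}(a,b)=ba$, $\mathbf{t}(a,b)=ab$, multiplication $(a_1,b_1)\cdot(a_2,b_2)=(a_1a_2,b_2b_1)$ whenever $\mathbf{s}(a_1,b_1)=\mathbf{t}(a_2,b_2)$, and inversion $(a,b)\mapsto(b,a)$, is a real analytic Banach-Lie groupoid. Moreover, this groupoid is locally transitive and its isotropy group at $\mathbf{1}\in Q(A)$ is the Banach-Lie group $A^\times$ of invertible elements of $A$.
   Context: $\mathbf{1}\in A$ denotes the unit of the algebra. The isotropy group at $\mathbf{1}$ is the set of $(a,b)\in\mathcal{G}(A)$ with $ab=ba=\mathbf{1}$, identified with $A^\times$ via $(a,b)\mapsto a$. A Banach-Lie groupoid is a groupoid $\mathcal{G}\rightrightarrows M$ (source $\mathbf{s}$, target $\mathbf{t}$, multiplication $gh$ defined when $\mathbf{s}(g)=\mathbf{t}(h)$, identity section $\mathbf{1}\colon M\to\mathcal{G}$, inversion) that is a topological groupoid (continuous structure maps, $\mathbf{s},\mathbf{t}$ open and surjective, identity section an embedding), such that $\mathcal{G}$ and $M$ are Hausdorff Banach manifolds, $\mathbf{s}$ is a surjective submersion (tangent maps surjective with closed complemented kernels), and inversion and multiplication are smooth. It is real analytic if $\mathcal{G}$ and $M$ are real analytic Banach manifolds and the structure maps are real analytic.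 Here $Q(A)$ and $\mathcal{G}(A)$ carry their structures of real analytic submanifolds of the Banach spaces $A$ and $A\times A$, respectively (with closed complemented tangent spaces). The groupoid is locally transitive if each orbit $\mathcal{G}.x=\{\mathbf{t}(g)\mid g\in\mathbf{s}^{-1}(x)\}$, $x\in M$, is open in $M$. *)

theory Defs
  imports "HOL-Analysis.Analysis" "HOL-Algebra.Group"
begin

section \<open>Closed subspaces, derivatives and real analytic maps\<close>

text \<open>The model space of a chart is a closed linear subspace of a Banach space, hence itself a
  Banach space. Subspaces rather than whole types are used because the connected components of a
  manifold may have non-isomorphic model spaces. All calculus is therefore done relative to a
  closed subspace \<open>V\<close>; linear maps on \<open>V\<close> are not assumed to extend to the ambient space.\<close>

definition closed_subspace :: "'e::real_normed_vector set \<Rightarrow> bool" where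
  "closed_subspace V \<longleftrightarrow> subspace V \<and> closed V"

definition complemented_in :: "'e::real_normed_vector set \<Rightarrow> 'e set \<Rightarrow> bool" where
  "complemented_in V W \<longleftrightarrow> closed_subspace W \<and> W \<subseteq> V \<and>
     (\<exists>C. closed_subspace C \<and> C \<subseteq> V \<and> W \<inter> C = {0} \<and> (\<forall>v\<in>V. \<exists>w\<in>W. \<exists>c\<in>C. v = w + c))"

definition linear_along :: "'e::real_vector set \<Rightarrow> ('e \<Rightarrow> 'f::real_vector) \<Rightarrow> bool" where
  "linear_along V f \<longleftrightarrow> (\<forall>x\<in>V. \<forall>y\<in>V. f (x + y) = f x + f y) \<and> (\<forall>r. \<forall>x\<in>V. f (r *\<^sub>R x) = r *\<^sub>R f x)"

definition multilinear_along :: "'e::real_vector set \<Rightarrow> nat \<Rightarrow> ('e list \<Rightarrow> 'f::real_vector) \<Rightarrow> bool" where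
  "multilinear_along V n m \<longleftrightarrow>
     (\<forall>xs ys. set xs \<subseteq> V \<longrightarrow> set ys \<subseteq> V \<longrightarrow> length xs + 1 + length ys = n
        \<longrightarrow> linear_along V (\<lambda>x. m (xs @ x # ys)))"

text \<open>Frechet derivative at \<open>x\<close> of a map defined near \<open>x\<close> in \<open>V\<close>. (The library's
  \<open>has_derivative\<close> at \<open>x\<close> within \<open>V\<close> would require \<open>D\<close> to be bounded linear on
  the whole ambient space.)\<close>

definition has_derivative_along ::
  "'e::real_normed_vector set \<Rightarrow> ('e \<Rightarrow> 'f::real_normed_vector) \<Rightarrow> ('e \<Rightarrow> 'f) \<Rightarrow> 'e \<Rightarrow> bool" where
  "has_derivative_along V f D x \<longleftrightarrow>
     linear_along V D \<and> (\<exists>K. \<forall>v\<in>V. norm (D v) \<le> K * norm v) \<and>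
     ((\<lambda>y. (f y - f x - D (y - x)) /\<^sub>R norm (y - x)) \<longlongrightarrow> 0) (at x within V)"

text \<open>Real analyticity on a relatively open subset \<open>U\<close> of \<open>V\<close>: near each point, \<open>f\<close> is the sum
  of a power series of continuous homogeneous polynomials \<open>h \<mapsto> m n (h, \<dots>, h)\<close>, given by bounded
  \<open>n\<close>-linear maps on \<open>V\<close> whose norms \<open>C n\<close> satisfy \<open>\<Sum>n. C n * r ^ n < \<infinity>\<close> for some \<open>r > 0\<close>.
  The \<open>m n\<close> need not be symmetric, since only their diagonals matter.\<close>

definition real_analytic_on ::
  "'e::real_normed_vector set \<Rightarrow> 'e set \<Rightarrow> ('e \<Rightarrow> 'f::real_normed_vector) \<Rightarrow> bool" where
  "real_analytic_on V U f \<longleftrightarrow> openin (top_of_set V) U \<and>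
     (\<forall>x\<in>U. \<exists>m C r. r > 0 \<and>
        (\<forall>n. multilinear_along V n (m n)) \<and>
        (\<forall>n. C n \<ge> 0) \<and>
        (\<forall>n xs. set xs \<subseteq> V \<and> length xs = n \<longrightarrow> norm (m n xs) \<le> C n * prod_list (map norm xs)) \<and>
        summable (\<lambda>n. C n * r ^ n) \<and>
        (\<forall>h\<in>V. norm h < r \<longrightarrow> x + h \<in> U \<and> (\<lambda>n. m n (replicate n h)) sums f (x + h)))"


section \<open>Real analytic Banach manifolds\<close>

record ('m, 'e) chart =
  cdom :: "'m set"
  cmap :: "'m \<Rightarrow> 'e"
  model :: "'e set"

record ('m, 'e) manifold =
  mtop :: "'m topology"
  atlas :: "('m, 'e) chart set"

definition cinv :: "('m, 'e) chart \<Rightarrow> 'e \<Rightarrow> 'm" where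
  "cinv c = inv_into (cdom c) (cmap c)"

definition is_chart :: "'m topology \<Rightarrow> ('m, 'e::banach) chart \<Rightarrow> bool" where
  "is_chart X c \<longleftrightarrow> openin X (cdom c) \<and> closed_subspace (model c) \<and>
     openin (top_of_set (model c)) (cmap c ` cdom c) \<and>
     homeomorphic_map (subtopology X (cdom c)) (top_of_set (cmap c ` cdom c)) (cmap c)"

definition compatible :: "('m, 'e::banach) chart \<Rightarrow> ('m, 'e) chart \<Rightarrow> bool" where
  "compatible c d \<longleftrightarrow>
     real_analytic_on (model c) (cmap c ` (cdom c \<inter> cdom d)) (cmap d \<circ> cinv c) \<and>
     real_analytic_on (model d) (cmap d ` (cdom c \<inter> cdom d)) (cmap c \<circ> cinv d)"

definition real_analytic_manifold :: "('m, 'e::banach) manifold \<Rightarrow> bool" where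
  "real_analytic_manifold M \<longleftrightarrow> Hausdorff_space (mtop M) \<and>
     (\<forall>c\<in>atlas M. is_chart (mtop M) c) \<and>
     (\<Union>c\<in>atlas M. cdom c) = topspace (mtop M) \<and>
     (\<forall>c\<in>atlas M. \<forall>d\<in>atlas M. compatible c d)"

definition maximal_atlas :: "('m, 'e::banach) manifold \<Rightarrow> ('m, 'e) chart set" where
  "maximal_atlas M = {c. is_chart (mtop M) c \<and> (\<forall>d\<in>atlas M. compatible c d)}"

definition real_analytic_map ::
  "('m, 'e::banach) manifold \<Rightarrow> ('n, 'f::banach) manifold \<Rightarrow> ('m \<Rightarrow> 'n) \<Rightarrow> bool" where
  "real_analytic_map M N f \<longleftrightarrow> continuous_map (mtop M) (mtop N) f \<and>
     (\<forall>c\<in>atlas M. \<forall>d\<in>atlas N.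
        real_analytic_on (model c) (cmap c ` {x \<in> cdom c. f x \<in> cdom d}) (cmap d \<circ> f \<circ> cinv c))"

text \<open>In charts \<open>c\<close> at \<open>p\<close> and \<open>d\<close> at \<open>f p\<close>, the tangent map of \<open>f\<close> at \<open>p\<close> is the derivative
  \<open>D\<close> of the local representative, as a map from \<open>model c\<close> to \<open>model d\<close>.\<close>

definition submersion ::
  "('m, 'e::banach) manifold \<Rightarrow> ('n, 'f::banach) manifold \<Rightarrow> ('m \<Rightarrow> 'n) \<Rightarrow> bool" where
  "submersion M N f \<longleftrightarrow>
     (\<forall>p\<in>topspace (mtop M). \<forall>c\<in>atlas M. \<forall>d\<in>atlas N. p \<in> cdom c \<and> f p \<in> cdom d \<longrightarrow>
        (\<exists>D. has_derivative_along (model c) (cmap d \<circ> f \<circ> cinv c) D (cmap c p) \<and>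
             D ` model c = model d \<and>
             complemented_in (model c) {v \<in> model c. D v = 0}))"

definition banach_space_manifold :: "('e::banach, 'e) manifold" where
  "banach_space_manifold =
     \<lparr>mtop = euclidean, atlas = {\<lparr>cdom = UNIV, cmap = (\<lambda>x. x), model = UNIV\<rparr>}\<rparr>"

definition prod_manifold ::
  "('m, 'e::banach) manifold \<Rightarrow> ('n, 'f::banach) manifold \<Rightarrow> ('m \<times> 'n, 'e \<times> 'f) manifold" where
  "prod_manifold M N =
     \<lparr>mtop = prod_topology (mtop M) (mtop N),
      atlas = {\<lparr>cdom = cdom c \<times> cdom d, cmap = map_prod (cmap c) (cmap d), model = model c \<times> model d\<rparr>
               | c d. c \<in> atlas M \<and> d \<in> atlas N}\<rparr>"

text \<open>Submanifolds have closed complemented tangent spaces: near each of its points, the subset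
  is cut out by a closed complemented subspace \<open>W\<close> of the model space of a suitable chart.\<close>

definition submanifold_chart ::
  "('m, 'e::banach) manifold \<Rightarrow> 'm set \<Rightarrow> ('m, 'e) chart \<Rightarrow> 'e set \<Rightarrow> bool" where
  "submanifold_chart M S c W \<longleftrightarrow> c \<in> maximal_atlas M \<and> complemented_in (model c) W \<and>
     cmap c ` (cdom c \<inter> S) = cmap c ` cdom c \<inter> W"

definition is_submanifold :: "('m, 'e::banach) manifold \<Rightarrow> 'm set \<Rightarrow> bool" where
  "is_submanifold M S \<longleftrightarrow> S \<subseteq> topspace (mtop M) \<and>
     (\<forall>p\<in>S. \<exists>c W. p \<in> cdom c \<and> submanifold_chart M S c W)"

definition submanifold :: "('m, 'e::banach) manifold \<Rightarrow> 'm set \<Rightarrow> ('m, 'e) manifold" where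
  "submanifold M S =
     \<lparr>mtop = subtopology (mtop M) S,
      atlas = {\<lparr>cdom = cdom c \<inter> S, cmap = cmap c, model = W\<rparr> | c W. submanifold_chart M S c W}\<rparr>"


section \<open>Banach-Lie groups\<close>

definition real_analytic_Lie_group :: "'g monoid \<Rightarrow> ('g, 'e::banach) manifold \<Rightarrow> bool" where
  "real_analytic_Lie_group G M \<longleftrightarrow> group G \<and> real_analytic_manifold M \<and>
     topspace (mtop M) = carrier G \<and>
     real_analytic_map (prod_manifold M M) M (\<lambda>(x, y). x \<otimes>\<^bsub>G\<^esub> y) \<and>
     real_analytic_map M M (\<lambda>x. inv\<^bsub>G\<^esub> x)"

definition Lie_group_iso ::
  "'g monoid \<Rightarrow> ('g, 'e::banach) manifold \<Rightarrow> 'h monoid \<Rightarrow> ('h, 'f::banach) manifold \<Rightarrow> ('g \<Rightarrow> 'h) \<Rightarrow> bool" where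
  "Lie_group_iso G M H N f \<longleftrightarrow> f \<in> iso G H \<and> real_analytic_map M N f \<and>
     real_analytic_map N M (inv_into (carrier G) f)"


section \<open>Groupoids\<close>

record ('g, 'm) groupoid =
  arrows :: "'g set"
  objects :: "'m set"
  src :: "'g \<Rightarrow> 'm"
  tgt :: "'g \<Rightarrow> 'm"
  gmult :: "'g \<Rightarrow> 'g \<Rightarrow> 'g"
  gid :: "'m \<Rightarrow> 'g"
  ginv :: "'g \<Rightarrow> 'g"

definition composable :: "('g, 'm) groupoid \<Rightarrow> ('g \<times> 'g) set" where
  "composable \<Gamma> = {(g, h). g \<in> arrows \<Gamma> \<and> h \<in> arrows \<Gamma> \<and> src \<Gamma> g = tgt \<Gamma> h}"

definition is_groupoid :: "('g, 'm) groupoid \<Rightarrow> bool" where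
  "is_groupoid \<Gamma> \<longleftrightarrow>
     (\<forall>g\<in>arrows \<Gamma>. src \<Gamma> g \<in> objects \<Gamma> \<and> tgt \<Gamma> g \<in> objects \<Gamma>) \<and>
     (\<forall>(g, h)\<in>composable \<Gamma>. gmult \<Gamma> g h \<in> arrows \<Gamma> \<and>
        src \<Gamma> (gmult \<Gamma> g h) = src \<Gamma> h \<and> tgt \<Gamma> (gmult \<Gamma> g h) = tgt \<Gamma> g) \<and>
     (\<forall>g h k. (g, h) \<in> composable \<Gamma> \<longrightarrow> (h, k) \<in> composable \<Gamma> \<longrightarrow>
        gmult \<Gamma> (gmult \<Gamma> g h) k = gmult \<Gamma> g (gmult \<Gamma> h k)) \<and>
     (\<forall>x\<in>objects \<Gamma>. gid \<Gamma> x \<in> arrows \<Gamma> \<and> src \<Gamma> (gid \<Gamma> x) = x \<and> tgt \<Gamma> (gid \<Gamma> x) = x) \<and>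
     (\<forall>g\<in>arrows \<Gamma>. gmult \<Gamma> (gid \<Gamma> (tgt \<Gamma> g)) g = g \<and> gmult \<Gamma> g (gid \<Gamma> (src \<Gamma> g)) = g) \<and>
     (\<forall>g\<in>arrows \<Gamma>. ginv \<Gamma> g \<in> arrows \<Gamma> \<and>
        src \<Gamma> (ginv \<Gamma> g) = tgt \<Gamma> g \<and> tgt \<Gamma> (ginv \<Gamma> g) = src \<Gamma> g \<and>
        gmult \<Gamma> g (ginv \<Gamma> g) = gid \<Gamma> (tgt \<Gamma> g) \<and> gmult \<Gamma> (ginv \<Gamma> g) g = gid \<Gamma> (src \<Gamma> g))"

definition topological_groupoid :: "('g, 'm) groupoid \<Rightarrow> 'g topology \<Rightarrow> 'm topology \<Rightarrow> bool" where
  "topological_groupoid \<Gamma> X Y \<longleftrightarrow> is_groupoid \<Gamma> \<and>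
     topspace X = arrows \<Gamma> \<and> topspace Y = objects \<Gamma> \<and>
     continuous_map X Y (src \<Gamma>) \<and> continuous_map X Y (tgt \<Gamma>) \<and>
     continuous_map (subtopology (prod_topology X X) (composable \<Gamma>)) X (\<lambda>(g, h). gmult \<Gamma> g h) \<and>
     continuous_map Y X (gid \<Gamma>) \<and> continuous_map X X (ginv \<Gamma>) \<and>
     open_map X Y (src \<Gamma>) \<and> open_map X Y (tgt \<Gamma>) \<and>
     src \<Gamma> ` arrows \<Gamma> = objects \<Gamma> \<and> tgt \<Gamma> ` arrows \<Gamma> = objects \<Gamma> \<and>
     embedding_map Y X (gid \<Gamma>)"

text \<open>Surjectivity of the source map is part of \<open>topological_groupoid\<close>. The multiplication is
  defined on the set of composable pairs, with its structure of a submanifold of the product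
  manifold. Real analytic manifolds and maps are in particular smooth, so the smoothness
  requirements on a Banach-Lie groupoid are subsumed by the analytic ones.\<close>

definition real_analytic_Lie_groupoid ::
  "('g, 'm) groupoid \<Rightarrow> ('g, 'e::banach) manifold \<Rightarrow> ('m, 'f::banach) manifold \<Rightarrow> bool" where
  "real_analytic_Lie_groupoid \<Gamma> G M \<longleftrightarrow>
     topological_groupoid \<Gamma> (mtop G) (mtop M) \<and>
     real_analytic_manifold G \<and> real_analytic_manifold M \<and>
     submersion G M (src \<Gamma>) \<and>
     real_analytic_map G M (src \<Gamma>) \<and> real_analytic_map G M (tgt \<Gamma>) \<and>
     real_analytic_map M G (gid \<Gamma>) \<and> real_analytic_map G G (ginv \<Gamma>) \<and>
     is_submanifold (prod_manifold G G) (composable \<Gamma>) \<and>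
     real_analytic_map (submanifold (prod_manifold G G) (composable \<Gamma>)) G (\<lambda>(g, h). gmult \<Gamma> g h)"

definition orbit :: "('g, 'm) groupoid \<Rightarrow> 'm \<Rightarrow> 'm set" where
  "orbit \<Gamma> x = tgt \<Gamma> ` {g \<in> arrows \<Gamma>. src \<Gamma> g = x}"

definition locally_transitive :: "('g, 'm) groupoid \<Rightarrow> 'm topology \<Rightarrow> bool" where
  "locally_transitive \<Gamma> Y \<longleftrightarrow> (\<forall>x\<in>objects \<Gamma>. openin Y (orbit \<Gamma> x))"

definition isotropy_group :: "('g, 'm) groupoid \<Rightarrow> 'm \<Rightarrow> 'g monoid" where
  "isotropy_group \<Gamma> x =
     \<lparr>carrier = {g \<in> arrows \<Gamma>. src \<Gamma> g = x \<and> tgt \<Gamma> g = x}, monoid.mult = gmult \<Gamma>, one = gid \<Gamma> x\<rparr>"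


section \<open>The groupoid of a unital Banach algebra\<close>

text \<open>The sort \<open>{real_normed_algebra, monoid_mult, banach}\<close> describes unital associative Banach
  algebras with submultiplicative norm. Unlike \<open>real_normed_algebra_1\<close> it neither requires the
  unit to have norm \<open>1\<close> nor to be nonzero.\<close>

definition idempotents :: "'a::{real_normed_algebra, monoid_mult, banach} set" where
  "idempotents = {a. a ^ 2 = a}"

definition inverse_pairs :: "('a::{real_normed_algebra, monoid_mult, banach} \<times> 'a) set" where
  "inverse_pairs = {(a, b). a * b * a = a \<and> b * a * b = b}"

definition algebra_groupoid ::
  "('a::{real_normed_algebra, monoid_mult, banach} \<times> 'a, 'a) groupoid" where
  "algebra_groupoid =
     \<lparr>arrows = inverse_pairs, objects = idempotents,
      src = (\<lambda>(a, b). b * a), tgt = (\<lambda>(a, b). a * b),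
      gmult = (\<lambda>(a1, b1) (a2, b2). (a1 * a2, b2 * b1)),
      gid = (\<lambda>q. (q, q)), ginv = (\<lambda>(a, b). (b, a))\<rparr>"

definition idempotents_manifold ::
  "('a::{real_normed_algebra, monoid_mult, banach}, 'a) manifold" where
  "idempotents_manifold = submanifold banach_space_manifold idempotents"

definition inverse_pairs_manifold ::
  "('a::{real_normed_algebra, monoid_mult, banach} \<times> 'a, 'a \<times> 'a) manifold" where
  "inverse_pairs_manifold = submanifold banach_space_manifold inverse_pairs"

definition unit_group :: "'a::{real_normed_algebra, monoid_mult, banach} monoid" where
  "unit_group = \<lparr>carrier = {a. \<exists>b. a * b = 1 \<and> b * a = 1}, monoid.mult = (*), one = 1\<rparr>"

definition unit_group_manifold ::
  "('a::{real_normed_algebra, monoid_mult, banach}, 'a) manifold" where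
  "unit_group_manifold = submanifold banach_space_manifold (carrier unit_group)"

definition isotropy_group_one ::
  "('a::{real_normed_algebra, monoid_mult, banach} \<times> 'a) monoid" where
  "isotropy_group_one = isotropy_group algebra_groupoid 1"

definition isotropy_group_one_manifold ::
  "('a::{real_normed_algebra, monoid_mult, banach} \<times> 'a, 'a \<times> 'a) manifold" where
  "isotropy_group_one_manifold = submanifold inverse_pairs_manifold (carrier isotropy_group_one)"

end

theory Submission
  imports Defs
begin

text \<open>
All spaces in the theorem are subsets of Banach spaces, and all structure maps are restrictions of
maps that are polynomial, or rational with inverses of the algebra as denominators, on the ambient
space. Such maps are analytic because the product is a polynomial of degree two and inversion is
given by the Neumann series. Two things remain: to straighten the subsets by analytic
diffeomorphisms of the ambient space, and to pass from ambient analyticity to the charts.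

\<^emph>\<open>Straightening.\<close> All diffeomorphisms have explicit rational inverses.
\<^item> Near an idempotent \<open>q\<close>, put \<open>j = 2q - 1\<close>. The Cayley transform \<open>w\<close> of \<open>(2a - 1) j\<close> satisfies
  \<open>j w + w j = 0\<close> exactly when \<open>a\<close> is idempotent (\<open>idempotents_straightened\<close>).
\<^item> Near \<open>(a0, b0)\<close>, Gaussian elimination with respect to the idempotents \<open>a0 b0\<close> and \<open>b0 a0\<close> writes
  \<open>a\<close> as \<open>u (a0 + d) v\<close> with triangular invertible \<open>u\<close>, \<open>v\<close>. For \<open>(a, b)\<close> close to \<open>(a0, b0)\<close>, being an
  inverse pair means that \<open>d = 0\<close> and that \<open>v b u\<close> is a partner of \<open>a0\<close>; the partners of \<open>a0\<close> form a
  graph over a linear space. The same coordinates straighten the fibre of the target map through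
  \<open>(a0, b0)\<close> (\<open>inverse_pairs_straightened\<close>).
\<^item> For idempotents \<open>p\<close> near \<open>q\<close>, the element \<open>p q + (1 - p) (1 - q)\<close> is invertible and conjugates \<open>q\<close>
  into \<open>p\<close>. Conjugation turns the pairs \<open>(g, h)\<close> with \<open>s(g) = t(h)\<close> into a product of the space of
  arrows with one fixed target fibre (\<open>composable_straightened\<close>). The same element yields analytic
  local sections of source and target (\<open>source_has_local_section\<close>,
  \<open>target_has_local_section\<close>); hence these maps are open, the source map is a submersion, and
  orbits are open.

\<^emph>\<open>Charts.\<close> The atlas of a submanifold is cut out by all charts of a maximal atlas, whose model
spaces may be any closed subspaces. Every such chart extends locally to an analytic map
of the ambient space, and its inverse is analytic into the ambient space
(\<open>compatible_imp_embedded_chart\<close>). It follows that the local representative of a map that is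
ambient analytic is a composite of analytic maps through whole Banach spaces, so the substitution
of power series (\<open>analytic_at_compose\<close>) applies (\<open>embedded_real_analytic_map\<close>). The submersion
property follows from a section because, in charts, the derivative of the section is a bounded
right inverse of the derivative of the map (\<open>local_sections_submersion\<close>).
\<close>

section \<open>Power series along a subspace\<close>

text \<open>Analyticity is studied one point at a time; the bundled predicate names the data \<open>m\<close>, \<open>C\<close>, \<open>r\<close> of
one expansion, so that they can be combined with those of another one.\<close>

definition power_series ::
  "'e::real_normed_vector set \<Rightarrow> ('e \<Rightarrow> 'f::real_normed_vector) \<Rightarrow> 'e \<Rightarrow>
    (nat \<Rightarrow> 'e list \<Rightarrow> 'f) \<Rightarrow> (nat \<Rightarrow> real) \<Rightarrow> real \<Rightarrow> bool" where
  "power_series V f x m C r \<longleftrightarrow> r > 0 \<and>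
        (\<forall>n. multilinear_along V n (m n)) \<and>
        (\<forall>n. C n \<ge> 0) \<and>
        (\<forall>n xs. set xs \<subseteq> V \<and> length xs = n \<longrightarrow> norm (m n xs) \<le> C n * prod_list (map norm xs)) \<and>
        summable (\<lambda>n. C n * r ^ n) \<and>
        (\<forall>h\<in>V. norm h < r \<longrightarrow> (\<lambda>n. m n (replicate n h)) sums f (x + h))"

definition analytic_at :: "'e::real_normed_vector set \<Rightarrow> ('e \<Rightarrow> 'f::real_normed_vector) \<Rightarrow> 'e \<Rightarrow> bool" where
  "analytic_at V f x \<longleftrightarrow> (\<exists>m C r. power_series V f x m C r)"

lemma power_seriesD:
  assumes "power_series V f x m C r"
  shows "r > 0" "\<And>n. multilinear_along V n (m n)" "\<And>n. C n \<ge> 0"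
    "\<And>n xs. set xs \<subseteq> V \<Longrightarrow> length xs = n \<Longrightarrow> norm (m n xs) \<le> C n * prod_list (map norm xs)"
    "summable (\<lambda>n. C n * r ^ n)"
    "\<And>h. h \<in> V \<Longrightarrow> norm h < r \<Longrightarrow> (\<lambda>n. m n (replicate n h)) sums f (x + h)"
  using assms unfolding power_series_def by auto

lemma analytic_atI:
  assumes "r > 0" "\<And>n. multilinear_along V n (m n)" "\<And>n. C n \<ge> 0"
    "\<And>n xs. set xs \<subseteq> V \<Longrightarrow> length xs = n \<Longrightarrow> norm (m n xs) \<le> C n * prod_list (map norm xs)"
    "summable (\<lambda>n. C n * r ^ n)"
    "\<And>h. h \<in> V \<Longrightarrow> norm h < r \<Longrightarrow> (\<lambda>n. m n (replicate n h)) sums f (x + h)"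
  shows "analytic_at V f x"
  unfolding analytic_at_def power_series_def
  by (rule exI[of _ m], rule exI[of _ C], rule exI[of _ r]) (simp add: assms)

lemma summable_smaller_radius:
  fixes C :: "nat \<Rightarrow> real"
  assumes "summable (\<lambda>n. C n * r ^ n)" "0 \<le> s" "s \<le> r" "\<And>n. C n \<ge> 0"
  shows "summable (\<lambda>n. C n * s ^ n)"
proof (rule summable_comparison_test'[OF assms(1), of 0])
  show "norm (C n * s ^ n) \<le> C n * r ^ n" for n
    using assms by (auto simp: abs_mult intro!: mult_mono power_mono)
qed

lemma analytic_at_cong:
  assumes "analytic_at V f x" "e > 0" "\<And>h. h \<in> V \<Longrightarrow> norm h < e \<Longrightarrow> g (x + h) = f (x + h)"
  shows "analytic_at V g x"
proof -
  obtain m C r where "power_series V f x m C r"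
    using assms(1) unfolding analytic_at_def by blast
  note * = power_seriesD[OF this]
  show ?thesis
  proof (rule analytic_atI[of "min r e" V m C])
    show "summable (\<lambda>n. C n * min r e ^ n)"
      using *(1,3) assms(2) by (intro summable_smaller_radius[OF *(5)]) auto
  qed (use assms in \<open>simp_all add: *\<close>)
qed

lemma analytic_at_cong_nhds:
  assumes "analytic_at V f x" "subspace V" "x \<in> V" "\<forall>\<^sub>F y in nhds x. y \<in> V \<longrightarrow> g y = f y"
  shows "analytic_at V g x"
proof -
  obtain e where "e > 0" and e: "\<And>y. dist y x < e \<Longrightarrow> y \<in> V \<longrightarrow> g y = f y"
    using assms(4) unfolding eventually_nhds_metric by auto
  show ?thesis
    by (rule analytic_at_cong[OF assms(1) \<open>e > 0\<close>])
      (use e assms(2,3) in \<open>auto simp: dist_norm subspace_add\<close>)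
qed

lemma analytic_at_subspace:
  assumes "analytic_at V f x" "W \<subseteq> V"
  shows "analytic_at W f x"
proof -
  obtain m C r where "power_series V f x m C r"
    using assms(1) unfolding analytic_at_def by blast
  note * = power_seriesD[OF this]
  have ml: "multilinear_along W n (m n)" for n
    using *(2)[of n] assms(2) unfolding multilinear_along_def linear_along_def by blast
  show ?thesis
    by (rule analytic_atI[of r W m C, OF *(1) ml *(3) *(4) *(5) *(6)]) (use assms(2) in auto)
qed

text \<open>Openness of the domain takes care of the condition that the ball of convergence stays inside it:
the radius may be shrunk. So analyticity can be proved and used point by point.\<close>

lemma real_analytic_on_iff:
  assumes "subspace V"
  shows "real_analytic_on V U f \<longleftrightarrow> openin (top_of_set V) U \<and> (\<forall>x\<in>U. analytic_at V f x)"
proof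
  assume A: "real_analytic_on V U f"
  show "openin (top_of_set V) U \<and> (\<forall>x\<in>U. analytic_at V f x)"
  proof (intro conjI ballI)
    show "openin (top_of_set V) U" using A unfolding real_analytic_on_def by (rule conjunct1)
    fix x assume "x \<in> U"
    from bspec[OF conjunct2[OF A[unfolded real_analytic_on_def]] this]
    show "analytic_at V f x"
      unfolding analytic_at_def power_series_def by (elim ex_forward) simp
  qed
next
  assume R: "openin (top_of_set V) U \<and> (\<forall>x\<in>U. analytic_at V f x)"
  show "real_analytic_on V U f"
    unfolding real_analytic_on_def
  proof (intro conjI ballI)
    show "openin (top_of_set V) U" using R by blast
    fix x assume x: "x \<in> U"
    obtain e where "e > 0" and e: "\<And>y. y \<in> V \<Longrightarrow> dist y x < e \<Longrightarrow> y \<in> U"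
      using R x unfolding openin_euclidean_subtopology_iff by blast
    have xV: "x \<in> V" using R x openin_imp_subset by fastforce
    obtain m C r where "power_series V f x m C r"
      using R x unfolding analytic_at_def by blast
    note * = power_seriesD[OF this]
    have "summable (\<lambda>n. C n * min r e ^ n)"
      using *(1,3) \<open>e > 0\<close> by (intro summable_smaller_radius[OF *(5)]) auto
    moreover have "x + h \<in> U" if "h \<in> V" "norm h < e" for h
      using e[of "x + h"] that xV assms by (auto simp: dist_norm subspace_add)
    ultimately show "\<exists>m C r. r > 0 \<and>
        (\<forall>n. multilinear_along V n (m n)) \<and>
        (\<forall>n. C n \<ge> 0) \<and>
        (\<forall>n xs. set xs \<subseteq> V \<and> length xs = n \<longrightarrow> norm (m n xs) \<le> C n * prod_list (map norm xs)) \<and>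
        summable (\<lambda>n. C n * r ^ n) \<and>
        (\<forall>h\<in>V. norm h < r \<longrightarrow> x + h \<in> U \<and> (\<lambda>n. m n (replicate n h)) sums f (x + h))"
      using \<open>e > 0\<close>
      by (intro exI[of _ m] exI[of _ C] exI[of _ "min r e"]) (simp add: *)
  qed
qed

lemma prod_list_map_replicate:
  "prod_list (map f (replicate n (h::'b))) = (f h :: 'c::comm_monoid_mult) ^ n"
  by (induction n) auto

text \<open>Taylor's estimate. The constant is the majorant with its first \<open>k\<close> coefficients removed, so it does
not depend on \<open>t\<close>; the cases \<open>k = 1\<close> and \<open>k = 2\<close> give continuity and differentiability.\<close>

lemma power_series_remainder:
  assumes "0 < r" "\<And>n. (C n :: real) \<ge> 0" "\<And>n. norm (m n) \<le> C n * t ^ n"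
    "summable (\<lambda>n. C n * r ^ n)" "m sums S" "0 \<le> t" "t \<le> r"
  shows "norm (S - (\<Sum>i<k. m i)) \<le> (\<Sum>n. C (n + k) * r ^ n) * t ^ k"
proof -
  have "summable (\<lambda>n. C (n + k) * r ^ (n + k))"
    using assms(4) summable_iff_shift[of "\<lambda>n. C n * r ^ n" k] by simp
  then have "summable (\<lambda>n. (C (n + k) * r ^ (n + k)) * inverse (r ^ k))"
    by (rule summable_mult2)
  then have s0: "summable (\<lambda>n. C (n + k) * r ^ n)"
    using assms(1) by (simp add: power_add mult.assoc)
  then have s1: "summable (\<lambda>n. C (n + k) * r ^ n * t ^ k)" by (rule summable_mult2)
  have sh: "(\<lambda>n. m (n + k)) sums (S - (\<Sum>i<k. m i))"
    using assms(5) by (simp add: sums_iff_shift)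
  have "norm (m (n + k)) \<le> C (n + k) * r ^ n * t ^ k" for n
  proof -
    have "norm (m (n + k)) \<le> C (n + k) * t ^ (n + k)" by (rule assms(3))
    also have "\<dots> = C (n + k) * t ^ n * t ^ k" by (simp add: power_add)
    also have "\<dots> \<le> C (n + k) * r ^ n * t ^ k"
      using assms by (intro mult_right_mono mult_left_mono power_mono) auto
    finally show ?thesis .
  qed
  note le = this
  have "norm (S - (\<Sum>i<k. m i)) \<le> (\<Sum>n. C (n + k) * r ^ n * t ^ k)"
  proof (rule LIMSEQ_le_const2[OF tendsto_norm[OF sh[unfolded sums_def]]], intro exI[of _ 0] allI impI)
    fix N :: nat
    have "norm (\<Sum>n<N. m (n + k)) \<le> (\<Sum>n<N. C (n + k) * r ^ n * t ^ k)"
      by (rule sum_norm_le) (rule le)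
    also have "\<dots> \<le> (\<Sum>n. C (n + k) * r ^ n * t ^ k)"
      using assms by (intro sum_le_suminf[OF s1]) auto
    finally show "norm (\<Sum>n<N. m (n + k)) \<le> (\<Sum>n. C (n + k) * r ^ n * t ^ k)" .
  qed
  then show ?thesis
    using s0 by (simp add: suminf_mult2[symmetric])
qed

lemma power_series_at_zero:
  assumes "\<And>n xs. set xs \<subseteq> V \<Longrightarrow> length xs = n \<Longrightarrow> norm (m n xs) \<le> C n * prod_list (map norm xs)"
    and "(\<lambda>n. m n (replicate n 0)) sums S" "0 \<in> V"
  shows "S = m 0 []"
proof -
  have "m n (replicate n 0) = 0" if "n > 0" for n
    using assms(1)[of "replicate n 0" n] assms(3) that
    by (auto simp: prod_list_map_replicate zero_power)
  then have "(\<lambda>n. m n (replicate n 0)) sums (\<Sum>n\<in>{0}. m n (replicate n 0))"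
    by (intro sums_finite) auto
  then show ?thesis using assms(2) sums_unique2 by force
qed

lemma linear_along_zero: "linear_along V D \<Longrightarrow> 0 \<in> V \<Longrightarrow> D 0 = 0"
  unfolding linear_along_def by (metis scale_zero_left)

lemma linear_along_diff:
  assumes "linear_along V D" "subspace V" "x \<in> V" "y \<in> V"
  shows "D (x - y) = D x - D y"
proof -
  have "D (x + (- 1) *\<^sub>R y) = D x + (- 1) *\<^sub>R D y"
    using assms unfolding linear_along_def by (metis subspace_scale)
  then show ?thesis by simp
qed

section \<open>Derivatives along a subspace\<close>

lemma norm_div_norm: "norm (z /\<^sub>R norm w) = norm z / norm w"
  by (simp add: divide_inverse mult.commute)

text \<open>The derivative is the linear term: by Taylor's estimate the rest is quadratic in the increment.\<close>

lemma analytic_at_imp_derivative: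
  assumes "analytic_at V f x" "subspace V" "x \<in> V"
  obtains D where "has_derivative_along V f D x"
proof -
  obtain m C r where "power_series V f x m C r"
    using assms(1) unfolding analytic_at_def by blast
  note * = power_seriesD[OF this]
  define K where "K = (\<Sum>n. C (n + 2) * r ^ n)"
  have V0: "0 \<in> V" using assms(2) subspace_0 by blast
  have fx: "f x = m 0 []"
    using power_series_at_zero[OF *(4) *(6)[of 0, simplified]] V0 *(1) by auto
  have lin: "linear_along V (\<lambda>h. m 1 [h])"
    using *(2)[of 1, unfolded multilinear_along_def, rule_format, of "[]" "[]"] by simp
  have bd: "norm (m 1 [v]) \<le> C 1 * norm v" if "v \<in> V" for v
    using *(4)[of "[v]" 1] that by simp
  have est: "norm (f y - f x - m 1 [y - x]) \<le> K * norm (y - x) ^ 2"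
    if y: "y \<in> V" "norm (y - x) < r" for y
  proof -
    let ?h = "y - x"
    have h: "?h \<in> V" using y assms by (simp add: subspace_diff)
    have "norm (f y - (\<Sum>i<2. m i (replicate i ?h))) \<le> K * norm ?h ^ 2"
      unfolding K_def
    proof (rule power_series_remainder[OF *(1,3)])
      show "norm (m n (replicate n ?h)) \<le> C n * norm ?h ^ n" for n
        using *(4)[of "replicate n ?h" n] h by (auto simp: prod_list_map_replicate set_replicate_conv_if)
      show "(\<lambda>n. m n (replicate n ?h)) sums f y" using *(6)[OF h] y by simp
    qed (use *(1,5) y in auto)
    moreover have "(\<Sum>i<2. m i (replicate i ?h)) = f x + m 1 [?h]"
      by (simp add: fx numeral_2_eq_2)
    ultimately show ?thesis by (simp add: algebra_simps)
  qed
  have "((\<lambda>y. (f y - f x - m 1 [y - x]) /\<^sub>R norm (y - x)) \<longlongrightarrow> 0) (at x within V)"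
  proof (rule tendsto_norm_zero_cancel, rule tendsto_sandwich[of "\<lambda>_. 0" _ _ "\<lambda>y. K * norm (y - x)"])
    show "\<forall>\<^sub>F y in at x within V. norm ((f y - f x - m 1 [y - x]) /\<^sub>R norm (y - x)) \<le> K * norm (y - x)"
      unfolding eventually_at
    proof (intro exI[of _ r] conjI ballI impI *(1))
      fix y assume y: "y \<in> V" "y \<noteq> x \<and> dist y x < r"
      then show "norm ((f y - f x - m 1 [y - x]) /\<^sub>R norm (y - x)) \<le> K * norm (y - x)"
        using est[of y] unfolding norm_div_norm
        by (simp add: dist_norm divide_le_eq power2_eq_square mult.assoc)
    qed
    have "((\<lambda>y. K * norm (y - x)) \<longlongrightarrow> K * norm (x - x)) (at x within V)"
      by (intro tendsto_intros)
    then show "((\<lambda>y. K * norm (y - x)) \<longlongrightarrow> 0) (at x within V)" by simp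
  qed auto
  then have "has_derivative_along V f (\<lambda>h. m 1 [h]) x"
    unfolding has_derivative_along_def using lin bd by blast
  then show thesis by (rule that)
qed

text \<open>In this form the increment \<open>0\<close> is allowed, which the punctured limit of the definition leaves out;
it is harmless because linear maps vanish at \<open>0\<close>.\<close>

lemma has_derivative_alongD:
  assumes "has_derivative_along V f D x" "e > 0"
  obtains d where "d > 0"
    "\<And>y. y \<in> V \<Longrightarrow> norm (y - x) < d \<Longrightarrow> norm (f y - f x - D (y - x)) \<le> e * norm (y - x)"
proof -
  have "((\<lambda>y. (f y - f x - D (y - x)) /\<^sub>R norm (y - x)) \<longlongrightarrow> 0) (at x within V)"
    using assms(1) unfolding has_derivative_along_def by blast
  from tendstoD[OF this assms(2)]
  obtain d where d: "d > 0"
    "\<And>y. y \<in> V \<Longrightarrow> y \<noteq> x \<Longrightarrow> dist y x < d \<Longrightarrow> norm ((f y - f x - D (y - x)) /\<^sub>R norm (y - x)) < e"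
    unfolding eventually_at by auto
  show thesis
  proof (rule that[OF d(1)])
    fix y assume y: "y \<in> V" "norm (y - x) < d"
    have D: "linear_along V D" using assms(1) unfolding has_derivative_along_def by blast
    show "norm (f y - f x - D (y - x)) \<le> e * norm (y - x)"
    proof (cases "y = x")
      case True
      have "norm (D 0) = 0"
      proof (cases "0 \<in> V")
        case t: True then show ?thesis using linear_along_zero[OF D] by simp
      next
        case False
        have "D (0 *\<^sub>R x) = 0 *\<^sub>R D x"
          using D y True unfolding linear_along_def by blast
        then show ?thesis by simp
      qed
      then show ?thesis using True by simp
    next
      case False
      then show ?thesis using d(2)[of y] y unfolding norm_div_norm
        by (simp add: dist_norm pos_divide_less_eq)
    qed
  qed
qed

lemma has_derivative_alongI:
  assumes "linear_along V D" "\<And>v. v \<in> V \<Longrightarrow> norm (D v) \<le> K * norm v"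
    "\<And>e. e > 0 \<Longrightarrow> \<exists>d>0. \<forall>y\<in>V. norm (y - x) < d \<longrightarrow> norm (f y - f x - D (y - x)) \<le> e * norm (y - x)"
  shows "has_derivative_along V f D x"
  unfolding has_derivative_along_def
proof (intro conjI)
  show "((\<lambda>y. (f y - f x - D (y - x)) /\<^sub>R norm (y - x)) \<longlongrightarrow> 0) (at x within V)"
  proof (rule tendstoI)
    fix e :: real assume "e > 0"
    then obtain d where d: "d > 0"
      "\<forall>y\<in>V. norm (y - x) < d \<longrightarrow> norm (f y - f x - D (y - x)) \<le> e/2 * norm (y - x)"
      using assms(3)[of "e/2"] by auto
    show "\<forall>\<^sub>F y in at x within V. dist ((f y - f x - D (y - x)) /\<^sub>R norm (y - x)) 0 < e"
      unfolding eventually_at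
    proof (intro exI[of _ d] conjI ballI impI d(1))
      fix y assume y: "y \<in> V" "y \<noteq> x \<and> dist y x < d"
      then have "norm (f y - f x - D (y - x)) \<le> e/2 * norm (y - x)"
        using d(2) by (simp add: dist_norm)
      then have "norm ((f y - f x - D (y - x)) /\<^sub>R norm (y - x)) \<le> e/2"
        using y unfolding norm_div_norm by (simp add: divide_le_eq)
      then show "dist ((f y - f x - D (y - x)) /\<^sub>R norm (y - x)) 0 < e" using \<open>e > 0\<close> by simp
    qed
  qed
qed (use assms in auto)

lemma has_derivative_along_lipschitz:
  assumes "has_derivative_along V f D x" "subspace V" "x \<in> V"
  obtains d K where "d > 0" "K > 0"
    "\<And>y. y \<in> V \<Longrightarrow> norm (y - x) < d \<Longrightarrow> norm (f y - f x) \<le> K * norm (y - x)"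
    "\<And>v. v \<in> V \<Longrightarrow> norm (D v) \<le> K * norm v"
proof -
  obtain d where d: "d > 0"
    "\<And>y. y \<in> V \<Longrightarrow> norm (y - x) < d \<Longrightarrow> norm (f y - f x - D (y - x)) \<le> 1 * norm (y - x)"
    using has_derivative_alongD[OF assms(1), of 1] by auto
  obtain K where K: "\<And>v. v \<in> V \<Longrightarrow> norm (D v) \<le> K * norm v"
    using assms(1) unfolding has_derivative_along_def by blast
  show thesis
  proof (rule that[OF d(1), of "\<bar>K\<bar> + 1"])
    fix v assume "v \<in> V"
    have "K * norm v \<le> (\<bar>K\<bar> + 1) * norm v" by (intro mult_right_mono) auto
    then show "norm (D v) \<le> (\<bar>K\<bar> + 1) * norm v" using K[OF \<open>v \<in> V\<close>] by linarith
  next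
    fix y assume y: "y \<in> V" "norm (y - x) < d"
    have "norm (f y - f x) \<le> norm (f y - f x - D (y - x)) + norm (D (y - x))"
      by (metis diff_add_cancel norm_triangle_ineq)
    also have "\<dots> \<le> 1 * norm (y - x) + \<bar>K\<bar> * norm (y - x)"
    proof (intro add_mono d(2) y)
      have "norm (D (y - x)) \<le> K * norm (y - x)" using K assms y by (simp add: subspace_diff)
      also have "\<dots> \<le> \<bar>K\<bar> * norm (y - x)" by (intro mult_right_mono) auto
      finally show "norm (D (y - x)) \<le> \<bar>K\<bar> * norm (y - x)" .
    qed
    finally show "norm (f y - f x) \<le> (\<bar>K\<bar> + 1) * norm (y - x)" by (simp add: algebra_simps)
  qed auto
qed

lemma analytic_at_imp_continuous:
  assumes "analytic_at V f x" "subspace V" "x \<in> V"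
  shows "continuous (at x within V) f"
proof -
  obtain D where D: "has_derivative_along V f D x" using analytic_at_imp_derivative[OF assms] .
  obtain d K where dK: "d > 0" "K > 0"
    "\<And>y. y \<in> V \<Longrightarrow> norm (y - x) < d \<Longrightarrow> norm (f y - f x) \<le> K * norm (y - x)"
    using has_derivative_along_lipschitz[OF D assms(2,3)] by metis
  show ?thesis
    unfolding continuous_within_eps_delta
  proof (intro allI impI)
    fix e :: real assume "e > 0"
    show "\<exists>d>0. \<forall>x'\<in>V. dist x' x < d \<longrightarrow> dist (f x') (f x) < e"
    proof (intro exI[of _ "min d (e / K)"] conjI ballI impI)
      show "min d (e / K) > 0" using dK \<open>e > 0\<close> by simp
      fix y assume y: "y \<in> V" "dist y x < min d (e / K)"
      then have "norm (f y - f x) \<le> K * norm (y - x)" by (intro dK) (auto simp: dist_norm)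
      also have "\<dots> < e" using y dK by (simp add: dist_norm field_simps)
      finally show "dist (f y) (f x) < e" by (simp add: dist_norm)
    qed
  qed
qed

text \<open>Values of a derivative are one-sided limits of difference quotients. This gives uniqueness, and it
shows that the derivative of a map into a closed subspace takes values there.\<close>

lemma has_derivative_along_quotient:
  assumes D: "has_derivative_along V f D x" and V: "subspace V" "x \<in> V" "v \<in> V"
  shows "((\<lambda>t. (f (x + t *\<^sub>R v) - f x) /\<^sub>R t) \<longlongrightarrow> D v) (at_right 0)"
proof (cases "v = 0")
  case True
  have "D 0 = 0" using D linear_along_zero subspace_0[OF V(1)] unfolding has_derivative_along_def by blast
  then show ?thesis using True by simp
next
  case False
  have lin: "linear_along V D" using D unfolding has_derivative_along_def by blast
  have "((\<lambda>t. x + t *\<^sub>R v) \<longlongrightarrow> x + 0 *\<^sub>R v) (at_right 0)" by (intro tendsto_intros)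
  moreover have "\<forall>\<^sub>F t in at_right (0::real). x + t *\<^sub>R v \<in> V \<and> x + t *\<^sub>R v \<noteq> x"
    using eventually_at_right_less[of 0]
    by eventually_elim (use V False in \<open>auto simp: subspace_add subspace_scale\<close>)
  ultimately have "filterlim (\<lambda>t. x + t *\<^sub>R v) (at x within V) (at_right 0)" by (simp add: filterlim_at)
  moreover have "((\<lambda>y. (f y - f x - D (y - x)) /\<^sub>R norm (y - x)) \<longlongrightarrow> 0) (at x within V)"
    using D unfolding has_derivative_along_def by blast
  ultimately have "((\<lambda>t. (f (x + t *\<^sub>R v) - f x - D (t *\<^sub>R v)) /\<^sub>R norm (t *\<^sub>R v)) \<longlongrightarrow> 0) (at_right 0)"
    using filterlim_compose by fastforce
  from tendsto_scaleR[OF tendsto_const[of "norm v"] this]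
  have "((\<lambda>t. norm v *\<^sub>R ((f (x + t *\<^sub>R v) - f x - D (t *\<^sub>R v)) /\<^sub>R norm (t *\<^sub>R v))) \<longlongrightarrow> 0) (at_right 0)"
    by simp
  then have "((\<lambda>t. (f (x + t *\<^sub>R v) - f x) /\<^sub>R t - D v) \<longlongrightarrow> 0) (at_right 0)"
  proof (rule Lim_transform_eventually)
    show "\<forall>\<^sub>F t in at_right 0. norm v *\<^sub>R ((f (x + t *\<^sub>R v) - f x - D (t *\<^sub>R v)) /\<^sub>R norm (t *\<^sub>R v))
        = (f (x + t *\<^sub>R v) - f x) /\<^sub>R t - D v"
      using eventually_at_right_less[of 0]
    proof eventually_elim
      case (elim t)
      have "D (t *\<^sub>R v) = t *\<^sub>R D v" using lin V(3) unfolding linear_along_def by blast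
      moreover have "norm v * inverse (norm (t *\<^sub>R v)) = inverse t" using elim False by (simp add: field_simps)
      ultimately show ?case using elim by (simp only: scaleR_scaleR) (simp add: scaleR_diff_right)
    qed
  qed
  then show ?thesis by (rule LIM_zero_cancel)
qed

lemma has_derivative_along_unique:
  assumes "has_derivative_along V f D x" "has_derivative_along V f D' x" "subspace V" "x \<in> V" "v \<in> V"
  shows "D v = D' v"
  by (rule tendsto_unique[OF trivial_limit_at_right_real
        has_derivative_along_quotient[OF assms(1,3-5)] has_derivative_along_quotient[OF assms(2,3-5)]])

lemma has_derivative_along_range:
  assumes D: "has_derivative_along V f D x" and V: "subspace V" "x \<in> V" and W: "subspace W" "closed W"
    and ev: "\<forall>\<^sub>F y in nhds x. y \<in> V \<longrightarrow> f y \<in> W" and v: "v \<in> V"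
  shows "D v \<in> W"
proof (rule Lim_in_closed_set[OF W(2) _ _ has_derivative_along_quotient[OF D V v]])
  have "((\<lambda>t. x + t *\<^sub>R v) \<longlongrightarrow> x + 0 *\<^sub>R v) (at_right 0)" by (intro tendsto_intros)
  from this[unfolded filterlim_iff, simplified, rule_format, OF ev]
  have ev': "\<forall>\<^sub>F t in at_right 0. x + t *\<^sub>R v \<in> V \<longrightarrow> f (x + t *\<^sub>R v) \<in> W" .
  have "f x \<in> W" using eventually_nhds_x_imp_x[OF ev] V(2) by blast
  then show "\<forall>\<^sub>F t in at_right 0. (f (x + t *\<^sub>R v) - f x) /\<^sub>R t \<in> W"
    using V v W by (intro eventually_mono[OF ev']) (simp add: subspace_add subspace_scale subspace_diff)
qed simp

lemma has_derivative_along_cong: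
  assumes D: "has_derivative_along V f D x" and "\<forall>\<^sub>F y in nhds x. y \<in> V \<longrightarrow> g y = f y" "x \<in> V"
  shows "has_derivative_along V g D x"
proof -
  have gx: "g x = f x" using eventually_nhds_x_imp_x[OF assms(2)] assms(3) by blast
  have "\<forall>\<^sub>F y in at x within V. (g y - g x - D (y - x)) /\<^sub>R norm (y - x) = (f y - f x - D (y - x)) /\<^sub>R norm (y - x)"
    using assms(2) unfolding eventually_at_filter by eventually_elim (auto simp: gx)
  from tendsto_cong[OF this] show ?thesis using D unfolding has_derivative_along_def by blast
qed

text \<open>The outer derivative is only linear along \<open>W\<close>, so the inner increments and the values of the inner
derivative must be known to lie in \<open>W\<close> before additivity may be used.\<close>

lemma has_derivative_along_chain:
  assumes f: "has_derivative_along V f D x" and g: "has_derivative_along W g E (f x)"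
    and V: "subspace V" "x \<in> V" and W: "subspace W" "closed W"
    and ev: "\<forall>\<^sub>F y in nhds x. y \<in> V \<longrightarrow> f y \<in> W"
  shows "has_derivative_along V (\<lambda>y. g (f y)) (\<lambda>v. E (D v)) x"
proof -
  have DW: "D v \<in> W" if "v \<in> V" for v
    by (rule has_derivative_along_range[OF f V W ev that])
  have fxW: "f x \<in> W" using eventually_nhds_x_imp_x[OF ev] V by blast
  have lin: "linear_along V D" "linear_along W E"
    using assms unfolding has_derivative_along_def by auto
  obtain d1 K where dK: "d1 > 0" "K > 0"
    "\<And>y. y \<in> V \<Longrightarrow> norm (y - x) < d1 \<Longrightarrow> norm (f y - f x) \<le> K * norm (y - x)"
    "\<And>v. v \<in> V \<Longrightarrow> norm (D v) \<le> K * norm v"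
    using has_derivative_along_lipschitz[OF f V] by metis
  obtain L where L: "L > 0" "\<And>v. v \<in> W \<Longrightarrow> norm (E v) \<le> L * norm v"
    using has_derivative_along_lipschitz[OF g W(1) fxW] by metis
  obtain d3 where d3: "d3 > 0" "\<And>y. dist y x < d3 \<Longrightarrow> y \<in> V \<Longrightarrow> f y \<in> W"
    using ev unfolding eventually_nhds_metric by auto
  show ?thesis
  proof (rule has_derivative_alongI[where K = "L * K"])
    show "linear_along V (\<lambda>v. E (D v))"
      using lin DW V unfolding linear_along_def by auto
    show "norm (E (D v)) \<le> L * K * norm v" if "v \<in> V" for v
    proof -
      have "norm (E (D v)) \<le> L * norm (D v)" using L DW that by blast
      also have "\<dots> \<le> L * (K * norm v)" using L dK that by (intro mult_left_mono) auto
      finally show ?thesis by simp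
    qed
    fix e :: real assume "e > 0"
    define e1 where "e1 = e / (2 * L)"
    define e2 where "e2 = e / (2 * K)"
    have e12: "e1 > 0" "e2 > 0" using \<open>e > 0\<close> L dK by (auto simp: e1_def e2_def)
    obtain d4 where d4: "d4 > 0"
      "\<And>y. y \<in> V \<Longrightarrow> norm (y - x) < d4 \<Longrightarrow> norm (f y - f x - D (y - x)) \<le> e1 * norm (y - x)"
      using has_derivative_alongD[OF f e12(1)] by metis
    obtain d5 where d5: "d5 > 0"
      "\<And>y. y \<in> W \<Longrightarrow> norm (y - f x) < d5 \<Longrightarrow> norm (g y - g (f x) - E (y - f x)) \<le> e2 * norm (y - f x)"
      using has_derivative_alongD[OF g e12(2)] by metis
    show "\<exists>d>0. \<forall>y\<in>V. norm (y - x) < d \<longrightarrow>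
        norm (g (f y) - g (f x) - E (D (y - x))) \<le> e * norm (y - x)"
    proof (intro exI[of _ "min (min d1 d3) (min d4 (d5 / K))"] conjI ballI impI)
      show "min (min d1 d3) (min d4 (d5 / K)) > 0" using dK d3 d4 d5 by simp
      fix y assume y: "y \<in> V" "norm (y - x) < min (min d1 d3) (min d4 (d5 / K))"
      have fy: "f y \<in> W" using d3 y by (simp add: dist_norm)
      have l: "norm (f y - f x) \<le> K * norm (y - x)" using dK y by simp
      moreover have "K * norm (y - x) < d5" using y dK by (simp add: field_simps)
      ultimately have "norm (g (f y) - g (f x) - E (f y - f x)) \<le> e2 * norm (f y - f x)"
        using d5 fy by auto
      also have "\<dots> \<le> e2 * (K * norm (y - x))" using l e12 by (intro mult_left_mono) auto
      also have "\<dots> = e / 2 * norm (y - x)" using dK by (simp add: e2_def)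
      finally have A: "norm (g (f y) - g (f x) - E (f y - f x)) \<le> e / 2 * norm (y - x)" .
      have yx: "y - x \<in> V" using y V by (simp add: subspace_diff)
      have fW: "f y - f x \<in> W" using fy fxW W by (simp add: subspace_diff)
      have "E (f y - f x) - E (D (y - x)) = E (f y - f x - D (y - x))"
        using linear_along_diff[OF lin(2) W(1) fW DW[OF yx]] by simp
      moreover have "norm (E (f y - f x - D (y - x))) \<le> L * norm (f y - f x - D (y - x))"
        using L fW DW[OF yx] W by (simp add: subspace_diff)
      moreover have "L * norm (f y - f x - D (y - x)) \<le> L * (e1 * norm (y - x))"
        using d4 y L by (intro mult_left_mono) auto
      moreover have "L * (e1 * norm (y - x)) = e / 2 * norm (y - x)" using L by (simp add: e1_def)
      ultimately have B: "norm (E (f y - f x) - E (D (y - x))) \<le> e / 2 * norm (y - x)" by simp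
      have "norm (g (f y) - g (f x) - E (D (y - x))) \<le>
          norm (g (f y) - g (f x) - E (f y - f x)) + norm (E (f y - f x) - E (D (y - x)))"
        using norm_triangle_ineq[of "g (f y) - g (f x) - E (f y - f x)" "E (f y - f x) - E (D (y - x))"]
        by simp
      then show "norm (g (f y) - g (f x) - E (D (y - x))) \<le> e * norm (y - x)" using A B by simp
    qed
  qed
qed

section \<open>Composition of power series\<close>

text \<open>Summation by the fibres of \<open>g\<close>. The terms of a composite series are indexed by lists of natural
numbers; grouping them by length gives the value of the composite, grouping them by total degree
gives its expansion into homogeneous terms.\<close>

lemma has_sum_fibres:
  fixes F :: "'i \<Rightarrow> 'a :: {topological_comm_monoid_add, t3_space}" and g :: "'i \<Rightarrow> 'j"
  assumes "(F has_sum S) UNIV" "\<And>j. (F has_sum G j) {i. g i = j}"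
  shows "(G has_sum S) UNIV"
proof -
  have bij: "bij_betw snd (Sigma UNIV (\<lambda>j. {i. g i = j})) UNIV"
    by (rule bij_betwI[of _ _ _ "\<lambda>i. (g i, i)"]) auto
  have "((\<lambda>p. F (snd p)) has_sum S) (Sigma UNIV (\<lambda>j. {i. g i = j}))"
    using has_sum_reindex_bij_betw[OF bij, of F S] assms(1) by simp
  then show ?thesis
    by (rule has_sum_SigmaD) (use assms(2) in simp)
qed

lemma summable_on_fibres:
  fixes F :: "'i \<Rightarrow> real" and g :: "'i \<Rightarrow> 'j"
  assumes "\<And>j. (F has_sum G j) {i. g i = j}" "G summable_on UNIV" "\<And>i. F i \<ge> 0"
  shows "F summable_on UNIV"
proof -
  have bij: "bij_betw snd (Sigma UNIV (\<lambda>j. {i. g i = j})) UNIV"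
    by (rule bij_betwI[of _ _ _ "\<lambda>i. (g i, i)"]) auto
  have "(\<lambda>p. F (snd p)) summable_on (Sigma UNIV (\<lambda>j. {i. g i = j}))"
    by (rule summable_on_SigmaI[where g = G]) (use assms in auto)
  then show ?thesis
    using summable_on_reindex_bij_betw[OF bij, of F] by simp
qed

lemma bij_betw_Cons_length:
  "bij_betw (\<lambda>(n, ns). n # ns) (Sigma UNIV (\<lambda>n. {ns. length ns = j})) {ns. length ns = Suc j}"
  by (rule bij_betwI[of _ _ _ "\<lambda>ns. (hd ns, tl ns)"]) (auto simp: length_Suc_conv)

lemma has_sum_prod_list:
  fixes c :: "nat \<Rightarrow> real"
  assumes "(c has_sum T) UNIV" "\<And>n. c n \<ge> 0"
  shows "((\<lambda>ns. prod_list (map c ns)) has_sum T ^ j) {ns. length ns = j}"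
proof (induction j)
  case 0
  have "((\<lambda>ns. prod_list (map c ns)) has_sum (\<Sum>ns\<in>{[]}. prod_list (map c ns))) {[]}"
    by (rule has_sum_finite) simp
  moreover have "{ns :: nat list. length ns = 0} = {[]}" by auto
  ultimately show ?case by simp
next
  case (Suc j)
  let ?f = "\<lambda>p. c (fst p) * prod_list (map c (snd p))"
  have inner: "((\<lambda>ns. ?f (n, ns)) has_sum c n * T ^ j) {ns. length ns = j}" for n
    using has_sum_cmult_right[OF Suc, of "c n"] by simp
  have outer: "((\<lambda>n. c n * T ^ j) has_sum T * T ^ j) UNIV"
    by (rule has_sum_cmult_left[OF assms(1)])
  have "?f summable_on Sigma UNIV (\<lambda>n. {ns. length ns = j})"
    by (rule summable_on_SigmaI[OF inner])
      (use outer assms(2) in \<open>auto simp: summable_on_def intro!: mult_nonneg_nonneg prod_list_nonneg\<close>)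
  then have "(?f has_sum T * T ^ j) (Sigma UNIV (\<lambda>n. {ns. length ns = j}))"
    by (rule has_sum_SigmaI[OF inner outer])
  then show ?case
    using has_sum_reindex_bij_betw[OF bij_betw_Cons_length[of j], of "\<lambda>ns. prod_list (map c ns)" "T ^ Suc j"]
    by (simp add: case_prod_unfold)
qed

lemma multilinear_slot_bounded_linear:
  fixes p :: "'f::real_normed_vector list \<Rightarrow> 'g::real_normed_vector"
  assumes "multilinear_along UNIV n p" "\<And>xs. length xs = n \<Longrightarrow> norm (p xs) \<le> D * prod_list (map norm xs)"
    "length as + 1 + length bs = n"
  shows "bounded_linear (\<lambda>z. p (as @ z # bs))"
proof
  have lin: "linear_along UNIV (\<lambda>z. p (as @ z # bs))"
    using assms(1,3) unfolding multilinear_along_def by simp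
  show "p (as @ (x + y) # bs) = p (as @ x # bs) + p (as @ y # bs)" for x y
    using lin unfolding linear_along_def by simp
  show "p (as @ (r *\<^sub>R x) # bs) = r *\<^sub>R p (as @ x # bs)" for r x
    using lin unfolding linear_along_def by simp
  show "\<exists>K. \<forall>x. norm (p (as @ x # bs)) \<le> norm x * K"
  proof (intro exI allI)
    fix x
    show "norm (p (as @ x # bs)) \<le> norm x * (D * (prod_list (map norm as) * prod_list (map norm bs)))"
      using assms(2)[of "as @ x # bs"] assms(3) by (simp add: algebra_simps)
  qed
qed

lemma prod_list_norm_bound:
  fixes \<mu> :: "nat \<Rightarrow> 'f::real_normed_vector"
  assumes "\<And>n. norm (\<mu> n) \<le> c n"
  shows "prod_list (map (\<lambda>n. norm (\<mu> n)) ns) \<le> prod_list (map c ns)"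
    and "0 \<le> prod_list (map (\<lambda>n. norm (\<mu> n)) ns)"
  by (induction ns)
    (auto intro!: mult_mono assms order_trans[OF norm_ge_zero assms] prod_list_nonneg)

text \<open>A bounded multilinear map may be evaluated on absolutely convergent series by expanding every
slot. The expanded slots are split off one at a time, which is why a list \<open>as\<close> of slots that are
already fixed is carried along.\<close>

lemma has_sum_multilinear:
  fixes p :: "'f::real_normed_vector list \<Rightarrow> 'g::banach" and \<mu> :: "nat \<Rightarrow> 'f"
  assumes ml: "multilinear_along UNIV N p"
    and bd: "\<And>xs. length xs = N \<Longrightarrow> norm (p xs) \<le> D * prod_list (map norm xs)"
    and \<mu>: "(\<mu> has_sum k) UNIV" "(\<lambda>n. norm (\<mu> n)) summable_on UNIV"
    and N: "length as + j = N"
  shows "((\<lambda>ns. p (as @ map \<mu> ns)) has_sum p (as @ replicate j k)) {ns. length ns = j}"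
  using N
proof (induction j arbitrary: as)
  case 0
  have "((\<lambda>ns. p (as @ map \<mu> ns)) has_sum (\<Sum>ns\<in>{[]}. p (as @ map \<mu> ns))) {[]}"
    by (rule has_sum_finite) simp
  moreover have "{ns :: nat list. length ns = 0} = {[]}" by auto
  ultimately show ?case by simp
next
  case (Suc j)
  let ?B = "\<lambda>n::nat. {ns :: nat list. length ns = j}"
  let ?f = "\<lambda>q. p (as @ \<mu> (fst q) # map \<mu> (snd q))"
  have inner: "((\<lambda>ns. ?f (n, ns)) has_sum p (as @ \<mu> n # replicate j k)) (?B n)" for n
    using Suc.IH[of "as @ [\<mu> n]"] Suc.prems by simp
  have "bounded_linear (\<lambda>z. p (as @ z # replicate j k))"
    by (rule multilinear_slot_bounded_linear[OF ml bd]) (use Suc.prems in auto)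
  from has_sum_bounded_linear[OF this \<mu>(1)]
  have outer: "((\<lambda>n. p (as @ \<mu> n # replicate j k)) has_sum p (as @ k # replicate j k)) UNIV" .
  let ?c = "\<lambda>n. norm (\<mu> n)"
  have cT: "(?c has_sum infsum ?c UNIV) UNIV" using \<mu>(2) by simp
  have "(\<lambda>ns. prod_list (map ?c ns)) summable_on {ns. length ns = Suc j}"
    using has_sum_prod_list[OF cT, of "Suc j"] by (auto simp: summable_on_def)
  then have "(\<lambda>q. ?c (fst q) * prod_list (map ?c (snd q))) summable_on Sigma UNIV ?B"
    using summable_on_reindex_bij_betw[OF bij_betw_Cons_length[of j], of "\<lambda>ns. prod_list (map ?c ns)"]
    by (simp add: case_prod_unfold)
  then have "(\<lambda>q. (D * prod_list (map norm as)) * (?c (fst q) * prod_list (map ?c (snd q))))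
      summable_on Sigma UNIV ?B"
    by (rule summable_on_cmult_right)
  then have "(\<lambda>q. norm (?f q)) summable_on Sigma UNIV ?B"
  proof (rule summable_on_comparison_test)
    fix q assume "q \<in> Sigma UNIV ?B"
    then have "length (as @ \<mu> (fst q) # map \<mu> (snd q)) = N" using Suc.prems by auto
    from bd[OF this]
    show "norm (?f q) \<le> (D * prod_list (map norm as)) * (?c (fst q) * prod_list (map ?c (snd q)))"
      by (simp add: o_def mult.assoc)
  qed simp
  then have "?f summable_on Sigma UNIV ?B" by (rule abs_summable_summable)
  then have "(?f has_sum p (as @ k # replicate j k)) (Sigma UNIV ?B)"
    by (rule has_sum_SigmaI[OF inner outer])
  then show ?case
    using has_sum_reindex_bij_betw[OF bij_betw_Cons_length[of j], of "\<lambda>ns. p (as @ map \<mu> ns)" "p (as @ k # replicate j k)"]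
    by (simp add: case_prod_unfold)
qed

text \<open>An entry \<open>n\<close> of the index list stands for a term of degree \<open>Suc n\<close> of the inner series: the constant
term of the inner series is absorbed into the base point of the outer one, and it must not occur,
since otherwise infinitely many lists would have the same degree.\<close>

definition deg :: "nat list \<Rightarrow> nat" where
  "deg ns = sum_list (map Suc ns)"

lemma deg_simps [simp]: "deg [] = 0" "deg (n # ns) = Suc n + deg ns"
  by (auto simp: deg_def)

lemma finite_deg: "finite {ns. deg ns = N}"
proof (rule finite_subset)
  have "set ns \<subseteq> {..deg ns} \<and> length ns \<le> deg ns" for ns
    by (induction ns) auto
  then show "{ns. deg ns = N} \<subseteq> {ns. set ns \<subseteq> {..N} \<and> length ns \<le> N}" by blast
  show "finite {ns. set ns \<subseteq> {..N} \<and> length ns \<le> N}" by (intro finite_lists_length_le) simp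
qed

text \<open>The arguments that the outer multilinear map receives in the term of the composite series that is
indexed by \<open>ns\<close>.\<close>

primrec blocks :: "(nat \<Rightarrow> 'e list \<Rightarrow> 'f) \<Rightarrow> nat list \<Rightarrow> 'e list \<Rightarrow> 'f list" where
  "blocks m [] hs = []"
| "blocks m (n # ns) hs = m (Suc n) (take (Suc n) hs) # blocks m ns (drop (Suc n) hs)"

lemma length_blocks [simp]: "length (blocks m ns hs) = length ns"
  by (induction ns arbitrary: hs) auto

lemma blocks_replicate:
  "blocks m ns (replicate (deg ns) h) = map (\<lambda>n. m (Suc n) (replicate (Suc n) h)) ns"
  by (induction ns) (auto simp: take_replicate drop_replicate min_def)

lemma blocks_bound:
  assumes "\<And>n xs. set xs \<subseteq> V \<Longrightarrow> length xs = n \<Longrightarrow> norm (m n xs) \<le> C n * prod_list (map norm xs)"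
    "set hs \<subseteq> V" "length hs = deg ns" "\<And>n. (C n :: real) \<ge> 0"
  shows "prod_list (map norm (blocks m ns hs)) \<le> prod_list (map (\<lambda>n. C (Suc n)) ns) * prod_list (map norm hs)"
  using assms(2,3)
proof (induction ns arbitrary: hs)
  case (Cons n ns)
  let ?t = "take (Suc n) hs" and ?d = "drop (Suc n) hs"
  have 1: "norm (m (Suc n) ?t) \<le> C (Suc n) * prod_list (map norm ?t)"
    using Cons.prems by (intro assms(1)) (auto dest: in_set_takeD)
  have 2: "prod_list (map norm (blocks m ns ?d)) \<le> prod_list (map (\<lambda>n. C (Suc n)) ns) * prod_list (map norm ?d)"
    using Cons.prems by (intro Cons.IH) (auto dest: in_set_dropD)
  have "prod_list (map norm (blocks m (n # ns) hs)) \<le>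
      (C (Suc n) * prod_list (map norm ?t)) * (prod_list (map (\<lambda>n. C (Suc n)) ns) * prod_list (map norm ?d))"
    using 1 2 assms(4) by (auto intro!: mult_mono mult_nonneg_nonneg prod_list_nonneg)
  also have "\<dots> = prod_list (map (\<lambda>n. C (Suc n)) (n # ns)) * prod_list (map norm (?t @ ?d))"
    unfolding map_append prod_list.append by (simp add: algebra_simps)
  finally show ?case by simp
qed simp

text \<open>A single argument lies in exactly one block, and it enters the value of that block linearly.
Hence the outer multilinear map sees a linear change in just one slot.\<close>

lemma blocks_linear:
  assumes ml: "\<And>n. multilinear_along V n (m n)"
    and "set xs \<subseteq> V" "set ys \<subseteq> V" "length xs + 1 + length ys = deg ns"
  shows "\<exists>as l bs. length as + 1 + length bs = length ns \<and> linear_along V l \<and>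
    (\<forall>z. blocks m ns (xs @ z # ys) = as @ l z # bs)"
  using assms(2-4)
proof (induction ns arbitrary: xs)
  case (Cons n ns)
  show ?case
  proof (cases "length xs \<le> n")
    case True
    let ?l = "\<lambda>z. m (Suc n) (xs @ z # take (n - length xs) ys)"
    have "linear_along V ?l"
    proof (rule ml[of "Suc n", unfolded multilinear_along_def, rule_format])
      show "length xs + 1 + length (take (n - length xs) ys) = Suc n"
        using True Cons.prems by auto
    qed (use Cons.prems in \<open>auto dest: in_set_takeD\<close>)
    moreover have "blocks m (n # ns) (xs @ z # ys) = [] @ ?l z # blocks m ns (drop (n - length xs) ys)" for z
      using True by (simp add: Suc_diff_le)
    ultimately show ?thesis
      by (intro exI[of _ "[]"] exI[of _ ?l] exI[of _ "blocks m ns (drop (n - length xs) ys)"]) auto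
  next
    case False
    have "set (drop (Suc n) xs) \<subseteq> V" using Cons.prems by (auto dest: in_set_dropD)
    from Cons.IH[OF this Cons.prems(2)] obtain as l bs where IH:
      "length as + 1 + length bs = length ns" "linear_along V l"
      "\<And>z. blocks m ns (drop (Suc n) xs @ z # ys) = as @ l z # bs"
      using False Cons.prems by auto
    show ?thesis
      by (rule exI[of _ "m (Suc n) (take (Suc n) xs) # as"], rule exI[of _ l], rule exI[of _ bs])
        (use False IH in auto)
  qed
qed simp

definition compose_terms ::
  "(nat \<Rightarrow> 'f list \<Rightarrow> 'g::real_vector) \<Rightarrow> (nat \<Rightarrow> 'e list \<Rightarrow> 'f) \<Rightarrow> nat \<Rightarrow> 'e list \<Rightarrow> 'g" where
  "compose_terms p m N hs = (\<Sum>ns\<in>{ns. deg ns = N}. p (length ns) (blocks m ns hs))"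

lemma compose_terms_multilinear:
  assumes "\<And>n. multilinear_along V n (m n)" "\<And>n. multilinear_along UNIV n (p n)"
  shows "multilinear_along V N (compose_terms p m N)"
  unfolding multilinear_along_def
proof (intro allI impI)
  fix xs ys :: "'a list" assume *: "set xs \<subseteq> V" "set ys \<subseteq> V" "length xs + 1 + length ys = N"
  have lin: "linear_along V (\<lambda>z. p (length ns) (blocks m ns (xs @ z # ys)))" if ns: "deg ns = N" for ns
  proof -
    obtain as l bs where abl: "length as + 1 + length bs = length ns" "linear_along V l"
      "\<And>z. blocks m ns (xs @ z # ys) = as @ l z # bs"
      using blocks_linear[OF assms(1) *(1,2), of ns] * ns by auto
    have "linear_along UNIV (\<lambda>w. p (length ns) (as @ w # bs))"
      using assms(2)[of "length ns"] abl(1) unfolding multilinear_along_def by simp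
    then show ?thesis using abl(2) unfolding abl(3) linear_along_def by simp
  qed
  show "linear_along V (\<lambda>z. compose_terms p m N (xs @ z # ys))"
    unfolding linear_along_def compose_terms_def
    using lin by (simp add: linear_along_def sum.distrib scaleR_sum_right)
qed

text \<open>The classical substitution of power series. Let \<open>c n\<close> be the inner majorant with its constant term
removed, at a radius so small that its sum \<open>T\<close> stays below the outer radius of convergence. Then
the family indexed by lists is dominated by \<open>D (length ns) * (\<Prod>n\<leftarrow>ns. c n)\<close>, whose sum is
\<open>\<Sum>j. D j * T ^ j\<close>. Absolute summability permits both groupings of the family, by length and by
degree.

The intermediate space is a whole Banach space rather than a closed subspace: the individual
\<open>m n\<close> need not map into a subspace that contains all values of the inner function.\<close>

lemma analytic_at_compose:
  fixes f :: "'e::real_normed_vector \<Rightarrow> 'f::banach" and g :: "'f \<Rightarrow> 'g::banach"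
  assumes "analytic_at V f x" "analytic_at UNIV g (f x)" "0 \<in> V"
  shows "analytic_at V (\<lambda>y. g (f y)) x"
proof -
  obtain m C r where "power_series V f x m C r" using assms(1) unfolding analytic_at_def by blast
  note f = power_seriesD[OF this]
  obtain p D \<rho> where "power_series UNIV g (f x) p D \<rho>" using assms(2) unfolding analytic_at_def by blast
  note g = power_seriesD[OF this]
  have fx: "f x = m 0 []"
    using power_series_at_zero[OF f(4) f(6)[of 0, simplified]] assms(3) f(1) by auto
  define K where "K = (\<Sum>n. C (Suc n) * r ^ n)"
  have sumK: "summable (\<lambda>n. C (Suc n) * r ^ n)"
  proof -
    have "summable (\<lambda>n. C (Suc n) * r ^ Suc n * inverse r)"
      by (intro summable_mult2 summable_Suc_iff[of "\<lambda>n. C n * r ^ n", THEN iffD2] f(5))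
    then show ?thesis using f(1) by (simp add: field_simps)
  qed
  have K0: "K \<ge> 0" unfolding K_def using f(1,3) by (intro suminf_nonneg sumK) auto
  \<comment> \<open>The inner increment is at most \<open>K\<close> times the outer one; \<open>K + 1\<close> avoids division by zero.\<close>
  define s where "s = min (r / 2) (\<rho> / (K + 1))"
  have s: "0 < s" "s < r" "s * K \<le> \<rho>"
  proof -
    show "0 < s" "s < r" using f(1) g(1) K0 by (auto simp: s_def)
    have "s * (K + 1) \<le> \<rho> / (K + 1) * (K + 1)" using K0 by (intro mult_right_mono) (auto simp: s_def)
    also have "\<dots> = \<rho>" using K0 by simp
    finally show "s * K \<le> \<rho>" using \<open>0 < s\<close> by (simp add: algebra_simps)
  qed
  define c where "c n = C (Suc n) * s ^ Suc n" for n
  have c0: "c n \<ge> 0" for n using f(3) s by (simp add: c_def)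
  have c_le: "c n \<le> (C (Suc n) * r ^ n) * s" for n
    using f(3)[of "Suc n"] s by (auto simp: c_def mult.assoc intro!: mult_left_mono mult_right_mono power_mono)
  have sumc: "summable c"
    by (rule summable_comparison_test'[OF summable_mult2[OF sumK, of s], of 0]) (use c0 c_le in auto)
  define T where "T = suminf c"
  have cT: "(c has_sum T) UNIV"
    unfolding T_def using sumc c0 by (intro norm_summable_imp_has_sum) (auto simp: summable_sums)
  have T0: "0 \<le> T" unfolding T_def using sumc c0 by (rule suminf_nonneg)
  have "T \<le> (\<Sum>n. (C (Suc n) * r ^ n) * s)"
    unfolding T_def by (intro suminf_le c_le sumc summable_mult2 sumK)
  also have "\<dots> = K * s" unfolding K_def by (rule suminf_mult2[OF sumK, symmetric])
  finally have T: "T \<le> \<rho>" using s by (simp add: mult.commute)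
  have sumD: "(\<lambda>j. D j * T ^ j) summable_on UNIV"
    by (rule norm_summable_imp_summable_on)
      (use summable_smaller_radius[OF g(5) T0 T g(3)] g(3) T0 in \<open>simp add: abs_mult\<close>)
  \<comment> \<open>the majorant, indexed by the lists of block lengths\<close>
  define G where "G ns = D (length ns) * prod_list (map c ns)" for ns
  have G0: "G ns \<ge> 0" for ns using g(3) c0 by (auto simp: G_def intro!: mult_nonneg_nonneg prod_list_nonneg)
  have GsumT: "(G has_sum D j * T ^ j) {ns. length ns = j}" for j
  proof -
    have "((\<lambda>ns. D j * prod_list (map c ns)) has_sum D j * T ^ j) {ns. length ns = j}"
      by (rule has_sum_cmult_right[OF has_sum_prod_list[OF cT c0]])
    then show ?thesis by (rule has_sum_cong[THEN iffD1, rotated]) (auto simp: G_def)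
  qed
  have Gsum: "G summable_on UNIV"
    by (rule summable_on_fibres[OF GsumT sumD G0])
  define E where "E N = (\<Sum>ns\<in>{ns. deg ns = N}. D (length ns) * prod_list (map (\<lambda>n. C (Suc n)) ns))" for N
  have G_eq: "G ns = D (length ns) * prod_list (map (\<lambda>n. C (Suc n)) ns) * s ^ deg ns" for ns
  proof -
    have "prod_list (map c ns) = prod_list (map (\<lambda>n. C (Suc n)) ns) * s ^ deg ns"
      by (induction ns) (auto simp: c_def power_add algebra_simps)
    then show ?thesis by (simp add: G_def)
  qed
  have "((\<lambda>N. E N * s ^ N) has_sum infsum G UNIV) UNIV"
  proof (rule has_sum_fibres[where F = G and g = deg])
    show "(G has_sum E N * s ^ N) {ns. deg ns = N}" for N
      by (rule has_sum_finiteI) (auto simp: finite_deg E_def G_eq sum_distrib_right)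
  qed (use Gsum in simp)
  then have sumE: "summable (\<lambda>N. E N * s ^ N)"
    by (intro summable_on_imp_summable) (auto simp: summable_on_def)
  show ?thesis
  proof (rule analytic_atI[OF s(1) compose_terms_multilinear[OF f(2) g(2)] _ _ sumE])
    show "E N \<ge> 0" for N
      unfolding E_def using f(3) g(3) by (intro sum_nonneg mult_nonneg_nonneg prod_list_nonneg) auto
    show "norm (compose_terms p m N xs) \<le> E N * prod_list (map norm xs)"
      if "set xs \<subseteq> V" "length xs = N" for N xs
      unfolding compose_terms_def E_def sum_distrib_right
    proof (rule sum_norm_le)
      fix ns assume "ns \<in> {ns. deg ns = N}"
      then have ns: "length xs = deg ns" using that by simp
      have "norm (p (length ns) (blocks m ns xs)) \<le> D (length ns) * prod_list (map norm (blocks m ns xs))"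
        by (rule g(4)) auto
      also have "\<dots> \<le> D (length ns) * (prod_list (map (\<lambda>n. C (Suc n)) ns) * prod_list (map norm xs))"
        by (intro mult_left_mono blocks_bound[where V = V] f(4) that ns f(3) g(3))
      finally show "norm (p (length ns) (blocks m ns xs)) \<le>
          D (length ns) * prod_list (map (\<lambda>n. C (Suc n)) ns) * prod_list (map norm xs)" by simp
    qed
    fix h assume h: "h \<in> V" "norm h < s"
    define \<mu> where "\<mu> n = m (Suc n) (replicate (Suc n) h)" for n
    have \<mu>c: "norm (\<mu> n) \<le> c n" for n
    proof -
      have "norm (\<mu> n) \<le> C (Suc n) * prod_list (map norm (replicate (Suc n) h))"
        unfolding \<mu>_def using h by (intro f(4)) auto
      also have "\<dots> = C (Suc n) * norm h ^ Suc n" by (simp only: prod_list_map_replicate)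
      also have "\<dots> \<le> c n" unfolding c_def using h f(3) by (intro mult_left_mono power_mono) auto
      finally show ?thesis .
    qed
    define k where "k = f (x + h) - f x"
    have fs: "(\<lambda>n. m n (replicate n h)) sums f (x + h)" using f(6) h s by auto
    have "\<mu> sums k"
      unfolding \<mu>_def k_def fx using fs by (subst sums_Suc_iff) simp
    moreover have sn: "summable (\<lambda>n. norm (\<mu> n))"
      by (rule summable_comparison_test'[OF sumc, of 0]) (use \<mu>c in auto)
    ultimately have \<mu>k: "(\<mu> has_sum k) UNIV" by (rule norm_summable_imp_has_sum[rotated])
    have \<mu>s: "(\<lambda>n. norm (\<mu> n)) summable_on UNIV"
      by (rule norm_summable_imp_summable_on) (use sn in simp)
    have k: "norm k < \<rho>"
    proof -
      have hK: "norm k \<le> K * norm h"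
      proof -
        have "norm (f (x + h) - (\<Sum>i<1. m i (replicate i h))) \<le> (\<Sum>n. C (n + 1) * r ^ n) * norm h ^ 1"
        proof (rule power_series_remainder[OF f(1,3)])
          show "norm (m n (replicate n h)) \<le> C n * norm h ^ n" for n
            using f(4)[of "replicate n h" n] h by (auto simp: prod_list_map_replicate set_replicate_conv_if)
        qed (use f(5) fs h s in auto)
        then show ?thesis by (simp add: K_def k_def fx)
      qed
      show ?thesis
      proof (cases "K = 0")
        case True then show ?thesis using hK g(1) by simp
      next
        case False
        then have "K * norm h < K * s" using K0 h by simp
        then show ?thesis using hK s by (simp add: mult.commute)
      qed
    qed
    define F where "F ns = p (length ns) (map \<mu> ns)" for ns
    have FG: "norm (F ns) \<le> G ns" for ns
    proof -
      have "norm (F ns) \<le> D (length ns) * prod_list (map norm (map \<mu> ns))"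
        unfolding F_def by (rule g(4)) auto
      also have "\<dots> \<le> G ns"
        unfolding G_def using prod_list_norm_bound(1)[of \<mu> c ns] \<mu>c g(3)
        by (auto simp: o_def intro!: mult_left_mono)
      finally show ?thesis .
    qed
    have "F summable_on UNIV"
      by (rule abs_summable_summable, rule summable_on_comparison_test[OF Gsum]) (use FG in auto)
    then obtain Z where Z: "(F has_sum Z) UNIV" by (auto simp: summable_on_def)
    have "((\<lambda>j. p j (replicate j k)) has_sum Z) UNIV"
    proof (rule has_sum_fibres[OF Z, where g = length])
      fix j
      have "((\<lambda>ns. p j ([] @ map \<mu> ns)) has_sum p j ([] @ replicate j k)) {ns. length ns = j}"
        by (rule has_sum_multilinear[OF g(2) g(4) \<mu>k \<mu>s]) auto
      then have "((\<lambda>ns. p j (map \<mu> ns)) has_sum p j (replicate j k)) {ns. length ns = j}" by simp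
      then show "(F has_sum p j (replicate j k)) {ns. length ns = j}"
        by (rule has_sum_cong[THEN iffD1, rotated]) (auto simp: F_def)
    qed
    then have "(\<lambda>j. p j (replicate j k)) sums Z" by (rule has_sum_imp_sums)
    moreover have "(\<lambda>j. p j (replicate j k)) sums g (f x + k)" by (rule g(6)) (use k in auto)
    ultimately have Zeq: "Z = g (f (x + h))" using sums_unique2 by (fastforce simp: k_def)
    have "((\<lambda>N. compose_terms p m N (replicate N h)) has_sum Z) UNIV"
    proof (rule has_sum_fibres[OF Z, where g = deg])
      fix N
      show "(F has_sum compose_terms p m N (replicate N h)) {ns. deg ns = N}"
        by (rule has_sum_finiteI)
          (auto simp: finite_deg compose_terms_def F_def \<mu>_def[abs_def] blocks_replicate
            simp del: replicate_Suc intro!: sum.cong)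
    qed
    then show "(\<lambda>N. compose_terms p m N (replicate N h)) sums g (f (x + h))"
      using Zeq has_sum_imp_sums by blast
  qed
qed

section \<open>Analytic maps between Banach spaces\<close>

text \<open>Series that stop: linear maps, constants and products have only finitely many terms.\<close>

lemma sums_first:
  "(\<And>n. n \<ge> k \<Longrightarrow> F n = 0) \<Longrightarrow> F sums (\<Sum>n<k. F n :: 'a::real_normed_vector)"
  by (rule sums_finite) auto

lemma analytic_at_linear:
  assumes lin: "linear_along V L" and bd: "\<And>v. v \<in> V \<Longrightarrow> norm (L v) \<le> K * norm v" and x: "x \<in> V"
  shows "analytic_at V L x"
proof -
  define m where "m n hs = (if n = 0 then L x else if n = 1 then L (hd hs) else 0)" for n :: nat and hs :: "'a list"
  define C where "C n = (if n = 0 then norm (L x) else if n = 1 then \<bar>K\<bar> else 0)" for n :: nat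
  show ?thesis
  proof (rule analytic_atI[of 1 V m C])
    show "multilinear_along V n (m n)" for n
      unfolding multilinear_along_def
    proof (intro allI impI)
      fix xs ys :: "'a list" assume "length xs + 1 + length ys = n"
      then show "linear_along V (\<lambda>x. m n (xs @ x # ys))"
        using lin by (cases "n = 1") (auto simp: m_def linear_along_def)
    qed
    show "norm (m n xs) \<le> C n * prod_list (map norm xs)" if "set xs \<subseteq> V" "length xs = n" for n xs
    proof (cases "n = 1")
      case True
      then obtain v where v: "xs = [v]" using \<open>length xs = n\<close> by (auto simp: length_Suc_conv)
      have "norm (L v) \<le> K * norm v" using bd v that by simp
      also have "\<dots> \<le> \<bar>K\<bar> * norm v" by (intro mult_right_mono) auto
      finally show ?thesis by (simp add: m_def C_def v True)
    qed (use that in \<open>auto simp: m_def C_def\<close>)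
    have "(\<lambda>n. C n * 1 ^ n) sums (\<Sum>n<2. C n * 1 ^ n)" by (rule sums_first) (auto simp: C_def)
    then show "summable (\<lambda>n. C n * 1 ^ n)" by (rule sums_summable)
    show "(\<lambda>n. m n (replicate n h)) sums L (x + h)" if "h \<in> V" for h
    proof -
      have "(\<lambda>n. m n (replicate n h)) sums (\<Sum>n<2. m n (replicate n h))"
        by (rule sums_first) (auto simp: m_def)
      moreover have "(\<Sum>n<2. m n (replicate n h)) = L (x + h)"
        using lin that x by (simp add: m_def numeral_2_eq_2 linear_along_def)
      ultimately show ?thesis by simp
    qed
  qed (auto simp: C_def)
qed

lemma analytic_at_bounded_linear:
  assumes "bounded_linear L" shows "analytic_at UNIV L x"
proof -
  interpret bounded_linear L by fact
  obtain K where "\<And>v. norm (L v) \<le> norm v * K" using bounded by blast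
  then show ?thesis
    by (intro analytic_at_linear[where K = K]) (auto simp: linear_along_def add scaleR mult.commute)
qed

lemma analytic_at_const: "analytic_at V (\<lambda>_. c) x"
proof -
  define m where "m n hs = (if n = 0 then c else 0)" for n :: nat and hs :: "'a list"
  define C where "C n = (if n = 0 then norm c else 0)" for n :: nat
  show ?thesis
  proof (rule analytic_atI[of 1 V m C])
    have "(\<lambda>n. C n * 1 ^ n) sums (\<Sum>n<1. C n * 1 ^ n)" by (rule sums_first) (auto simp: C_def)
    then show "summable (\<lambda>n. C n * 1 ^ n)" by (rule sums_summable)
    have "(\<lambda>n. m n (replicate n h)) sums (\<Sum>n<1. m n (replicate n h))" for h
      by (rule sums_first) (auto simp: m_def)
    then show "(\<lambda>n. m n (replicate n h)) sums c" for h by (simp add: m_def)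
  qed (auto simp: C_def m_def multilinear_along_def linear_along_def)
qed

lemma analytic_at_Pair:
  assumes "analytic_at V f x" "analytic_at V g x"
  shows "analytic_at V (\<lambda>y. (f y, g y)) x"
proof -
  obtain m C r where "power_series V f x m C r" using assms(1) unfolding analytic_at_def by blast
  note f = power_seriesD[OF this]
  obtain p D s where "power_series V g x p D s" using assms(2) unfolding analytic_at_def by blast
  note g = power_seriesD[OF this]
  show ?thesis
  proof (rule analytic_atI[of "min r s" V "\<lambda>n hs. (m n hs, p n hs)" "\<lambda>n. C n + D n"])
    show "min r s > 0" using f(1) g(1) by simp
    show "multilinear_along V n (\<lambda>hs. (m n hs, p n hs))" for n
      using f(2)[of n] g(2)[of n] unfolding multilinear_along_def linear_along_def by simp
    show "0 \<le> C n + D n" for n using f(3) g(3) by (simp add: add_nonneg_nonneg)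
    show "norm (m n xs, p n xs) \<le> (C n + D n) * prod_list (map norm xs)"
      if "set xs \<subseteq> V" "length xs = n" for n xs
      using f(4)[OF that] g(4)[OF that] norm_Pair_le[of "m n xs" "p n xs"] by (simp add: distrib_right)
    have "summable (\<lambda>n. C n * min r s ^ n)" "summable (\<lambda>n. D n * min r s ^ n)"
      using f(1,3) g(1,3) by (auto intro!: summable_smaller_radius[OF f(5)] summable_smaller_radius[OF g(5)])
    then show "summable (\<lambda>n. (C n + D n) * min r s ^ n)" by (simp add: distrib_right summable_add)
    show "(\<lambda>n. (m n (replicate n h), p n (replicate n h))) sums (f (x + h), g (x + h))"
      if "h \<in> V" "norm h < min r s" for h
      using f(6)[of h] g(6)[of h] that unfolding sums_def by (auto simp: sum_prod intro: tendsto_Pair)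
  qed
qed

lemma analytic_at_mult:
  fixes x :: "'a::real_normed_algebra \<times> 'a"
  shows "analytic_at UNIV (\<lambda>y. fst y * snd y) x"
proof -
  obtain a b where x: "x = (a, b)" by fastforce
  define m where "m n hs = (if n = 0 then a * b else if n = 1 then a * snd (hd hs) + fst (hd hs) * b
      else if n = 2 then fst (hd hs) * snd (hd (tl hs)) else 0)"
    for n :: nat and hs :: "('a \<times> 'a) list"
  define C where "C n = (if n = 0 then norm (a * b) else if n = 1 then norm a + norm b else if n = 2 then 1 else 0)"
    for n :: nat
  have fs: "norm (fst v) \<le> norm v" "norm (snd v) \<le> norm v" for v :: "'a \<times> 'a"
    by (cases v; simp add: norm_Pair)+
  show ?thesis
  proof (rule analytic_atI[of 1 UNIV m C])
    show "multilinear_along UNIV n (m n)" for n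
      unfolding multilinear_along_def
    proof (intro allI impI)
      fix xs ys :: "('a \<times> 'a) list" assume "length xs + 1 + length ys = n"
      then consider "n = 1" "xs = []" "ys = []" | u where "n = 2" "xs = []" "ys = [u]"
        | u where "n = 2" "xs = [u]" "ys = []" | "n > 2"
        by (cases xs; cases ys; cases "tl xs"; cases "tl ys") auto
      then show "linear_along UNIV (\<lambda>x. m n (xs @ x # ys))"
        by cases (auto simp: m_def linear_along_def algebra_simps)
    qed
    show "norm (m n xs) \<le> C n * prod_list (map norm xs)" if "length xs = n" for n xs
    proof -
      consider "xs = []" | v where "xs = [v]" | v w where "xs = [v, w]" | "length xs > 2"
        by (cases xs; cases "tl xs"; cases "tl (tl xs)") auto
      then show ?thesis
      proof cases
        case (2 v)
        have "norm (a * snd v + fst v * b) \<le> norm a * norm v + norm v * norm b"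
          by (intro norm_triangle_le add_mono order_trans[OF norm_mult_ineq] mult_mono fs order_refl) auto
        then show ?thesis using 2 that by (auto simp: m_def C_def algebra_simps)
      next
        case (3 v w)
        have "norm (fst v * snd w) \<le> norm v * norm w"
          by (intro order_trans[OF norm_mult_ineq] mult_mono fs) auto
        then show ?thesis using 3 that by (auto simp: m_def C_def)
      qed (use that in \<open>auto simp: m_def C_def\<close>)
    qed
    have "(\<lambda>n. C n * 1 ^ n) sums (\<Sum>n<3. C n * 1 ^ n)" by (rule sums_first) (auto simp: C_def)
    then show "summable (\<lambda>n. C n * 1 ^ n)" by (rule sums_summable)
    show "(\<lambda>n. m n (replicate n h)) sums (fst (x + h) * snd (x + h))" for h
    proof -
      have "(\<lambda>n. m n (replicate n h)) sums (\<Sum>n<3. m n (replicate n h))"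
        by (rule sums_first) (auto simp: m_def)
      moreover have "(\<Sum>n<3. m n (replicate n h)) = fst (x + h) * snd (x + h)"
        by (simp add: m_def eval_nat_numeral x algebra_simps)
      ultimately show ?thesis by simp
    qed
  qed (auto simp: C_def)
qed

text \<open>Here the outer map may be analytic along a closed subspace only. The case of a projection onto
that subspace turns it into a map that is analytic on the ambient space.\<close>

lemma analytic_at_compose_bounded_linear:
  fixes x :: "'a::real_normed_vector"
  assumes g: "analytic_at W g (P x)" and P: "bounded_linear P" "\<And>y. y \<in> V \<Longrightarrow> P y \<in> W"
  shows "analytic_at V (\<lambda>y. g (P y)) x"
proof -
  interpret P: bounded_linear P by fact
  obtain m C r where "power_series W g (P x) m C r" using g unfolding analytic_at_def by blast
  note g = power_seriesD[OF this]
  obtain K where K: "K > 0" "\<And>v. norm (P v) \<le> norm v * K" using P.pos_bounded by blast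
  show ?thesis
  proof (rule analytic_atI[of "r / K" V "\<lambda>n hs. m n (map P hs)" "\<lambda>n. C n * K ^ n"])
    show "r / K > 0" using g(1) K by simp
    show "multilinear_along V n (\<lambda>hs. m n (map P hs))" for n
      unfolding multilinear_along_def
    proof (intro allI impI)
      fix xs ys :: "'a list" assume "set xs \<subseteq> V" "set ys \<subseteq> V" "length xs + 1 + length ys = n"
      then have "linear_along W (\<lambda>z. m n (map P xs @ z # map P ys))"
        using P(2) by (intro g(2)[of n, unfolded multilinear_along_def, rule_format]) auto
      then show "linear_along V (\<lambda>z. m n (map P (xs @ z # ys)))"
        using P(2) by (auto simp: linear_along_def P.add P.scaleR)
    qed
    show "0 \<le> C n * K ^ n" for n using g(3) K by simp
    show "norm (m n (map P xs)) \<le> C n * K ^ n * prod_list (map norm xs)" if "set xs \<subseteq> V" "length xs = n" for n xs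
    proof -
      have "prod_list (map norm (map P xs)) \<le> K ^ length xs * prod_list (map norm xs)"
      proof (induction xs)
        case (Cons v xs)
        have "norm (P v) * prod_list (map norm (map P xs)) \<le>
            (norm v * K) * (K ^ length xs * prod_list (map norm xs))"
          using Cons K by (intro mult_mono) (auto intro!: prod_list_nonneg)
        then show ?case by (simp add: algebra_simps)
      qed simp
      then have "C n * prod_list (map norm (map P xs)) \<le> C n * (K ^ length xs * prod_list (map norm xs))"
        using g(3) by (intro mult_left_mono) auto
      moreover have "norm (m n (map P xs)) \<le> C n * prod_list (map norm (map P xs))"
        using that P(2) by (intro g(4)) (auto simp: image_subset_iff subset_iff)
      ultimately show ?thesis using that by (simp add: mult.assoc)
    qed
    show "summable (\<lambda>n. C n * K ^ n * (r / K) ^ n)"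
      using g(5) K by (simp add: power_divide mult.assoc)
    show "(\<lambda>n. m n (map P (replicate n h))) sums g (P (x + h))" if "h \<in> V" "norm h < r / K" for h
    proof -
      have "norm (P h) < r" using K(2)[of h] K(1) that(2) by (simp add: field_simps)
      then show ?thesis using g(6)[OF P(2)[OF that(1)]] by (simp add: P.add)
    qed
  qed
qed

section \<open>Invertible elements of a Banach algebra\<close>

text \<open>The norm of the unit is arbitrary and the algebra may be zero, so the algebra is in general not an
instance of the type classes that come with a multiplicative inverse or with numerals in a ring
with \<open>0 \<noteq> 1\<close>.\<close>

definition inverse_of :: "'a::{real_normed_algebra, monoid_mult, banach} \<Rightarrow> 'a" where
  "inverse_of a = (THE b. a * b = 1 \<and> b * a = 1)"

definition invertible_elements :: "'a::{real_normed_algebra, monoid_mult, banach} set" where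
  "invertible_elements = {a. \<exists>b. a * b = 1 \<and> b * a = 1}"

lemma inverse_of_eqI:
  fixes a :: "'a::{real_normed_algebra, monoid_mult, banach}"
  assumes "a * b = 1" "b * a = 1"
  shows "inverse_of a = b" "a \<in> invertible_elements"
proof -
  have "c = b" if "a * c = 1 \<and> c * a = 1" for c
  proof -
    have "c = c * (a * b)" using assms by simp
    also have "\<dots> = (c * a) * b" by (simp only: mult.assoc)
    also have "\<dots> = b" using that by simp
    finally show ?thesis .
  qed
  then show "inverse_of a = b"
    unfolding inverse_of_def by (intro the_equality conjI assms)
  show "a \<in> invertible_elements" using assms unfolding invertible_elements_def by blast
qed

lemma inverse_of [simp]:
  fixes a :: "'a::{real_normed_algebra, monoid_mult, banach}"
  assumes "a \<in> invertible_elements"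
  shows "a * inverse_of a = 1" "inverse_of a * a = 1"
proof -
  obtain b where "a * b = 1" "b * a = 1" using assms unfolding invertible_elements_def by blast
  then show "a * inverse_of a = 1" "inverse_of a * a = 1" using inverse_of_eqI(1)[of a b] by auto
qed

lemma inverse_of_mult [simp]:
  fixes a :: "'a::{real_normed_algebra, monoid_mult, banach}"
  assumes "a \<in> invertible_elements"
  shows "a * (inverse_of a * z) = z" "inverse_of a * (a * z) = z"
  using inverse_of[OF assms] by (simp_all add: mult.assoc[symmetric])

lemma invertible_elements_one [simp]: "1 \<in> invertible_elements"
  and inverse_of_one [simp]: "inverse_of 1 = 1"
  using inverse_of_eqI[of 1 1] by auto

lemma invertible_elements_mult:
  "a \<in> invertible_elements \<Longrightarrow> b \<in> invertible_elements \<Longrightarrow> a * b \<in> invertible_elements"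
  by (rule inverse_of_eqI(2)[of _ "inverse_of b * inverse_of a"]) (simp_all add: mult.assoc)

text \<open>The multilinear maps of the Neumann series
\<open>(x + h)\<^sup>-\<^sup>1 = y - y h y + y h y h y - \<dots>\<close>, where \<open>y\<close> is the inverse of \<open>x\<close>.\<close>

primrec neumann :: "'a::{real_normed_algebra, monoid_mult, banach} \<Rightarrow> 'a list \<Rightarrow> 'a" where
  "neumann y [] = y"
| "neumann y (h # hs) = - (y * h * neumann y hs)"

lemma neumann_bound: "norm (neumann y hs) \<le> norm y ^ Suc (length hs) * prod_list (map norm hs)"
proof (induction hs)
  case (Cons h hs)
  have "norm (neumann y (h # hs)) \<le> (norm y * norm h) * (norm y ^ Suc (length hs) * prod_list (map norm hs))"
    using Cons by (auto intro!: order_trans[OF norm_mult_ineq] mult_mono norm_mult_ineq)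
  then show ?case by (simp add: algebra_simps)
qed simp

lemma neumann_linear: "linear_along UNIV (\<lambda>z. neumann y (xs @ z # ys))"
  by (induction xs) (auto simp: linear_along_def algebra_simps)

lemma neumann_replicate_Suc: "neumann y (replicate (Suc n) h) = - (neumann y (replicate n h) * h * y)"
proof (induction n)
  case (Suc n)
  have "neumann y (replicate (Suc (Suc n)) h) = - (y * h * neumann y (replicate (Suc n) h))" by simp
  also have "\<dots> = - (y * h * - (neumann y (replicate n h) * h * y))" by (simp only: Suc.IH)
  also have "\<dots> = - ((- (y * h * neumann y (replicate n h))) * h * y)" by (simp add: mult.assoc)
  finally show ?case by simp
qed simp

text \<open>With \<open>S\<close> the sum of the series, dropping the first term and factoring \<open>y h\<close> on the left or \<open>h y\<close> on
the right gives \<open>S = y - y h S = y - S h y\<close>; multiplication by \<open>x\<close> shows that \<open>S\<close> is a two-sided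
inverse of \<open>x + h\<close>. The summand \<open>1\<close> in the radius avoids division by
zero if \<open>y = 0\<close>, that is, in the zero algebra.\<close>

lemma neumann_inverse:
  fixes x :: "'a::{real_normed_algebra, monoid_mult, banach}"
  assumes x: "x \<in> invertible_elements" and h: "norm h < inverse (2 * (norm (inverse_of x) + 1))"
  shows "(\<lambda>n. neumann (inverse_of x) (replicate n h)) sums inverse_of (x + h)"
    and "x + h \<in> invertible_elements"
    and "summable (\<lambda>n. norm (inverse_of x) ^ Suc n * inverse (2 * (norm (inverse_of x) + 1)) ^ n)"
proof -
  define y where "y = inverse_of x"
  define \<rho> where "\<rho> = inverse (2 * (norm y + 1))"
  have y1: "norm y + 1 > 0" using norm_ge_zero[of y] by linarith
  have \<rho>0: "\<rho> > 0" using y1 by (simp add: \<rho>_def)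
  have q: "norm y * \<rho> < 1" "norm y * \<rho> \<ge> 0"
  proof -
    have "norm y * \<rho> = norm y / (2 * (norm y + 1))" by (simp add: \<rho>_def divide_inverse)
    also have "\<dots> < 1" using y1 by (simp add: divide_less_eq)
    finally show "norm y * \<rho> < 1" .
  qed (use \<rho>0 in simp)
  have "summable (\<lambda>n. norm y * (norm y * \<rho>) ^ n)"
    using q by (intro summable_mult summable_geometric) auto
  then have sm: "summable (\<lambda>n. norm y ^ Suc n * \<rho> ^ n)" by (simp add: power_mult_distrib mult.assoc)
  then show "summable (\<lambda>n. norm (inverse_of x) ^ Suc n * inverse (2 * (norm (inverse_of x) + 1)) ^ n)"
    by (simp add: \<rho>_def y_def)
  let ?N = "\<lambda>n. neumann y (replicate n h)"
  have "norm (?N n) \<le> norm y ^ Suc n * \<rho> ^ n" for n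
  proof -
    have "norm (?N n) \<le> norm y ^ Suc n * norm h ^ n"
      using neumann_bound[of y "replicate n h"] by (simp add: prod_list_map_replicate del: power_Suc)
    also have "\<dots> \<le> norm y ^ Suc n * \<rho> ^ n"
      using h by (intro mult_left_mono power_mono) (auto simp: \<rho>_def y_def)
    finally show ?thesis .
  qed
  then have "summable ?N" by (intro summable_comparison_test'[OF sm, of 0]) auto
  then obtain S where S: "?N sums S" by (auto simp: summable_def)
  have "(\<lambda>n. ?N (Suc n)) sums (S - y)" by (subst sums_Suc_iff) (use S in simp)
  moreover have "(\<lambda>n. ?N (Suc n)) sums (- (y * h * S))"
    using sums_minus[OF sums_mult[OF S, of "y * h"]] by simp
  moreover have "(\<lambda>n. ?N (Suc n)) sums (- (S * (h * y)))"
    using sums_minus[OF sums_mult2[OF S, of "h * y"]] unfolding neumann_replicate_Suc by (simp add: mult.assoc)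
  ultimately have e: "S - y = - (y * h * S)" "S - y = - (S * (h * y))" using sums_unique2 by blast+
  have S1: "S = y - y * h * S" and S2: "S = y - S * (h * y)" using e by (simp_all add: algebra_simps)
  have "x * S = 1 - h * S"
    using arg_cong[OF S1, of "\<lambda>z. x * z"] x by (simp add: right_diff_distrib mult.assoc y_def)
  then have "(x + h) * S = 1" by (simp add: distrib_right)
  moreover have "S * x = 1 - S * h"
    using arg_cong[OF S2, of "\<lambda>z. z * x"] x by (simp add: left_diff_distrib mult.assoc y_def)
  then have "S * (x + h) = 1" by (simp add: distrib_left)
  ultimately have "inverse_of (x + h) = S" "x + h \<in> invertible_elements" using inverse_of_eqI by blast+
  then show "(\<lambda>n. neumann (inverse_of x) (replicate n h)) sums inverse_of (x + h)"
    "x + h \<in> invertible_elements"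
    using S by (auto simp: y_def)
qed

lemma analytic_at_inverse_of:
  assumes "x \<in> invertible_elements"
  shows "analytic_at UNIV inverse_of x"
proof (rule analytic_atI[where m = "\<lambda>n. neumann (inverse_of x)" and C = "\<lambda>n. norm (inverse_of x) ^ Suc n"])
  show "0 < inverse (2 * (norm (inverse_of x) + 1))"
    using norm_ge_zero[of "inverse_of x"] by (simp add: add_nonneg_pos)
  show "summable (\<lambda>n. norm (inverse_of x) ^ Suc n * inverse (2 * (norm (inverse_of x) + 1)) ^ n)"
    by (rule neumann_inverse(3)[OF assms, of 0]) (simp add: add_nonneg_pos)
qed (use assms neumann_inverse(1) neumann_bound neumann_linear in \<open>auto simp: multilinear_along_def simp del: power_Suc\<close>)

lemma open_invertible_elements: "open invertible_elements"
  unfolding open_dist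
proof (intro ballI)
  fix x :: 'a assume x: "x \<in> invertible_elements"
  show "\<exists>e>0. \<forall>y. dist y x < e \<longrightarrow> y \<in> invertible_elements"
  proof (intro exI conjI allI impI)
    show "0 < inverse (2 * (norm (inverse_of x) + 1))" by (simp add: add_nonneg_pos)
    fix y assume "dist y x < inverse (2 * (norm (inverse_of x) + 1))"
    then show "y \<in> invertible_elements"
      using neumann_inverse(2)[OF x, of "y - x"] by (simp add: dist_norm)
  qed
qed

text \<open>These rules reduce the analyticity of a rational expression to the invertibility of its
denominators.\<close>

named_theorems analytic_intros

lemma analytic_at_ident [analytic_intros]: "analytic_at UNIV (\<lambda>y. y) x"
  by (rule analytic_at_bounded_linear[OF bounded_linear_ident])

lemma analytic_at_UNIV_compose:
  fixes f :: "'e::real_normed_vector \<Rightarrow> 'f::banach" and g :: "'f \<Rightarrow> 'g::banach"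
  shows "analytic_at UNIV g (f x) \<Longrightarrow> analytic_at UNIV f x \<Longrightarrow> analytic_at UNIV (\<lambda>y. g (f y)) x"
  by (rule analytic_at_compose) auto

lemma analytic_at_linear_image:
  fixes f :: "'e::real_normed_vector \<Rightarrow> 'f::banach" and L :: "'f \<Rightarrow> 'g::banach"
  assumes "bounded_linear L" "analytic_at UNIV f x"
  shows "analytic_at UNIV (\<lambda>y. L (f y)) x"
  by (rule analytic_at_UNIV_compose[OF analytic_at_bounded_linear[OF assms(1)] assms(2)])

lemmas [analytic_intros] = analytic_at_const analytic_at_Pair
lemmas analytic_at_fst [analytic_intros] = analytic_at_linear_image[OF bounded_linear_fst]
lemmas analytic_at_snd [analytic_intros] = analytic_at_linear_image[OF bounded_linear_snd]
lemmas analytic_at_scaleR [analytic_intros] = analytic_at_linear_image[OF bounded_linear_scaleR_right]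

lemma analytic_at_times [analytic_intros]:
  fixes f g :: "'e::real_normed_vector \<Rightarrow> 'f::{real_normed_algebra, banach}"
  assumes "analytic_at UNIV f x" "analytic_at UNIV g x"
  shows "analytic_at UNIV (\<lambda>y. f y * g y) x"
  using analytic_at_UNIV_compose[OF analytic_at_mult analytic_at_Pair[OF assms]] by simp

lemma analytic_at_add [analytic_intros]:
  fixes f g :: "'e::real_normed_vector \<Rightarrow> 'f::banach"
  assumes "analytic_at UNIV f x" "analytic_at UNIV g x"
  shows "analytic_at UNIV (\<lambda>y. f y + g y) x"
proof -
  have "bounded_linear (\<lambda>p :: 'f \<times> 'f. fst p + snd p)"
    by (intro bounded_linear_add bounded_linear_fst bounded_linear_snd)
  from analytic_at_linear_image[OF this analytic_at_Pair[OF assms]] show ?thesis by simp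
qed

lemma analytic_at_diff [analytic_intros]:
  fixes f g :: "'e::real_normed_vector \<Rightarrow> 'f::banach"
  assumes "analytic_at UNIV f x" "analytic_at UNIV g x"
  shows "analytic_at UNIV (\<lambda>y. f y - g y) x"
proof -
  have "bounded_linear (\<lambda>p :: 'f \<times> 'f. fst p - snd p)"
    by (intro bounded_linear_sub bounded_linear_fst bounded_linear_snd)
  from analytic_at_linear_image[OF this analytic_at_Pair[OF assms]] show ?thesis by simp
qed

lemma analytic_at_inverse [analytic_intros]:
  fixes f :: "'e::real_normed_vector \<Rightarrow> 'f::{real_normed_algebra, monoid_mult, banach}"
  assumes "f x \<in> invertible_elements" "analytic_at UNIV f x"
  shows "analytic_at UNIV (\<lambda>y. inverse_of (f y)) x"
  by (rule analytic_at_UNIV_compose[OF analytic_at_inverse_of[OF assms(1)] assms(2)])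

section \<open>Charts of subsets of a Banach space\<close>

text \<open>Relative openness as a local condition; charts are compared near single points throughout.\<close>

lemma openin_iff_eventually:
  "openin (top_of_set S) A \<longleftrightarrow> A \<subseteq> S \<and> (\<forall>p\<in>A. \<forall>\<^sub>F y in nhds p. y \<in> S \<longrightarrow> y \<in> A)"
  (is "_ \<longleftrightarrow> ?R")
proof
  assume "openin (top_of_set S) A"
  then obtain U where U: "open U" "A = S \<inter> U" by (auto simp: openin_open)
  show ?R
    unfolding U(2) by (auto intro!: eventually_mono[OF eventually_nhds_in_open[OF U(1)]])
next
  assume R: ?R
  define U where "U = {p. \<forall>\<^sub>F y in nhds p. y \<in> S \<longrightarrow> y \<in> A}"
  have "open U" unfolding open_subopen[of U]
  proof
    fix p assume "p \<in> U"
    then obtain B where "open B" "p \<in> B" "\<forall>y\<in>B. y \<in> S \<longrightarrow> y \<in> A"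
      unfolding U_def eventually_nhds by auto
    then show "\<exists>T. open T \<and> p \<in> T \<and> T \<subseteq> U"
      unfolding U_def eventually_nhds by blast
  qed
  moreover have "A = S \<inter> U"
    using R eventually_nhds_x_imp_x unfolding U_def by fastforce
  ultimately show "openin (top_of_set S) A" by (auto simp: openin_open)
qed

lemma openin_imp_eventually:
  "openin (top_of_set S) A \<Longrightarrow> p \<in> A \<Longrightarrow> \<forall>\<^sub>F y in nhds p. y \<in> S \<longrightarrow> y \<in> A"
  by (simp add: openin_iff_eventually)

lemma continuous_within_eventually:
  fixes k :: "'a::metric_space \<Rightarrow> 'b::metric_space"
  assumes k: "continuous (at v within V) k" and P: "\<forall>\<^sub>F y in nhds (k v). P y"
  shows "\<forall>\<^sub>F w in nhds v. w \<in> V \<longrightarrow> P (k w)"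
proof -
  obtain e where e: "e > 0" "\<And>y. dist y (k v) < e \<Longrightarrow> P y"
    using P unfolding eventually_nhds_metric by auto
  obtain d where d: "d > 0" "\<And>w. w \<in> V \<Longrightarrow> dist w v < d \<Longrightarrow> dist (k w) (k v) < e"
    using k e(1) unfolding continuous_within_eps_delta by blast
  show ?thesis unfolding eventually_nhds_metric using d e(2) by blast
qed

text \<open>This notion of analyticity is available for an arbitrary subset \<open>S\<close>, before any manifold structure,
and it is stable under composition without reference to charts.\<close>

definition extends_analytically ::
  "'e::real_normed_vector set \<Rightarrow> ('e \<Rightarrow> 'f::real_normed_vector) \<Rightarrow> 'e \<Rightarrow> bool" where
  "extends_analytically S f p \<longleftrightarrow>
     (\<exists>F. analytic_at UNIV F p \<and> (\<forall>\<^sub>F y in nhds p. y \<in> S \<longrightarrow> F y = f y))"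

lemma extends_analyticallyI: "analytic_at UNIV f p \<Longrightarrow> extends_analytically S f p"
  unfolding extends_analytically_def by auto

lemma extends_analytically_cong:
  assumes "extends_analytically S f p" "\<forall>\<^sub>F y in nhds p. y \<in> S \<longrightarrow> g y = f y"
  shows "extends_analytically S g p"
proof -
  obtain F where F: "analytic_at UNIV F p" "\<forall>\<^sub>F y in nhds p. y \<in> S \<longrightarrow> F y = f y"
    using assms(1) unfolding extends_analytically_def by blast
  have "\<forall>\<^sub>F y in nhds p. y \<in> S \<longrightarrow> F y = g y" using F(2) assms(2) by eventually_elim auto
  then show ?thesis using F(1) unfolding extends_analytically_def by blast
qed

lemma extends_analytically_subset:
  assumes "extends_analytically S f p" "T \<subseteq> S"
  shows "extends_analytically T f p"
proof -
  obtain F where F: "analytic_at UNIV F p" "\<forall>\<^sub>F y in nhds p. y \<in> S \<longrightarrow> F y = f y"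
    using assms(1) unfolding extends_analytically_def by blast
  have "\<forall>\<^sub>F y in nhds p. y \<in> T \<longrightarrow> F y = f y" using F(2) by eventually_elim (use assms(2) in auto)
  then show ?thesis using F(1) unfolding extends_analytically_def by blast
qed

lemma extends_analytically_eventually:
  assumes "extends_analytically S f p" "p \<in> S" "\<forall>\<^sub>F z in nhds (f p). P z"
  shows "\<forall>\<^sub>F y in nhds p. y \<in> S \<longrightarrow> P (f y)"
proof -
  obtain F where F: "analytic_at UNIV F p" "\<forall>\<^sub>F y in nhds p. y \<in> S \<longrightarrow> F y = f y"
    using assms(1) unfolding extends_analytically_def by blast
  have Fp: "F p = f p" using eventually_nhds_x_imp_x[OF F(2)] assms(2) by blast
  have "continuous (at p within UNIV) F" by (rule analytic_at_imp_continuous[OF F(1)]) auto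
  from continuous_within_eventually[OF this, of P]
  have "\<forall>\<^sub>F y in nhds p. P (F y)" using assms(3) Fp by simp
  then show ?thesis using F(2) by eventually_elim auto
qed

lemma extends_analytically_continuous_on:
  assumes "\<And>p. p \<in> S \<Longrightarrow> extends_analytically S f p"
  shows "continuous_on S f"
  unfolding continuous_on_iff
proof (intro ballI allI impI)
  fix p and e :: real assume p: "p \<in> S" "e > 0"
  have "\<forall>\<^sub>F z in nhds (f p). dist z (f p) < e"
    unfolding eventually_nhds_metric using p by auto
  from extends_analytically_eventually[OF assms[OF p(1)] p(1) this]
  obtain d where "d > 0" "\<And>y. dist y p < d \<Longrightarrow> y \<in> S \<Longrightarrow> dist (f y) (f p) < e"
    by (auto simp: eventually_nhds_metric)
  then show "\<exists>d>0. \<forall>x'\<in>S. dist x' p < d \<longrightarrow> dist (f x') (f p) < e"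
    by (intro exI[of _ d] conjI ballI impI)
qed

lemma extends_analytically_compose:
  fixes f :: "'e::banach \<Rightarrow> 'f::banach" and g :: "'f \<Rightarrow> 'g::banach"
  assumes f: "extends_analytically S f p" and g: "extends_analytically T g (f p)"
    and p: "p \<in> S" and ST: "\<forall>\<^sub>F y in nhds p. y \<in> S \<longrightarrow> f y \<in> T"
  shows "extends_analytically S (\<lambda>y. g (f y)) p"
proof -
  obtain F where F: "analytic_at UNIV F p" "\<forall>\<^sub>F y in nhds p. y \<in> S \<longrightarrow> F y = f y"
    using f unfolding extends_analytically_def by blast
  obtain G where G: "analytic_at UNIV G (f p)" "\<forall>\<^sub>F y in nhds (f p). y \<in> T \<longrightarrow> G y = g y"
    using g unfolding extends_analytically_def by blast
  have Fp: "F p = f p" using eventually_nhds_x_imp_x[OF F(2)] p by blast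
  have "analytic_at UNIV (\<lambda>y. G (F y)) p" 
    by (rule analytic_at_UNIV_compose[of G F p]) (simp_all add: Fp G(1) F(1))
  moreover have "\<forall>\<^sub>F y in nhds p. y \<in> S \<longrightarrow> G (F y) = g (f y)"
    using extends_analytically_eventually[OF f p G(2)] F(2) ST by eventually_elim auto
  ultimately show ?thesis unfolding extends_analytically_def by blast
qed

text \<open>A map that extends analytically may be composed with an analytic parametrisation of \<open>S\<close>: the
composite then passes through the full ambient space.\<close>

lemma analytic_at_pull_back:
  fixes k :: "'e::banach \<Rightarrow> 'f::banach" and f :: "'f \<Rightarrow> 'g::banach"
  assumes k: "analytic_at V k v" and V: "subspace V" "v \<in> V" and f: "extends_analytically S f (k v)"
    and kS: "\<forall>\<^sub>F w in nhds v. w \<in> V \<longrightarrow> k w \<in> S"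
  shows "analytic_at V (\<lambda>w. f (k w)) v"
proof -
  obtain F where F: "analytic_at UNIV F (k v)" "\<forall>\<^sub>F y in nhds (k v). y \<in> S \<longrightarrow> F y = f y"
    using f unfolding extends_analytically_def by blast
  have "analytic_at V (\<lambda>w. F (k w)) v"
    using subspace_0[OF V(1)] by (rule analytic_at_compose[OF k F(1)])
  then show ?thesis
  proof (rule analytic_at_cong_nhds[OF _ V])
    show "\<forall>\<^sub>F w in nhds v. w \<in> V \<longrightarrow> f (k w) = F (k w)"
      using continuous_within_eventually[OF analytic_at_imp_continuous[OF k V] F(2)] kS
      by eventually_elim auto
  qed
qed

lemma is_chartD:
  assumes "is_chart (top_of_set S) c"
  shows "cdom c \<subseteq> S" "openin (top_of_set S) (cdom c)" "subspace (model c)" "closed (model c)"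
    "openin (top_of_set (model c)) (cmap c ` cdom c)" "inj_on (cmap c) (cdom c)"
    "continuous_on (cdom c) (cmap c)"
    "\<And>p. p \<in> cdom c \<Longrightarrow> cmap c p \<in> model c" "\<And>p. p \<in> cdom c \<Longrightarrow> cinv c (cmap c p) = p"
    "\<And>w. w \<in> cmap c ` cdom c \<Longrightarrow> cinv c w \<in> cdom c \<and> cmap c (cinv c w) = w"
    "homeomorphic_map (top_of_set (cdom c)) (top_of_set (cmap c ` cdom c)) (cmap c)"
proof -
  show *: "openin (top_of_set S) (cdom c)" "subspace (model c)" "closed (model c)"
    "openin (top_of_set (model c)) (cmap c ` cdom c)"
    using assms unfolding is_chart_def closed_subspace_def by auto
  show sub: "cdom c \<subseteq> S" using *(1) openin_imp_subset by blast
  show h: "homeomorphic_map (top_of_set (cdom c)) (top_of_set (cmap c ` cdom c)) (cmap c)"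
    using assms sub unfolding is_chart_def by (simp add: subtopology_subtopology Int_absorb1)
  show inj: "inj_on (cmap c) (cdom c)" using homeomorphic_imp_injective_map[OF h] by simp
  show "continuous_on (cdom c) (cmap c)"
    using homeomorphic_imp_continuous_map[OF h] by (simp add: continuous_map_in_subtopology)
  show "\<And>p. p \<in> cdom c \<Longrightarrow> cmap c p \<in> model c" using openin_imp_subset[OF *(4)] by auto
  show "\<And>p. p \<in> cdom c \<Longrightarrow> cinv c (cmap c p) = p"
    unfolding cinv_def using inj by simp
  show "\<And>w. w \<in> cmap c ` cdom c \<Longrightarrow> cinv c w \<in> cdom c \<and> cmap c (cinv c w) = w"
    unfolding cinv_def by (simp add: inv_into_into f_inv_into_f)
qed

lemma is_chart_openin_image:
  assumes c: "is_chart (top_of_set S) c" and U: "openin (top_of_set S) U" "U \<subseteq> cdom c"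
  shows "openin (top_of_set (model c)) (cmap c ` U)"
proof -
  have "openin (top_of_set (cdom c)) U"
    using U is_chartD(1)[OF c] by (meson openin_subset_trans)
  then have "openin (top_of_set (cmap c ` cdom c)) (cmap c ` U)"
    using homeomorphic_imp_open_map[OF is_chartD(11)[OF c]] unfolding open_map_def by blast
  then show ?thesis using is_chartD(5)[OF c] by (rule openin_trans)
qed

lemma is_chart_eventually:
  assumes c: "is_chart (top_of_set S) c" and p: "p \<in> cdom c"
  shows "\<forall>\<^sub>F y in nhds p. y \<in> S \<longrightarrow> y \<in> cdom c"
    and "\<forall>\<^sub>F w in nhds (cmap c p). w \<in> model c \<longrightarrow> w \<in> cmap c ` cdom c"
  using openin_imp_eventually[OF is_chartD(2)[OF c] p]
    openin_imp_eventually[OF is_chartD(5)[OF c]] p by auto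

text \<open>The two conditions serve the two ends of a local representative, which begins with the inverse of
one chart and ends with another chart: the first one must lead into the ambient space, the second
one must be applicable there.\<close>

definition embedded_chart :: "'e::banach set \<Rightarrow> ('e, 'f::banach) chart \<Rightarrow> bool" where
  "embedded_chart S c \<longleftrightarrow> is_chart (top_of_set S) c \<and>
     (\<forall>p\<in>cdom c. extends_analytically S (cmap c) p \<and> analytic_at (model c) (cinv c) (cmap c p))"

text \<open>The local representative factors through the ambient spaces: first the inverse of \<open>c\<close>, then the
extensions of \<open>f\<close> and of \<open>d\<close>.\<close>

lemma local_representative_analytic:
  assumes c: "embedded_chart S c" and d: "embedded_chart T d"
    and p: "p \<in> cdom c" "f p \<in> cdom d" and f: "extends_analytically S f p"
    and fT: "\<forall>\<^sub>F y in nhds p. y \<in> S \<longrightarrow> f y \<in> T"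
  shows "analytic_at (model c) (cmap d \<circ> f \<circ> cinv c) (cmap c p)"
proof -
  have cc: "is_chart (top_of_set S) c" and cd: "is_chart (top_of_set T) d"
    using c d unfolding embedded_chart_def by auto
  note C = is_chartD[OF cc]
  have pS: "p \<in> S" using C(1) p by blast
  have "extends_analytically T (cmap d) (f p)" using d p unfolding embedded_chart_def by blast
  from extends_analytically_compose[OF f this pS fT]
  have e: "extends_analytically S (\<lambda>y. cmap d (f y)) (cinv c (cmap c p))" using C(9)[OF p(1)] by simp
  have k: "analytic_at (model c) (cinv c) (cmap c p)" using c p unfolding embedded_chart_def by blast
  have "\<forall>\<^sub>F w in nhds (cmap c p). w \<in> model c \<longrightarrow> cinv c w \<in> S"
    using is_chart_eventually(2)[OF cc p(1)] by eventually_elim (use C(1,10) in auto)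
  from analytic_at_pull_back[OF k C(3) C(8)[OF p(1)] e this]
  show ?thesis by (simp add: o_def)
qed

lemma local_representative_real_analytic_on:
  assumes c: "embedded_chart S c" and d: "embedded_chart T d"
    and f: "\<And>p. p \<in> S \<Longrightarrow> extends_analytically S f p" and fT: "\<And>p. p \<in> S \<Longrightarrow> f p \<in> T"
  shows "real_analytic_on (model c) (cmap c ` {x \<in> cdom c. f x \<in> cdom d}) (cmap d \<circ> f \<circ> cinv c)"
proof -
  have cc: "is_chart (top_of_set S) c" and cd: "is_chart (top_of_set T) d"
    using c d unfolding embedded_chart_def by auto
  note C = is_chartD[OF cc]
  have op: "openin (top_of_set S) {x \<in> cdom c. f x \<in> cdom d}"
    unfolding openin_iff_eventually
  proof (intro conjI ballI)
    fix p assume p: "p \<in> {x \<in> cdom c. f x \<in> cdom d}"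
    then have pS: "p \<in> S" using C(1) by auto
    have "\<forall>\<^sub>F y in nhds p. y \<in> S \<longrightarrow> f y \<in> T \<longrightarrow> f y \<in> cdom d"
      using p is_chart_eventually(1)[OF cd, of "f p"]
      by (intro extends_analytically_eventually[OF f[OF pS] pS]) auto
    moreover have "\<forall>\<^sub>F y in nhds p. y \<in> S \<longrightarrow> y \<in> cdom c"
      using p is_chart_eventually(1)[OF cc, of p] by auto
    ultimately show "\<forall>\<^sub>F y in nhds p. y \<in> S \<longrightarrow> y \<in> {x \<in> cdom c. f x \<in> cdom d}"
      by eventually_elim (use fT in auto)
  qed (use C(1) in auto)
  show ?thesis
    unfolding real_analytic_on_iff[OF C(3)]
  proof (intro conjI ballI)
    show "openin (top_of_set (model c)) (cmap c ` {x \<in> cdom c. f x \<in> cdom d})"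
      by (rule is_chart_openin_image[OF cc op]) auto
    fix w assume "w \<in> cmap c ` {x \<in> cdom c. f x \<in> cdom d}"
    then obtain p where p: "p \<in> cdom c" "f p \<in> cdom d" "w = cmap c p" by auto
    have pS: "p \<in> S" using C(1) p by auto
    show "analytic_at (model c) (cmap d \<circ> f \<circ> cinv c) w"
      unfolding p(3) by (rule local_representative_analytic[OF c d p(1,2) f[OF pS]]) (use fT in auto)
  qed
qed

text \<open>A transition map is the local representative of the identity.\<close>

lemma embedded_charts_compatible:
  assumes "embedded_chart S c" "embedded_chart S d"
  shows "compatible c d"
proof -
  have id: "extends_analytically S (\<lambda>y. y) p" for p by (rule extends_analyticallyI[OF analytic_at_ident])
  have eq: "{x \<in> cdom c. x \<in> cdom d} = cdom c \<inter> cdom d" "{x \<in> cdom d. x \<in> cdom c} = cdom c \<inter> cdom d" by auto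
  show ?thesis
    unfolding compatible_def
    using local_representative_real_analytic_on[OF assms id]
      local_representative_real_analytic_on[OF assms(2,1) id]
    by (simp add: eq o_def)
qed

definition projection_onto :: "('e::real_normed_vector \<Rightarrow> 'e) \<Rightarrow> 'e set \<Rightarrow> bool" where
  "projection_onto P V \<longleftrightarrow> bounded_linear P \<and> (\<forall>x. P x \<in> V) \<and> (\<forall>x\<in>V. P x = x)"

lemma projection_ontoD:
  assumes "projection_onto P V"
  shows "bounded_linear P" "\<And>x. P x \<in> V" "\<And>x. x \<in> V \<Longrightarrow> P x = x"
  using assms unfolding projection_onto_def by auto

lemma projection_onto_closed_subspace:
  assumes "projection_onto P V" shows "closed_subspace V"
proof -
  note P = projection_ontoD[OF assms]
  interpret bounded_linear P by (rule P)
  have eq: "V = {x. P x = x}" using P(2,3) by (auto intro: P(2)) (metis P(2))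
  have "closed {x. P x = x}"
    by (intro closed_Collect_eq linear_continuous_on[OF P(1)] continuous_on_id)
  moreover have "subspace {x. P x = x}" unfolding subspace_def by (auto simp: add scaleR zero)
  ultimately show ?thesis unfolding closed_subspace_def eq[symmetric] by simp
qed

lemma projection_onto_complemented:
  assumes P: "projection_onto P V" and Q: "projection_onto Q W" and WV: "W \<subseteq> V"
  shows "complemented_in V W"
proof -
  interpret Q: bounded_linear Q by (rule projection_ontoD[OF Q])
  have V: "subspace V" "closed V"
    using projection_onto_closed_subspace[OF P] unfolding closed_subspace_def by auto
  have "closed {v. Q v = 0}"
    by (intro closed_Collect_eq linear_continuous_on[OF projection_ontoD(1)[OF Q]] continuous_on_const)
  moreover have "subspace {v. Q v = 0}" unfolding subspace_def by (auto simp: Q.add Q.scaleR Q.zero)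
  ultimately have C: "closed_subspace (V \<inter> {v. Q v = 0})"
    using V unfolding closed_subspace_def by (auto intro: subspace_inter)
  show ?thesis
    unfolding complemented_in_def
  proof (intro conjI exI[of _ "V \<inter> {v. Q v = 0}"] C projection_onto_closed_subspace[OF Q] WV ballI)
    show "W \<inter> (V \<inter> {v. Q v = 0}) = {0}"
      using projection_ontoD[OF Q] WV projection_onto_closed_subspace[OF Q] Q.zero
      unfolding closed_subspace_def by (auto simp: subspace_0)
    fix v assume v: "v \<in> V"
    have "v - Q v \<in> V \<inter> {v. Q v = 0}"
      using v V WV projection_ontoD(2,3)[OF Q] by (auto simp: subspace_diff subset_iff Q.diff)
    moreover have "v = Q v + (v - Q v)" by simp
    ultimately show "\<exists>w\<in>W. \<exists>c\<in>V \<inter> {v. Q v = 0}. v = w + c"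
      using projection_ontoD(2)[OF Q] by blast
  qed auto
qed

text \<open>The projection makes it possible to extend maps from the model space to the ambient space. An
arbitrary chart of a maximal atlas need not have a complemented model space.\<close>

definition slice_chart :: "'e::banach set \<Rightarrow> ('e, 'f::banach) chart \<Rightarrow> bool" where
  "slice_chart S c \<longleftrightarrow> embedded_chart S c \<and> (\<exists>P. projection_onto P (model c))"

text \<open>The reason why charts of a maximal atlas can be controlled although nothing is known about their
model spaces. Near \<open>p\<close>, choose a slice chart \<open>d\<close> with projection \<open>P\<close>. Then \<open>c\<close> is the composite
\<open>(c \<circ> d\<^sup>-\<^sup>1) \<circ> P \<circ> d\<close> and \<open>c\<^sup>-\<^sup>1\<close> is the composite \<open>(d\<^sup>-\<^sup>1 \<circ> P) \<circ> (d \<circ> c\<^sup>-\<^sup>1)\<close>, and thanks to \<open>P\<close> both pass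
through whole Banach spaces.\<close>

lemma compatible_imp_embedded_chart:
  assumes c: "is_chart (top_of_set S) c"
    and cov: "\<And>p. p \<in> cdom c \<Longrightarrow> \<exists>d. p \<in> cdom d \<and> slice_chart S d \<and> compatible c d"
  shows "embedded_chart S c"
  unfolding embedded_chart_def
proof (intro conjI ballI c)
  note C = is_chartD[OF c]
  fix p assume p: "p \<in> cdom c"
  obtain d P where d: "p \<in> cdom d" "embedded_chart S d" "compatible c d" "projection_onto P (model d)"
    using cov[OF p] unfolding slice_chart_def by auto
  note P = projection_ontoD[OF d(4)]
  have cd: "is_chart (top_of_set S) d" using d unfolding embedded_chart_def by auto
  note D = is_chartD[OF cd]
  have pS: "p \<in> S" using C(1) p by blast
  have Pp: "P (cmap d p) = cmap d p" by (rule P(3)[OF D(8)[OF d(1)]])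
  have "analytic_at (model d) (cmap c \<circ> cinv d) (cmap d p)"
    using d(3) p d(1) unfolding compatible_def real_analytic_on_iff[OF D(3)] by auto
  then have "analytic_at UNIV (\<lambda>y. (cmap c \<circ> cinv d) (P y)) (cmap d p)"
    by (intro analytic_at_compose_bounded_linear[OF _ P(1), of "model d"]) (simp_all only: Pp P(2))
  note ext = extends_analyticallyI[OF this, of UNIV]
  have "extends_analytically S (cmap d) p" using d(1,2) unfolding embedded_chart_def by blast
  from extends_analytically_compose[OF this ext pS]
  have "extends_analytically S (\<lambda>y. (cmap c \<circ> cinv d) (P (cmap d y))) p" by simp
  then show "extends_analytically S (cmap c) p"
  proof (rule extends_analytically_cong)
    show "\<forall>\<^sub>F y in nhds p. y \<in> S \<longrightarrow> cmap c y = (cmap c \<circ> cinv d) (P (cmap d y))"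
      using is_chart_eventually(1)[OF cd d(1)] by eventually_elim (use D(8,9) P(3) in auto)
  qed
  have a: "analytic_at (model c) (cmap d \<circ> cinv c) (cmap c p)"
    using d(3) p d(1) unfolding compatible_def real_analytic_on_iff[OF C(3)] by auto
  have ep: "(cmap d \<circ> cinv c) (cmap c p) = cmap d p" using C(9)[OF p] by simp
  have "analytic_at (model d) (cinv d) (cmap d p)" using d(1,2) unfolding embedded_chart_def by blast
  then have "analytic_at UNIV (\<lambda>y. cinv d (P y)) (cmap d p)"
    by (intro analytic_at_compose_bounded_linear[OF _ P(1), of "model d"]) (simp_all only: Pp P(2))
  then have "analytic_at (model c) (\<lambda>w. cinv d (P ((cmap d \<circ> cinv c) w))) (cmap c p)"
    using subspace_0[OF C(3)] by (intro analytic_at_compose[OF a, of "\<lambda>y. cinv d (P y)"]) (simp_all only: ep)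
  then show "analytic_at (model c) (cinv c) (cmap c p)"
  proof (rule analytic_at_cong_nhds[OF _ C(3) C(8)[OF p]])
    have "openin (top_of_set (model c)) (cmap c ` (cdom c \<inter> cdom d))"
      by (rule is_chart_openin_image[OF c]) (use C(2) D(2) in auto)
    from openin_imp_eventually[OF this, of "cmap c p"]
    have "\<forall>\<^sub>F w in nhds (cmap c p). w \<in> model c \<longrightarrow> w \<in> cmap c ` (cdom c \<inter> cdom d)"
      using p d(1) by blast
    then show "\<forall>\<^sub>F w in nhds (cmap c p). w \<in> model c \<longrightarrow> cinv c w = cinv d (P ((cmap d \<circ> cinv c) w))"
      by eventually_elim (use C(9) D(8,9) P(3) in auto)
  qed
qed

section \<open>Manifolds embedded in a Banach space\<close>

text \<open>The supply of slice charts ensures that the charts of the maximal atlas are embedded as well, and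
these are the charts from which the atlas of a submanifold is made.\<close>

definition embedded_manifold :: "('e::banach, 'f::banach) manifold \<Rightarrow> 'e set \<Rightarrow> bool" where
  "embedded_manifold M S \<longleftrightarrow> mtop M = top_of_set S \<and> (\<forall>c\<in>atlas M. embedded_chart S c) \<and>
     (\<forall>p\<in>S. \<exists>c\<in>atlas M. p \<in> cdom c \<and> slice_chart S c)"

lemma embedded_manifoldD:
  assumes "embedded_manifold M S"
  shows "mtop M = top_of_set S" "\<And>c. c \<in> atlas M \<Longrightarrow> embedded_chart S c"
    "\<And>c. c \<in> atlas M \<Longrightarrow> is_chart (top_of_set S) c"
    "\<And>p. p \<in> S \<Longrightarrow> \<exists>c\<in>atlas M. p \<in> cdom c \<and> slice_chart S c"
  using assms unfolding embedded_manifold_def embedded_chart_def by auto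

lemma embedded_manifold_real_analytic:
  assumes "embedded_manifold M S"
  shows "real_analytic_manifold M"
proof -
  note M = embedded_manifoldD[OF assms]
  have "(\<Union>c\<in>atlas M. cdom c) = S"
    using M(4) is_chartD(1)[OF M(3)] by blast
  then show ?thesis
    unfolding real_analytic_manifold_def
    using M embedded_charts_compatible[OF M(2) M(2)] by (auto simp: Hausdorff_space_subtopology)
qed

lemma embedded_maximal_atlas:
  assumes "embedded_manifold M S"
  shows "c \<in> maximal_atlas M \<longleftrightarrow> embedded_chart S c"
proof
  note M = embedded_manifoldD[OF assms]
  assume c: "c \<in> maximal_atlas M"
  then have cc: "is_chart (top_of_set S) c" using M(1) unfolding maximal_atlas_def by auto
  show "embedded_chart S c"
  proof (rule compatible_imp_embedded_chart[OF cc])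
    fix p assume "p \<in> cdom c"
    then have "p \<in> S" using is_chartD(1)[OF cc] by blast
    then show "\<exists>d. p \<in> cdom d \<and> slice_chart S d \<and> compatible c d"
      using M(4)[of p] c unfolding maximal_atlas_def by blast
  qed
next
  note M = embedded_manifoldD[OF assms]
  assume c: "embedded_chart S c"
  then show "c \<in> maximal_atlas M"
    unfolding maximal_atlas_def using M(1) embedded_charts_compatible[OF c M(2)]
    by (auto simp: embedded_chart_def)
qed

lemma embedded_real_analytic_map:
  assumes M: "embedded_manifold M S" and N: "embedded_manifold N T"
    and f: "\<And>p. p \<in> S \<Longrightarrow> extends_analytically S f p" and fT: "\<And>p. p \<in> S \<Longrightarrow> f p \<in> T"
  shows "real_analytic_map M N f"
  unfolding real_analytic_map_def
proof (intro conjI ballI)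
  show "continuous_map (mtop M) (mtop N) f"
    using extends_analytically_continuous_on[OF f] fT
    by (auto simp: embedded_manifoldD(1)[OF M] embedded_manifoldD(1)[OF N] continuous_map_in_subtopology)
  fix c d assume "c \<in> atlas M" "d \<in> atlas N"
  then show "real_analytic_on (model c) (cmap c ` {x \<in> cdom c. f x \<in> cdom d}) (cmap d \<circ> f \<circ> cinv c)"
    by (intro local_representative_real_analytic_on[OF embedded_manifoldD(2)[OF M] embedded_manifoldD(2)[OF N] f fT])
qed

lemma extends_analytically_map_prod:
  fixes f :: "'a::banach \<Rightarrow> 'b::banach" and g :: "'c::banach \<Rightarrow> 'd::banach"
  assumes "extends_analytically S f p" "extends_analytically T g q"
  shows "extends_analytically (S \<times> T) (map_prod f g) (p, q)"
proof -
  obtain F where F: "analytic_at UNIV F p" "\<forall>\<^sub>F y in nhds p. y \<in> S \<longrightarrow> F y = f y"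
    using assms(1) unfolding extends_analytically_def by blast
  obtain G where G: "analytic_at UNIV G q" "\<forall>\<^sub>F y in nhds q. y \<in> T \<longrightarrow> G y = g y"
    using assms(2) unfolding extends_analytically_def by blast
  have "analytic_at UNIV (\<lambda>z. F (fst z)) (p, q)"
    by (rule analytic_at_UNIV_compose[of F fst])
      (simp_all add: F analytic_at_bounded_linear[OF bounded_linear_fst])
  moreover have "analytic_at UNIV (\<lambda>z. G (snd z)) (p, q)"
    by (rule analytic_at_UNIV_compose[of G snd])
      (simp_all add: G analytic_at_bounded_linear[OF bounded_linear_snd])
  ultimately have "analytic_at UNIV (\<lambda>z. (F (fst z), G (snd z))) (p, q)"
    by (rule analytic_at_Pair)
  moreover have "\<forall>\<^sub>F z in nhds (p, q). z \<in> S \<times> T \<longrightarrow> (F (fst z), G (snd z)) = map_prod f g z"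
    unfolding nhds_prod using eventually_prodI[OF F(2) G(2)] by eventually_elim (auto simp: map_prod_def)
  ultimately show ?thesis unfolding extends_analytically_def by blast
qed

definition prod_chart :: "('m, 'e) chart \<Rightarrow> ('n, 'f) chart \<Rightarrow> ('m \<times> 'n, 'e \<times> 'f) chart" where
  "prod_chart c d = \<lparr>cdom = cdom c \<times> cdom d, cmap = map_prod (cmap c) (cmap d), model = model c \<times> model d\<rparr>"

lemma is_chart_prod_chart:
  assumes c: "is_chart (top_of_set S) c" and d: "is_chart (top_of_set T) d"
  shows "is_chart (top_of_set (S \<times> T)) (prod_chart c d)"
proof -
  note C = is_chartD[OF c] and D = is_chartD[OF d]
  have im: "map_prod (cmap c) (cmap d) ` (cdom c \<times> cdom d) = cmap c ` cdom c \<times> cmap d ` cdom d"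
    by (rule map_prod_surj_on) auto
  obtain kc where kc: "homeomorphic_maps (top_of_set (cdom c)) (top_of_set (cmap c ` cdom c)) (cmap c) kc"
    using C(11) homeomorphic_map_maps by blast
  obtain kd where kd: "homeomorphic_maps (top_of_set (cdom d)) (top_of_set (cmap d ` cdom d)) (cmap d) kd"
    using D(11) homeomorphic_map_maps by blast
  have "homeomorphic_maps (prod_topology (top_of_set (cdom c)) (top_of_set (cdom d)))
      (prod_topology (top_of_set (cmap c ` cdom c)) (top_of_set (cmap d ` cdom d)))
      (\<lambda>(x, y). (cmap c x, cmap d y)) (\<lambda>(x, y). (kc x, kd y))"
    using homeomorphic_maps_prod[THEN iffD2] kc kd by blast
  then have "homeomorphic_map (top_of_set (cdom c \<times> cdom d))
      (top_of_set (cmap c ` cdom c \<times> cmap d ` cdom d)) (map_prod (cmap c) (cmap d))"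
    unfolding map_prod_def by (auto simp: homeomorphic_map_maps)
  then show ?thesis
    unfolding is_chart_def prod_chart_def closed_subspace_def
    using C(1-5) D(1-5)
    by (auto simp: im openin_Times subspace_Times closed_Times subtopology_subtopology Int_absorb1 Sigma_mono)
qed

lemma embedded_chart_prod:
  assumes c: "embedded_chart S c" and d: "embedded_chart T d"
  shows "embedded_chart (S \<times> T) (prod_chart c d)"
proof -
  have cc: "is_chart (top_of_set S) c" and cd: "is_chart (top_of_set T) d"
    using c d unfolding embedded_chart_def by auto
  note C = is_chartD[OF cc] and D = is_chartD[OF cd]
  have cp: "is_chart (top_of_set (S \<times> T)) (prod_chart c d)" by (rule is_chart_prod_chart[OF cc cd])
  note CP = is_chartD[OF cp]
  show ?thesis
    unfolding embedded_chart_def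
  proof (intro conjI cp ballI)
    fix z assume z: "z \<in> cdom (prod_chart c d)"
    then obtain p q where pq: "z = (p, q)" "p \<in> cdom c" "q \<in> cdom d" by (auto simp: prod_chart_def)
    show "extends_analytically (S \<times> T) (cmap (prod_chart c d)) z"
      using c d pq unfolding embedded_chart_def prod_chart_def
      by (auto intro!: extends_analytically_map_prod)
    let ?V = "model c \<times> model d"
    have "analytic_at ?V (\<lambda>w. cinv c (fst w)) (cmap c p, cmap d q)"
      using c pq unfolding embedded_chart_def
      by (intro analytic_at_compose_bounded_linear[OF _ bounded_linear_fst]) auto
    moreover have "analytic_at ?V (\<lambda>w. cinv d (snd w)) (cmap c p, cmap d q)"
      using d pq unfolding embedded_chart_def
      by (intro analytic_at_compose_bounded_linear[OF _ bounded_linear_snd]) auto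
    ultimately have an: "analytic_at ?V (\<lambda>w. (cinv c (fst w), cinv d (snd w))) (cmap c p, cmap d q)"
      by (rule analytic_at_Pair)
    have "analytic_at ?V (cinv (prod_chart c d)) (cmap c p, cmap d q)"
    proof (rule analytic_at_cong_nhds[OF an])
      show "subspace ?V" "(cmap c p, cmap d q) \<in> ?V" using C(3,8) D(3,8) pq by (auto intro: subspace_Times)
      have "\<forall>\<^sub>F w in nhds (cmap c p, cmap d q). w \<in> ?V \<longrightarrow> w \<in> cmap (prod_chart c d) ` cdom (prod_chart c d)"
        using is_chart_eventually(2)[OF cp z] pq(1) by (simp add: prod_chart_def)
      then show "\<forall>\<^sub>F w in nhds (cmap c p, cmap d q). w \<in> ?V \<longrightarrow>
          cinv (prod_chart c d) w = (cinv c (fst w), cinv d (snd w))"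
      proof eventually_elim
        case (elim w)
        show ?case
        proof
          assume "w \<in> ?V"
          then obtain a b where ab: "a \<in> cdom c" "b \<in> cdom d" "w = cmap (prod_chart c d) (a, b)"
            using elim by (auto simp: prod_chart_def)
          then have "cinv (prod_chart c d) w = (a, b)" using CP(9)[of "(a, b)"] by (simp add: prod_chart_def)
          then show "cinv (prod_chart c d) w = (cinv c (fst w), cinv d (snd w))"
            using ab C(9) D(9) by (simp add: prod_chart_def)
        qed
      qed
    qed
    then show "analytic_at (model (prod_chart c d)) (cinv (prod_chart c d)) (cmap (prod_chart c d) z)"
      by (simp add: prod_chart_def pq(1))
  qed
qed

lemma projection_onto_prod:
  assumes "projection_onto P V" "projection_onto Q W"
  shows "projection_onto (\<lambda>z. (P (fst z), Q (snd z))) (V \<times> W)"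
  using assms unfolding projection_onto_def
  by (auto intro!: bounded_linear_Pair bounded_linear_compose[OF _ bounded_linear_fst]
      bounded_linear_compose[OF _ bounded_linear_snd])

lemma embedded_manifold_prod:
  assumes M: "embedded_manifold M S" and N: "embedded_manifold N T"
  shows "embedded_manifold (prod_manifold M N) (S \<times> T)"
proof -
  note M = embedded_manifoldD[OF M] and N = embedded_manifoldD[OF N]
  have at: "atlas (prod_manifold M N) = {prod_chart c d | c d. c \<in> atlas M \<and> d \<in> atlas N}"
    by (simp add: prod_manifold_def prod_chart_def)
  show ?thesis
    unfolding embedded_manifold_def
  proof (intro conjI ballI)
    show "mtop (prod_manifold M N) = top_of_set (S \<times> T)"
      by (simp add: prod_manifold_def M(1) N(1))
    show "embedded_chart (S \<times> T) e" if "e \<in> atlas (prod_manifold M N)" for e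
      using that M(2) N(2) unfolding at by (auto intro: embedded_chart_prod)
    fix z assume "z \<in> S \<times> T"
    then obtain c d where cd: "c \<in> atlas M" "d \<in> atlas N" "fst z \<in> cdom c" "snd z \<in> cdom d"
      "slice_chart S c" "slice_chart T d"
      using M(4)[of "fst z"] N(4)[of "snd z"] by (auto simp: mem_Times_iff)
    have "slice_chart (S \<times> T) (prod_chart c d)"
      using cd(5,6) embedded_chart_prod projection_onto_prod unfolding slice_chart_def
      by (fastforce simp: prod_chart_def)
    then show "\<exists>c\<in>atlas (prod_manifold M N). z \<in> cdom c \<and> slice_chart (S \<times> T) c"
      unfolding at using cd by (intro bexI[of _ "prod_chart c d"]) (auto simp: prod_chart_def mem_Times_iff)
  qed
qed

section \<open>Straightened submanifolds\<close>

text \<open>The inverse is part of the data. All diffeomorphisms below are given by explicit formulas, so no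
inverse function theorem is involved.\<close>

definition analytic_diffeo ::
  "'e::banach set \<Rightarrow> 'f::banach set \<Rightarrow> ('e \<Rightarrow> 'f) \<Rightarrow> ('f \<Rightarrow> 'e) \<Rightarrow> bool" where
  "analytic_diffeo U U' \<Phi> \<Psi> \<longleftrightarrow> open U \<and> open U' \<and>
     (\<forall>x\<in>U. \<Phi> x \<in> U' \<and> \<Psi> (\<Phi> x) = x \<and> analytic_at UNIV \<Phi> x) \<and>
     (\<forall>y\<in>U'. \<Psi> y \<in> U \<and> \<Phi> (\<Psi> y) = y \<and> analytic_at UNIV \<Psi> y)"

lemma analytic_diffeoI:
  assumes "open U" "open U'" "\<And>x. x \<in> U \<Longrightarrow> \<Phi> x \<in> U'" "\<And>x. x \<in> U \<Longrightarrow> \<Psi> (\<Phi> x) = x"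
    "\<And>x. x \<in> U \<Longrightarrow> analytic_at UNIV \<Phi> x" "\<And>y. y \<in> U' \<Longrightarrow> \<Psi> y \<in> U"
    "\<And>y. y \<in> U' \<Longrightarrow> \<Phi> (\<Psi> y) = y" "\<And>y. y \<in> U' \<Longrightarrow> analytic_at UNIV \<Psi> y"
  shows "analytic_diffeo U U' \<Phi> \<Psi>"
  unfolding analytic_diffeo_def using assms by blast

lemma analytic_diffeoD:
  assumes "analytic_diffeo U U' \<Phi> \<Psi>"
  shows "open U" "open U'" "\<And>x. x \<in> U \<Longrightarrow> \<Phi> x \<in> U'" "\<And>x. x \<in> U \<Longrightarrow> \<Psi> (\<Phi> x) = x"
    "\<And>x. x \<in> U \<Longrightarrow> analytic_at UNIV \<Phi> x" "\<And>y. y \<in> U' \<Longrightarrow> \<Psi> y \<in> U"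
    "\<And>y. y \<in> U' \<Longrightarrow> \<Phi> (\<Psi> y) = y" "\<And>y. y \<in> U' \<Longrightarrow> analytic_at UNIV \<Psi> y"
  using assms unfolding analytic_diffeo_def by blast+

lemma analytic_at_imp_continuous_on:
  assumes "\<And>x. x \<in> U \<Longrightarrow> analytic_at UNIV f x"
  shows "continuous_on U f"
proof (rule continuous_at_imp_continuous_on, rule ballI)
  fix x assume "x \<in> U"
  then show "isCont f x" using analytic_at_imp_continuous[OF assms] by simp
qed

lemma open_analytic_preimage:
  assumes "open U" "open A" "\<And>x. x \<in> U \<Longrightarrow> analytic_at UNIV f x"
  shows "open {x \<in> U. f x \<in> A}"
  using continuous_open_preimage[OF analytic_at_imp_continuous_on[OF assms(3)] assms(1,2)]
  by (simp add: vimage_def Int_def conj_commute)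

text \<open>Membership is compared point by point, as computations in coordinates do; since the inverse is
given, it follows that \<open>\<Phi>\<close> maps \<open>U \<inter> S\<close> onto \<open>U' \<inter> V\<close>. The projection turns the resulting chart into
a slice chart.\<close>

definition straightens where
  "straightens U U' \<Phi> \<Psi> S V \<longleftrightarrow> analytic_diffeo U U' \<Phi> \<Psi> \<and> (\<exists>P. projection_onto P V) \<and>
     (\<forall>x\<in>U. x \<in> S \<longleftrightarrow> \<Phi> x \<in> V)"

lemma straightens_UNIV: "analytic_diffeo U U' \<Phi> \<Psi> \<Longrightarrow> straightens U U' \<Phi> \<Psi> UNIV UNIV"
  unfolding straightens_def projection_onto_def by (auto intro!: exI[of _ "\<lambda>x. x"] bounded_linear_ident)

lemma straightens_slice_chart:
  assumes "straightens U U' \<Phi> \<Psi> S V"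
  shows "slice_chart S \<lparr>cdom = U \<inter> S, cmap = \<Phi>, model = V\<rparr>" (is "slice_chart S ?c")
proof -
  obtain P where d: "analytic_diffeo U U' \<Phi> \<Psi>" and P: "projection_onto P V"
    and SV: "\<And>x. x \<in> U \<Longrightarrow> x \<in> S \<longleftrightarrow> \<Phi> x \<in> V"
    using assms unfolding straightens_def by blast
  note D = analytic_diffeoD[OF d]
  have V: "subspace V" "closed V"
    using projection_onto_closed_subspace[OF P] unfolding closed_subspace_def by auto
  have im: "\<Phi> ` (U \<inter> S) = V \<inter> U'"
  proof
    show "\<Phi> ` (U \<inter> S) \<subseteq> V \<inter> U'" using SV D(3) by auto
    show "V \<inter> U' \<subseteq> \<Phi> ` (U \<inter> S)"
    proof
      fix y assume y: "y \<in> V \<inter> U'"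
      then have "\<Psi> y \<in> U \<inter> S" using D(6,7) SV by auto
      then show "y \<in> \<Phi> ` (U \<inter> S)" using D(7) y by force
    qed
  qed
  have "homeomorphic_maps (top_of_set (U \<inter> S)) (top_of_set (V \<inter> U')) \<Phi> \<Psi>"
    unfolding homeomorphic_maps_def
    using D SV by (auto simp: continuous_map_in_subtopology
        intro!: continuous_on_subset[OF analytic_at_imp_continuous_on[of U \<Phi>]]
          continuous_on_subset[OF analytic_at_imp_continuous_on[of U' \<Psi>]])
  then have hom: "homeomorphic_map (top_of_set (U \<inter> S)) (top_of_set (V \<inter> U')) \<Phi>"
    using homeomorphic_map_maps by blast
  have ch: "is_chart (top_of_set S) ?c"
    unfolding is_chart_def closed_subspace_def
    using hom V D(1,2) by (auto simp: im subtopology_subtopology Int_absorb1 Int_absorb2 openin_open)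
  note C = is_chartD[OF ch]
  have "embedded_chart S ?c"
    unfolding embedded_chart_def
  proof (intro conjI ballI ch)
    fix p assume "p \<in> cdom ?c"
    then have p: "p \<in> U" "p \<in> S" by auto
    show "extends_analytically S (cmap ?c) p" using D(5)[OF p(1)] by (simp add: extends_analyticallyI)
    have "analytic_at V \<Psi> (\<Phi> p)"
      using D(8)[OF D(3)[OF p(1)]] by (rule analytic_at_subspace) simp
    then have "analytic_at V (cinv ?c) (\<Phi> p)"
    proof (rule analytic_at_cong_nhds[OF _ V(1)])
      show "\<Phi> p \<in> V" using p SV by blast
      show "\<forall>\<^sub>F w in nhds (\<Phi> p). w \<in> V \<longrightarrow> cinv ?c w = \<Psi> w"
        using eventually_nhds_in_open[OF D(2) D(3)[OF p(1)]]
      proof eventually_elim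
        case (elim w)
        show ?case
        proof
          assume "w \<in> V"
          then have "\<Psi> w \<in> cdom ?c" "cmap ?c (\<Psi> w) = w" using elim D(6,7) SV by auto
          then show "cinv ?c w = \<Psi> w" using C(9)[of "\<Psi> w"] by simp
        qed
      qed
    qed
    then show "analytic_at (model ?c) (cinv ?c) (cmap ?c p)" by simp
  qed
  then show ?thesis unfolding slice_chart_def using P by auto
qed

text \<open>Both directions of the chart restrict: the extension off \<open>S\<close> is also one off \<open>T\<close>, and the
inverse stays analytic on the smaller model space.\<close>

lemma submanifold_chart_embedded:
  assumes M: "embedded_manifold M S" and TS: "T \<subseteq> S" and c: "submanifold_chart M T c W"
  shows "embedded_chart T \<lparr>cdom = cdom c \<inter> T, cmap = cmap c, model = W\<rparr>" (is "embedded_chart T ?d")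
proof -
  have ec: "embedded_chart S c"
    using c embedded_maximal_atlas[OF M] unfolding submanifold_chart_def by blast
  then have cc: "is_chart (top_of_set S) c" unfolding embedded_chart_def by blast
  note C = is_chartD[OF cc]
  have im: "cmap c ` (cdom c \<inter> T) = cmap c ` cdom c \<inter> W" and W: "closed_subspace W" "W \<subseteq> model c"
    using c unfolding submanifold_chart_def complemented_in_def by auto
  obtain B where B: "open B" "cmap c ` cdom c = model c \<inter> B"
    using C(5) by (auto simp: openin_open)
  have imo: "cmap c ` (cdom c \<inter> T) = W \<inter> B" unfolding im B(2) using W(2) by auto
  from homeomorphic_map_subtopologies[OF C(11), of T W]
  have hom: "homeomorphic_map (top_of_set (cdom c \<inter> T)) (top_of_set (cmap c ` (cdom c \<inter> T))) (cmap c)"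
    using im by (simp add: subtopology_subtopology)
  obtain U where U: "open U" "cdom c = S \<inter> U" using C(2) by (auto simp: openin_open)
  have dT: "openin (top_of_set T) (cdom c \<inter> T)"
    using U TS by (auto simp: openin_open)
  have oW: "openin (top_of_set W) (cmap c ` (cdom c \<inter> T))" using imo B(1) by (auto simp: openin_open)
  have cd: "is_chart (top_of_set T) ?d"
    unfolding is_chart_def using hom W dT oW by (simp add: subtopology_subtopology Int_absorb1)
  note D = is_chartD[OF cd]
  show ?thesis
    unfolding embedded_chart_def
  proof (intro conjI ballI cd)
    fix p assume "p \<in> cdom ?d"
    then have p: "p \<in> cdom c" "p \<in> T" by auto
    have e: "extends_analytically S (cmap c) p" and a: "analytic_at (model c) (cinv c) (cmap c p)"
      using ec p(1) unfolding embedded_chart_def by auto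
    show "extends_analytically T (cmap ?d) p" using extends_analytically_subset[OF e TS] by simp
    have "analytic_at W (cinv ?d) (cmap c p)"
    proof (rule analytic_at_cong_nhds[OF analytic_at_subspace[OF a W(2)]])
      show "subspace W" using W(1) unfolding closed_subspace_def by blast
      show "cmap c p \<in> W" using D(8)[of p] p by simp
      have "\<forall>\<^sub>F w in nhds (cmap c p). w \<in> W \<longrightarrow> w \<in> cmap c ` (cdom c \<inter> T)"
        using is_chart_eventually(2)[OF cd, of p] p by simp
      then show "\<forall>\<^sub>F w in nhds (cmap c p). w \<in> W \<longrightarrow> cinv ?d w = cinv c w"
      proof eventually_elim
        case (elim w)
        show ?case
        proof
          assume "w \<in> W"
          then obtain q where q: "q \<in> cdom c" "q \<in> T" "w = cmap c q" using elim by blast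
          then show "cinv ?d w = cinv c w" using C(9)[of q] D(9)[of q] by simp
        qed
      qed
    qed
    then show "analytic_at (model ?d) (cinv ?d) (cmap ?d p)" by simp
  qed
qed

text \<open>One diffeomorphism straightens both \<open>S\<close> and \<open>T\<close>, so that the chart of \<open>S\<close> that it induces is a
submanifold chart for \<open>T\<close>.\<close>

lemma straightened_submanifold:
  fixes M :: "('e::banach, 'f::banach) manifold"
  assumes M: "embedded_manifold M S" and TS: "T \<subseteq> S"
    and str: "\<And>p. p \<in> T \<Longrightarrow> \<exists>U U' \<Phi> \<Psi> V W. p \<in> U \<and> W \<subseteq> V \<and>
      straightens U U' \<Phi> \<Psi> S V \<and> straightens U U' \<Phi> \<Psi> T (W :: 'f set)"
  shows "is_submanifold M T" "embedded_manifold (submanifold M T) T"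
proof -
  have main: "\<exists>c W. p \<in> cdom c \<and> submanifold_chart M T c W \<and>
      slice_chart T \<lparr>cdom = cdom c \<inter> T, cmap = cmap c, model = W\<rparr>" if p: "p \<in> T" for p
  proof -
    obtain U U' \<Phi> \<Psi> V and W :: "'f set" where *: "p \<in> U" "W \<subseteq> V" "straightens U U' \<Phi> \<Psi> S V" "straightens U U' \<Phi> \<Psi> T W"
      using str[OF p] by blast
    let ?c = "\<lparr>cdom = U \<inter> S, cmap = \<Phi>, model = V\<rparr>"
    note sc = *(3,4)[THEN straightens_slice_chart]
    obtain P Q where PQ: "projection_onto P V" "projection_onto Q W" using *(3,4) unfolding straightens_def by blast
    have T: "\<And>x. x \<in> U \<Longrightarrow> x \<in> T \<longleftrightarrow> \<Phi> x \<in> W" using *(4) unfolding straightens_def by blast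
    have S: "\<And>x. x \<in> U \<Longrightarrow> x \<in> S \<longleftrightarrow> \<Phi> x \<in> V" using *(3) unfolding straightens_def by blast
    have "submanifold_chart M T ?c W"
      unfolding submanifold_chart_def
    proof (intro conjI)
      show "?c \<in> maximal_atlas M" using sc(1) embedded_maximal_atlas[OF M] unfolding slice_chart_def by blast
      show "complemented_in (model ?c) W" using projection_onto_complemented[OF PQ *(2)] by simp
      show "cmap ?c ` (cdom ?c \<inter> T) = cmap ?c ` cdom ?c \<inter> W" using T TS by auto
    qed
    moreover have "U \<inter> S \<inter> T = U \<inter> T" using TS by auto
    ultimately show ?thesis
      using p *(1) sc(2) TS by (intro exI[of _ ?c] exI[of _ W]) auto
  qed
  have top: "mtop M = top_of_set S" by (rule embedded_manifoldD(1)[OF M])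
  show "is_submanifold M T"
    unfolding is_submanifold_def using main TS top by fastforce
  show "embedded_manifold (submanifold M T) T"
    unfolding embedded_manifold_def
  proof (intro conjI ballI)
    show "mtop (submanifold M T) = top_of_set T"
      using TS by (simp add: submanifold_def top subtopology_subtopology Int_absorb1)
    show "embedded_chart T c" if "c \<in> atlas (submanifold M T)" for c
      using that submanifold_chart_embedded[OF M TS] unfolding submanifold_def by auto
    fix p assume p: "p \<in> T"
    obtain c W where "p \<in> cdom c" "submanifold_chart M T c W"
      "slice_chart T \<lparr>cdom = cdom c \<inter> T, cmap = cmap c, model = W\<rparr>" using main[OF p] by blast
    then show "\<exists>c\<in>atlas (submanifold M T). p \<in> cdom c \<and> slice_chart T c"
      using p unfolding submanifold_def
      by (intro bexI[of _ "\<lparr>cdom = cdom c \<inter> T, cmap = cmap c, model = W\<rparr>"]) auto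
  qed
qed

lemma embedded_banach_space_manifold: "embedded_manifold banach_space_manifold UNIV"
proof -
  have "analytic_diffeo UNIV UNIV (\<lambda>x. x) (\<lambda>x. x)"
    by (rule analytic_diffeoI) (auto intro: analytic_at_ident)
  from straightens_slice_chart[OF straightens_UNIV[OF this]]
  have "slice_chart UNIV \<lparr>cdom = UNIV, cmap = \<lambda>x. x, model = UNIV\<rparr>" by simp
  then show ?thesis
    unfolding embedded_manifold_def banach_space_manifold_def slice_chart_def by auto
qed

lemma straightened_submanifold_banach:
  fixes S :: "'e::banach set"
  assumes "\<And>p. p \<in> S \<Longrightarrow> \<exists>U U' \<Phi> \<Psi> V. p \<in> U \<and> straightens U U' \<Phi> \<Psi> S (V :: 'e set)"
  shows "is_submanifold banach_space_manifold S" "embedded_manifold (submanifold banach_space_manifold S) S"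
proof -
  have "\<exists>U U' \<Phi> \<Psi> V W. p \<in> U \<and> W \<subseteq> V \<and>
      straightens U U' \<Phi> \<Psi> UNIV V \<and> straightens U U' \<Phi> \<Psi> S (W :: 'e set)" if p: "p \<in> S" for p
  proof -
    obtain U U' \<Phi> \<Psi> and V :: "'e set" where *: "p \<in> U" "straightens U U' \<Phi> \<Psi> S V" using assms[OF p] by blast
    then have "straightens U U' \<Phi> \<Psi> UNIV UNIV" by (intro straightens_UNIV) (auto simp: straightens_def)
    then show ?thesis using * by blast
  qed
  from straightened_submanifold[OF embedded_banach_space_manifold subset_UNIV this]
  show "is_submanifold banach_space_manifold S" "embedded_manifold (submanifold banach_space_manifold S) S"
    by auto
qed

section \<open>Submersions and local sections\<close>

text \<open>Only the behaviour of \<open>\<sigma>\<close> near \<open>f p\<close> matters. A section through every point makes \<open>f\<close> both open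
and submersive.\<close>

definition has_local_section ::
  "'e::banach set \<Rightarrow> 'f::banach set \<Rightarrow> ('e \<Rightarrow> 'f) \<Rightarrow> 'e \<Rightarrow> bool" where
  "has_local_section S T f p \<longleftrightarrow> (\<exists>\<sigma>. extends_analytically T \<sigma> (f p) \<and> \<sigma> (f p) = p \<and>
     (\<forall>\<^sub>F y in nhds (f p). y \<in> T \<longrightarrow> \<sigma> y \<in> S \<and> f (\<sigma> y) = y))"

lemma local_sections_open_map:
  assumes fT: "\<And>p. p \<in> S \<Longrightarrow> f p \<in> T" and sec: "\<And>p. p \<in> S \<Longrightarrow> has_local_section S T f p"
  shows "open_map (top_of_set S) (top_of_set T) f"
  unfolding open_map_def
proof (intro allI impI)
  fix A assume A: "openin (top_of_set S) A"
  then have AS: "A \<subseteq> S" by (rule openin_imp_subset)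
  show "openin (top_of_set T) (f ` A)"
    unfolding openin_iff_eventually
  proof (intro conjI ballI)
    show "f ` A \<subseteq> T" using AS fT by auto
    fix q assume "q \<in> f ` A"
    then obtain p where p: "p \<in> A" "q = f p" by auto
    then have pS: "p \<in> S" using AS by auto
    obtain \<sigma> where \<sigma>: "extends_analytically T \<sigma> (f p)" "\<sigma> (f p) = p"
      "\<forall>\<^sub>F y in nhds (f p). y \<in> T \<longrightarrow> \<sigma> y \<in> S \<and> f (\<sigma> y) = y"
      using sec[OF pS] unfolding has_local_section_def by blast
    have "\<forall>\<^sub>F y in nhds (f p). y \<in> T \<longrightarrow> \<sigma> y \<in> S \<longrightarrow> \<sigma> y \<in> A"
      using openin_imp_eventually[OF A p(1)] fT[OF pS] \<sigma>(2)
      by (intro extends_analytically_eventually[OF \<sigma>(1)]) auto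
    then show "\<forall>\<^sub>F y in nhds q. y \<in> T \<longrightarrow> y \<in> f ` A"
      unfolding p(2) using \<sigma>(3) by eventually_elim (metis imageI)
  qed
qed

lemma chart_inverse_eventually:
  assumes d: "embedded_chart T d" and q: "q \<in> cdom d" and P: "\<forall>\<^sub>F y in nhds q. y \<in> T \<longrightarrow> P y"
  shows "\<forall>\<^sub>F w in nhds (cmap d q). w \<in> model d \<longrightarrow>
    cinv d w \<in> cdom d \<and> cmap d (cinv d w) = w \<and> P (cinv d w)"
proof -
  have cd: "is_chart (top_of_set T) d" and a: "analytic_at (model d) (cinv d) (cmap d q)"
    using d q unfolding embedded_chart_def by auto
  note D = is_chartD[OF cd]
  have "continuous (at (cmap d q) within model d) (cinv d)"
    by (rule analytic_at_imp_continuous[OF a D(3) D(8)[OF q]])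
  from continuous_within_eventually[OF this, of "\<lambda>y. y \<in> T \<longrightarrow> P y"]
  have "\<forall>\<^sub>F w in nhds (cmap d q). w \<in> model d \<longrightarrow> cinv d w \<in> T \<longrightarrow> P (cinv d w)"
    using P D(9)[OF q] by simp
  then show ?thesis
    using is_chart_eventually(2)[OF cd q] by eventually_elim (use D(1,10) in blast)
qed

lemma linear_along_kernel:
  assumes V: "subspace V" "closed V" and L: "linear_along V L" "\<And>v. v \<in> V \<Longrightarrow> norm (L v) \<le> K * norm v"
  shows "closed_subspace {v \<in> V. L v = 0}"
  unfolding closed_subspace_def
proof
  have "continuous_on V L"
    unfolding continuous_on_eq_continuous_within
    using analytic_at_imp_continuous[OF analytic_at_linear[OF L]] V(1) by blast
  then show "closed {v \<in> V. L v = 0}" by (rule continuous_closed_preimage_constant[OF _ V(2)])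
  show "subspace {v \<in> V. L v = 0}"
    using V(1) L(1) linear_along_zero[OF L(1)] unfolding subspace_def linear_along_def by auto
qed

text \<open>A bounded right inverse \<open>E\<close> of \<open>D\<close> splits \<open>V\<close>: every \<open>v\<close> is \<open>(v - E (D v)) + E (D v)\<close>. The complement
is the range of \<open>E\<close>; it is closed because it consists of the fixed points of \<open>E \<circ> D\<close>.\<close>

lemma right_inverse_kernel_complemented:
  assumes V: "subspace V" "closed V" and W: "subspace W"
    and D: "linear_along V D" "\<And>v. v \<in> V \<Longrightarrow> norm (D v) \<le> K * norm v" "\<And>v. v \<in> V \<Longrightarrow> D v \<in> W"
    and E: "linear_along W E" "\<And>w. w \<in> W \<Longrightarrow> norm (E w) \<le> L * norm w" "\<And>w. w \<in> W \<Longrightarrow> E w \<in> V"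
    and DE: "\<And>w. w \<in> W \<Longrightarrow> D (E w) = w" and L: "L \<ge> 0"
  shows "complemented_in V {v \<in> V. D v = 0}"
proof -
  let ?G = "\<lambda>v. E (D v) - v"
  have lin: "linear_along V ?G"
    using D(1,3) E(1) unfolding linear_along_def by (auto simp: algebra_simps)
  have bd: "norm (?G v) \<le> (L * K + 1) * norm v" if "v \<in> V" for v
  proof -
    have "norm (E (D v)) \<le> L * norm (D v)" using E(2) D(3) that by blast
    also have "\<dots> \<le> L * (K * norm v)" using D(2)[OF that] L by (intro mult_left_mono)
    finally show ?thesis using norm_triangle_ineq4[of "E (D v)" v] by (simp add: algebra_simps)
  qed
  let ?C = "{v \<in> V. ?G v = 0}"
  show ?thesis
    unfolding complemented_in_def
  proof (intro conjI exI[of _ ?C] ballI)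
    show "closed_subspace {v \<in> V. D v = 0}" by (rule linear_along_kernel[OF V D(1,2)])
    show "closed_subspace ?C" by (rule linear_along_kernel[OF V lin bd])
    have "E 0 = 0" "D 0 = 0" using linear_along_zero D(1) E(1) subspace_0 V(1) W by auto
    then show "{v \<in> V. D v = 0} \<inter> ?C = {0}" using subspace_0[OF V(1)] by auto
    fix v assume v: "v \<in> V"
    have EDv: "E (D v) \<in> V" using v D(3) E(3) by blast
    have "D (v - E (D v)) = 0"
      using linear_along_diff[OF D(1) V(1) v EDv] DE[OF D(3)[OF v]] by simp
    then have "v - E (D v) \<in> {v \<in> V. D v = 0}" using v EDv V(1) by (simp add: subspace_diff)
    moreover have "E (D v) \<in> ?C" using EDv DE[OF D(3)[OF v]] by simp
    moreover have "v = (v - E (D v)) + E (D v)" by simp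
    ultimately show "\<exists>w\<in>{v \<in> V. D v = 0}. \<exists>c\<in>?C. v = w + c" by blast
  qed auto
qed

text \<open>In charts, the derivative of the section is a right inverse of the derivative of \<open>f\<close>, by the chain
rule and the uniqueness of the derivative of the identity.\<close>

lemma local_sections_submersion:
  assumes M: "embedded_manifold M S" and N: "embedded_manifold N T"
    and f: "\<And>p. p \<in> S \<Longrightarrow> extends_analytically S f p" and fT: "\<And>p. p \<in> S \<Longrightarrow> f p \<in> T"
    and sec: "\<And>p. p \<in> S \<Longrightarrow> has_local_section S T f p"
  shows "submersion M N f"
  unfolding submersion_def
proof (intro ballI impI)
  fix p c d assume p: "p \<in> topspace (mtop M)" and cd: "c \<in> atlas M" "d \<in> atlas N" "p \<in> cdom c \<and> f p \<in> cdom d"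
  have pS: "p \<in> S" using p embedded_manifoldD(1)[OF M] by simp
  have c: "embedded_chart S c" and d: "embedded_chart T d"
    using cd embedded_manifoldD(2)[OF M] embedded_manifoldD(2)[OF N] by auto
  have cc: "is_chart (top_of_set S) c" and dd: "is_chart (top_of_set T) d"
    using c d unfolding embedded_chart_def by auto
  note C = is_chartD[OF cc] and DD = is_chartD[OF dd]
  obtain \<sigma> where \<sigma>: "extends_analytically T \<sigma> (f p)" "\<sigma> (f p) = p"
    "\<forall>\<^sub>F y in nhds (f p). y \<in> T \<longrightarrow> \<sigma> y \<in> S \<and> f (\<sigma> y) = y"
    using sec[OF pS] unfolding has_local_section_def by blast
  define R where "R = cmap d \<circ> f \<circ> cinv c"
  define R' where "R' = cmap c \<circ> \<sigma> \<circ> cinv d"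
  have pc: "p \<in> cdom c" "f p \<in> cdom d" using cd by auto
  have Rp: "R (cmap c p) = cmap d (f p)" "R' (cmap d (f p)) = cmap c p"
    using C(9)[OF pc(1)] DD(9)[OF pc(2)] by (auto simp: R_def R'_def \<sigma>(2))
  have "analytic_at (model c) R (cmap c p)"
    unfolding R_def by (rule local_representative_analytic[OF c d pc f[OF pS]]) (use fT in auto)
  then obtain D where D: "has_derivative_along (model c) R D (cmap c p)"
    using analytic_at_imp_derivative C(3) C(8)[OF pc(1)] by metis
  have "analytic_at (model d) R' (cmap d (f p))"
    unfolding R'_def using pc \<sigma>(1,2)
    by (intro local_representative_analytic[OF d c]) (auto intro: eventually_mono[OF \<sigma>(3)])
  then obtain E where E: "has_derivative_along (model d) R' E (cmap d (f p))"
    using analytic_at_imp_derivative DD(3) DD(8)[OF pc(2)] by metis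
  have "\<forall>\<^sub>F y in nhds p. y \<in> S \<longrightarrow> f y \<in> T \<longrightarrow> f y \<in> cdom d"
    by (rule extends_analytically_eventually[OF f[OF pS] pS is_chart_eventually(1)[OF dd pc(2)]])
  then have "\<forall>\<^sub>F y in nhds p. y \<in> S \<longrightarrow> f y \<in> cdom d" by eventually_elim (use fT in auto)
  from chart_inverse_eventually[OF c pc(1) this]
  have evR: "\<forall>\<^sub>F w in nhds (cmap c p). w \<in> model c \<longrightarrow> R w \<in> model d"
    by eventually_elim (use DD(8) in \<open>auto simp: R_def\<close>)
  have "\<forall>\<^sub>F y in nhds (f p). y \<in> T \<longrightarrow> \<sigma> y \<in> S \<longrightarrow> \<sigma> y \<in> cdom c"
    by (rule extends_analytically_eventually[OF \<sigma>(1) fT[OF pS]])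
      (use is_chart_eventually(1)[OF cc pc(1)] \<sigma>(2) in simp)
  then have "\<forall>\<^sub>F y in nhds (f p). y \<in> T \<longrightarrow> \<sigma> y \<in> cdom c \<and> f (\<sigma> y) = y"
    using \<sigma>(3) by eventually_elim auto
  from chart_inverse_eventually[OF d pc(2) this]
  have ev: "\<forall>\<^sub>F w in nhds (cmap d (f p)). w \<in> model d \<longrightarrow> R' w \<in> model c \<and> R (R' w) = w"
    by eventually_elim (use C(8,9) in \<open>auto simp: R_def R'_def\<close>)
  have evR': "\<forall>\<^sub>F w in nhds (cmap d (f p)). w \<in> model d \<longrightarrow> R' w \<in> model c"
    using ev by eventually_elim auto
  have "has_derivative_along (model d) (\<lambda>w. R (R' w)) (\<lambda>v. D (E v)) (cmap d (f p))"
    by (rule has_derivative_along_chain[OF E _ DD(3) DD(8)[OF pc(2)] C(3,4) evR'])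
      (simp add: D Rp(2))
  moreover have "has_derivative_along (model d) (\<lambda>w. R (R' w)) (\<lambda>v. v) (cmap d (f p))"
  proof (rule has_derivative_along_cong[where f = "\<lambda>w. w"])
    show "has_derivative_along (model d) (\<lambda>w. w) (\<lambda>v. v) (cmap d (f p))"
      by (rule has_derivative_alongI[where K = 1]) (auto simp: linear_along_def intro!: exI[of _ 1])
    show "\<forall>\<^sub>F w in nhds (cmap d (f p)). w \<in> model d \<longrightarrow> R (R' w) = w"
      using ev by eventually_elim auto
  qed (use DD(8) pc in auto)
  ultimately have DE: "D (E v) = v" if "v \<in> model d" for v
    by (rule has_derivative_along_unique[OF _ _ DD(3) DD(8)[OF pc(2)] that])
  have Dm: "D v \<in> model d" if "v \<in> model c" for v
    by (rule has_derivative_along_range[OF D C(3) C(8)[OF pc(1)] DD(3,4) evR that])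
  have Em: "E v \<in> model c" if "v \<in> model d" for v
    by (rule has_derivative_along_range[OF E DD(3) DD(8)[OF pc(2)] C(3,4) evR' that])
  obtain K where K: "\<And>v. v \<in> model c \<Longrightarrow> norm (D v) \<le> K * norm v"
    using has_derivative_along_lipschitz[OF D C(3) C(8)[OF pc(1)]] by metis
  obtain L where L: "L > 0" "\<And>v. v \<in> model d \<Longrightarrow> norm (E v) \<le> L * norm v"
    using has_derivative_along_lipschitz[OF E DD(3) DD(8)[OF pc(2)]] by metis
  have lin: "linear_along (model c) D" "linear_along (model d) E"
    using D E unfolding has_derivative_along_def by auto
  have "complemented_in (model c) {v \<in> model c. D v = 0}"
    by (rule right_inverse_kernel_complemented[OF C(3,4) DD(3) lin(1) K Dm lin(2) L(2) Em DE less_imp_le[OF L(1)]])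
  moreover have "D ` model c = model d"
  proof
    show "model d \<subseteq> D ` model c" using DE Em by (metis imageI subsetI)
  qed (use Dm in auto)
  ultimately show "\<exists>D. has_derivative_along (model c) (cmap d \<circ> f \<circ> cinv c) D (cmap c p) \<and>
      D ` model c = model d \<and> complemented_in (model c) {v \<in> model c. D v = 0}"
    using D unfolding R_def by blast
qed

section \<open>Idempotents and the Cayley transform\<close>

lemma inverse_of_scaleR:
  assumes "a \<in> invertible_elements" "c \<noteq> 0"
  shows "c *\<^sub>R a \<in> invertible_elements" "inverse_of (c *\<^sub>R a) = (1 / c) *\<^sub>R inverse_of a"
  using inverse_of_eqI[of "c *\<^sub>R a" "(1 / c) *\<^sub>R inverse_of a"] assms by auto

lemma inverse_of_inverse_of:
  assumes "a \<in> invertible_elements"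
  shows "inverse_of a \<in> invertible_elements" "inverse_of (inverse_of a) = a"
  using inverse_of_eqI[of "inverse_of a" a] assms by auto

lemma scaleR_2: "2 *\<^sub>R (x :: 'a::real_vector) = x + x"
  using scaleR_left_distrib[of 1 1 x] by simp

lemma idempotents_iff: "a \<in> idempotents \<longleftrightarrow> a * a = a"
  by (simp add: idempotents_def power2_eq_square)

lemma idempotents_iff_involution:
  fixes a :: "'a::{real_normed_algebra, monoid_mult, banach}"
  shows "a \<in> idempotents \<longleftrightarrow> (2 *\<^sub>R a - 1) * (2 *\<^sub>R a - 1) = 1"
proof -
  have "4 *\<^sub>R a = 2 *\<^sub>R a + 2 *\<^sub>R a" using scaleR_left_distrib[of 2 2 a] by simp
  then have "(2 *\<^sub>R a - 1) * (2 *\<^sub>R a - 1) = 4 *\<^sub>R (a * a - a) + 1"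
    by (simp add: algebra_simps)
  then show ?thesis by (simp add: idempotents_iff)
qed

text \<open>The element \<open>w\<close> is the Cayley transform \<open>(b - 1) (b + 1)\<^sup>-\<^sup>1\<close> of \<open>b = t j\<close>. That \<open>t\<close> is an involution
means \<open>j b j = b\<^sup>-\<^sup>1\<close>, and the Cayley transform turns inversion into the sign change \<open>w \<mapsto> -w\<close>.\<close>

lemma cayley_anticommute_iff:
  fixes t j :: "'a::{real_normed_algebra, monoid_mult, banach}"
  assumes j: "j * j = 1" and u: "t * j + 1 \<in> invertible_elements"
    and w: "w = 1 - 2 *\<^sub>R inverse_of (t * j + 1)"
  shows "t * t = 1 \<longleftrightarrow> j * w + w * j = 0"
proof -
  define u where "u = t * j + 1"
  define y where "y = inverse_of u"
  have uy: "u * y = 1" "y * u = 1" "\<And>z. u * (y * z) = z" "\<And>z. y * (u * z) = z"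
    using u by (simp_all add: u_def y_def)
  have jj: "j * (j * z) = z" for z using j by (simp add: mult.assoc[symmetric])
  have "j * w + w * j = 2 *\<^sub>R (j - (j * y + y * j))"
    by (simp add: w y_def u_def algebra_simps scaleR_2)
  then have "j * w + w * j = 0 \<longleftrightarrow> j * y + y * j = j" by auto
  also have "\<dots> \<longleftrightarrow> u * j + j * u = u * j * u"
  proof
    assume "j * y + y * j = j"
    then have "u * (j * y + y * j) * u = u * j * u" by simp
    then show "u * j + j * u = u * j * u" using uy by (simp add: algebra_simps)
  next
    assume "u * j + j * u = u * j * u"
    then have "y * (u * j + j * u) * y = y * (u * j * u) * y" by simp
    then show "j * y + y * j = j" using uy by (simp add: algebra_simps)
  qed
  also have "\<dots> \<longleftrightarrow> j = t * t * j"
    by (auto simp: u_def algebra_simps j)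
  also have "\<dots> \<longleftrightarrow> t * t = 1"
  proof
    assume "j = t * t * j"
    then have "j * j = t * t * j * j" by simp
    then show "t * t = 1" using j by (simp add: mult.assoc)
  qed simp
  finally show ?thesis by blast
qed

text \<open>The idempotents \<open>a\<close> correspond to the involutions \<open>2a - 1\<close>. Relative to the involution \<open>j\<close> that
belongs to \<open>q\<close>, the Cayley transform of \<open>(2a - 1) j\<close> straightens them to the linear condition
\<open>j w + w j = 0\<close>. The averaging map \<open>w \<mapsto> (w - j w j) / 2\<close> projects onto its solutions.\<close>

lemma idempotents_straightened:
  fixes q :: "'a::{real_normed_algebra, monoid_mult, banach}"
  assumes q: "q \<in> idempotents"
  shows "\<exists>U U' \<Phi> \<Psi> V. q \<in> U \<and> straightens U U' \<Phi> \<Psi> idempotents (V :: 'a set)"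
proof -
  define j where "j = 2 *\<^sub>R q - 1"
  have j: "j * j = 1" using q idempotents_iff_involution unfolding j_def by blast
  have jj: "j * (j * z) = z" for z using j by (simp add: mult.assoc[symmetric])
  define u where "u a = (2 *\<^sub>R a - 1) * j + 1" for a
  define \<Phi> where "\<Phi> a = 1 - 2 *\<^sub>R inverse_of (u a)" for a
  \<comment> \<open>The Cayley transform is undone by \<open>b = 2 (1 - w)\<^sup>-\<^sup>1 - 1\<close>, and \<open>j\<close> is its own inverse.\<close>
  define \<Psi> where "\<Psi> w = (1 / 2) *\<^sub>R ((2 *\<^sub>R inverse_of (1 - w) - 1) * j + 1)" for w
  define U where "U = {a. u a \<in> invertible_elements}"
  define U' where "U' = {w :: 'a. 1 - w \<in> invertible_elements}"
  define V where "V = {w :: 'a. j * w + w * j = 0}"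
  have oneminus: "1 - \<Phi> a = 2 *\<^sub>R inverse_of (u a)" for a by (simp add: \<Phi>_def)
  have u\<Psi>: "u (\<Psi> w) = 2 *\<^sub>R inverse_of (1 - w)" for w
    by (simp add: u_def \<Psi>_def algebra_simps j)
  have "analytic_diffeo U U' \<Phi> \<Psi>"
  proof (rule analytic_diffeoI)
    have "open {a \<in> UNIV. u a \<in> invertible_elements}"
      by (rule open_analytic_preimage[OF open_UNIV open_invertible_elements])
        (unfold u_def, intro analytic_intros)
    then show "open U" by (simp add: U_def)
    have "open {w \<in> UNIV. 1 - w \<in> (invertible_elements :: 'a set)}"
      by (rule open_analytic_preimage[OF open_UNIV open_invertible_elements]) (intro analytic_intros)
    then show "open U'" by (simp add: U'_def)
    show "\<Phi> x \<in> U'" if "x \<in> U" for x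
      using that by (simp add: U_def U'_def oneminus inverse_of_inverse_of inverse_of_scaleR)
    show "\<Psi> (\<Phi> x) = x" if "x \<in> U" for x
    proof -
      have "inverse_of (1 - \<Phi> x) = (1 / 2) *\<^sub>R u x"
        unfolding oneminus using that by (simp add: U_def inverse_of_inverse_of inverse_of_scaleR)
      then have "\<Psi> (\<Phi> x) = (1 / 2) *\<^sub>R ((u x - 1) * j + 1)" by (simp add: \<Psi>_def)
      also have "\<dots> = x" by (simp add: u_def algebra_simps j)
      finally show ?thesis .
    qed
    show "analytic_at UNIV \<Phi> x" if "x \<in> U" for x
      unfolding \<Phi>_def[abs_def] u_def[abs_def]
      by (intro analytic_intros) (use that in \<open>simp add: U_def u_def\<close>)
    show "\<Psi> y \<in> U" if "y \<in> U'" for y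
      using that by (simp add: U_def U'_def u\<Psi> inverse_of_inverse_of inverse_of_scaleR)
    show "\<Phi> (\<Psi> y) = y" if "y \<in> U'" for y
      using that by (simp add: \<Phi>_def u\<Psi> U'_def inverse_of_inverse_of inverse_of_scaleR)
    show "analytic_at UNIV \<Psi> y" if "y \<in> U'" for y
      unfolding \<Psi>_def[abs_def]
      by (intro analytic_intros) (use that in \<open>simp add: U'_def\<close>)
  qed
  moreover have "projection_onto (\<lambda>w. (1 / 2) *\<^sub>R (w - j * w * j)) V"
    unfolding projection_onto_def
  proof (intro conjI allI ballI)
    show "bounded_linear (\<lambda>w. (1 / 2) *\<^sub>R (w - j * w * j))"
      by (intro bounded_linear_scaleR_right[THEN bounded_linear_compose] bounded_linear_sub bounded_linear_ident
          bounded_linear_mult_left[THEN bounded_linear_compose] bounded_linear_mult_right)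
    show "(1 / 2) *\<^sub>R (w - j * w * j) \<in> V" for w
      by (simp add: V_def algebra_simps j jj)
    show "(1 / 2) *\<^sub>R (w - j * w * j) = w" if "w \<in> V" for w
    proof -
      have "j * w = - (w * j)" using that by (simp add: V_def eq_neg_iff_add_eq_0)
      then have "j * w * j = - w" using j by (simp add: mult.assoc)
      then show ?thesis by (simp add: scaleR_2[symmetric])
    qed
  qed
  moreover have "x \<in> idempotents \<longleftrightarrow> \<Phi> x \<in> V" if "x \<in> U" for x
    unfolding idempotents_iff_involution V_def mem_Collect_eq
    by (rule cayley_anticommute_iff[OF j]) (use that in \<open>simp_all add: U_def u_def \<Phi>_def\<close>)
  ultimately have "straightens U U' \<Phi> \<Psi> idempotents V" unfolding straightens_def by blast
  moreover have "(2 *\<^sub>R q - 1) * j = 1" using j by (simp only: j_def)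
  then have "u q = 2 *\<^sub>R 1" by (simp only: u_def scaleR_2)
  then have "q \<in> U" using inverse_of_scaleR(1)[of 1 2] by (simp add: U_def)
  ultimately show ?thesis by blast
qed

text \<open>For idempotents, \<open>transporter q p\<close> intertwines \<open>q\<close> and \<open>p\<close>. It equals \<open>1\<close> at \<open>p = q\<close>, so it is
invertible for \<open>p\<close> near \<open>q\<close>, where it conjugates \<open>q\<close> into \<open>p\<close> and depends analytically on \<open>p\<close>. This
provides all local sections, and it moves arrows from one fibre to another.\<close>

definition transporter :: "'a::{real_normed_algebra, monoid_mult, banach} \<Rightarrow> 'a \<Rightarrow> 'a" where
  "transporter q p = p * q + (1 - p) * (1 - q)"

lemma transporter_self: "q \<in> idempotents \<Longrightarrow> transporter q q = 1"
  by (simp add: transporter_def idempotents_iff algebra_simps)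

lemma transporter_intertwines:
  assumes "q \<in> idempotents" "p \<in> idempotents"
  shows "transporter q p * q = p * transporter q p"
proof -
  have "p * (p * z) = p * z" for z using assms(2) by (simp add: idempotents_iff mult.assoc[symmetric])
  then show ?thesis using assms by (simp add: transporter_def idempotents_iff algebra_simps)
qed

lemma transporter_conjugates:
  assumes "q \<in> idempotents" "p \<in> idempotents" "transporter q p \<in> invertible_elements"
  shows "transporter q p * q * inverse_of (transporter q p) = p"
    "inverse_of (transporter q p) * p * transporter q p = q"
proof -
  show "transporter q p * q * inverse_of (transporter q p) = p"
    using transporter_intertwines[OF assms(1,2)] assms(3) by (simp add: mult.assoc)
  have "inverse_of (transporter q p) * p * transporter q p = inverse_of (transporter q p) * (transporter q p * q)"
    using transporter_intertwines[OF assms(1,2)] by (simp add: mult.assoc)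
  then show "inverse_of (transporter q p) * p * transporter q p = q" using assms(3) by simp
qed

lemma transporter_analytic: "analytic_at UNIV (transporter q) p"
  unfolding transporter_def[abs_def] by (intro analytic_intros)

lemma transporter_eventually_invertible:
  assumes "q \<in> idempotents"
  shows "\<forall>\<^sub>F p in nhds q. transporter q p \<in> invertible_elements"
proof -
  have "open {p \<in> UNIV. transporter q p \<in> invertible_elements}"
    by (rule open_analytic_preimage[OF open_UNIV open_invertible_elements transporter_analytic])
  from eventually_nhds_in_open[OF this, of q] show ?thesis
    using assms by (simp add: transporter_self)
qed

section \<open>Inverse pairs and Gaussian elimination\<close>

lemma inverse_pairs_iff: "(a, b) \<in> inverse_pairs \<longleftrightarrow> a * b * a = a \<and> b * a * b = b"
  by (simp add: inverse_pairs_def)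

lemma inverse_pairs_idempotents:
  assumes "(a, b) \<in> inverse_pairs"
  shows "a * b \<in> idempotents" "b * a \<in> idempotents"
  using assms by (simp_all add: inverse_pairs_iff idempotents_iff mult.assoc[symmetric])

lemma inverse_pairs_equivalent_iff:
  fixes a b u v :: "'a::{real_normed_algebra, monoid_mult, banach}"
  assumes u: "u * u' = 1" "u' * u = 1" and v: "v * v' = 1" "v' * v = 1"
  shows "(u * a * v, v' * b * u') \<in> inverse_pairs \<longleftrightarrow> (a, b) \<in> inverse_pairs"
proof -
  have *: "u * (u' * z) = z" "u' * (u * z) = z" "v * (v' * z) = z" "v' * (v * z) = z" for z
    using u v by (simp_all add: mult.assoc[symmetric])
  have c: "u * x * v = u * y * v \<longleftrightarrow> x = y" "v' * x * u' = v' * y * u' \<longleftrightarrow> x = y" for x y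
  proof -
    show "u * x * v = u * y * v \<longleftrightarrow> x = y"
    proof
      assume "u * x * v = u * y * v"
      then have "u' * (u * x * v) * v' = u' * (u * y * v) * v'" by simp
      then show "x = y" using u v * by (simp add: mult.assoc)
    qed simp
    show "v' * x * u' = v' * y * u' \<longleftrightarrow> x = y"
    proof
      assume "v' * x * u' = v' * y * u'"
      then have "v * (v' * x * u') * u = v * (v' * y * u') * u" by simp
      then show "x = y" using u v * by (simp add: mult.assoc)
    qed simp
  qed
  have "(u * a * v) * (v' * b * u') * (u * a * v) = u * (a * b * a) * v"
    "(v' * b * u') * (u * a * v) * (v' * b * u') = v' * (b * a * b) * u'"
    by (simp_all add: mult.assoc *)
  then show ?thesis unfolding inverse_pairs_iff by (simp only: c)
qed

text \<open>Coordinates near a fixed pair \<open>(a0, b0)\<close>. With respect to the idempotents \<open>e = a0 b0\<close> on the target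
side and \<open>f = b0 a0\<close> on the source side, an element \<open>a\<close> is a block matrix whose corner \<open>e a f\<close> is
close to \<open>a0\<close>. As in Gaussian elimination, \<open>a\<close> is written as \<open>lower * (a0 + excess) * upper\<close> with
triangular outer factors; the excess is the Schur complement of the corner. If \<open>a\<close> belongs to an
inverse pair close to \<open>(a0, b0)\<close>, then the excess vanishes. The elements \<open>b\<close> that form a pair with
\<open>a\<close> are then obtained from those that form a pair with \<open>a0\<close> by multiplication with the inverse
factors, and the latter are a graph over a linear space.\<close>

locale inverse_pair =
  fixes a0 b0 :: "'a::{real_normed_algebra, monoid_mult, banach}"
  assumes pair: "(a0, b0) \<in> inverse_pairs"
begin

abbreviation e where "e \<equiv> a0 * b0"
abbreviation f where "f \<equiv> b0 * a0"

lemma pair_simps: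
  "a0 * (b0 * a0) = a0" "b0 * (a0 * b0) = b0"
  "a0 * (b0 * (a0 * z)) = a0 * z" "b0 * (a0 * (b0 * z)) = b0 * z"
  using pair by (simp_all add: inverse_pairs_iff mult.assoc[symmetric])

text \<open>Elimination of columns: \<open>reduce a\<close> keeps the column \<open>a f\<close> and stores the other column after
multiplication by the inverse of the lower triangular factor. That factor depends on the column
\<open>a f\<close> only, so it can be recovered from \<open>reduce a\<close>; therefore \<open>unreduce\<close> is an inverse. For the
second component, \<open>flat\<close> subtracts the base point and, from the last block, the value that this
block of \<open>b a0 b\<close> prescribes; since \<open>b a0 b\<close> does not see the last block of \<open>b\<close> there, this is a shear.\<close>

definition lower where "lower x = 1 - e + x * b0"
definition upper where "upper x = 1 + b0 * x * (1 - f)"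
definition upper' where "upper' x = 1 - b0 * x * (1 - f)"
definition reduce where "reduce a = a * f + inverse_of (lower a) * a * (1 - f)"
definition unreduce where "unreduce x = x * f + lower x * x * (1 - f)"
definition excess where "excess x = (1 - e) * x * (1 - f)"
definition flat where "flat b = b - (1 - f) * b * a0 * b * (1 - e) - b0"
definition unflat where "unflat y = y + b0 + (1 - f) * y * a0 * y * (1 - e)"

lemma lower_reduce: "lower (reduce a) = lower a"
proof -
  have "reduce a * b0 = a * b0"
    unfolding reduce_def by (simp add: algebra_simps pair_simps)
  then show ?thesis by (simp add: lower_def)
qed

lemma lower_unreduce: "lower (unreduce x) = lower x"
proof -
  have "unreduce x * b0 = x * b0"
    unfolding unreduce_def by (simp add: algebra_simps pair_simps)
  then show ?thesis by (simp add: lower_def)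
qed

lemma unreduce_reduce:
  assumes "lower a \<in> invertible_elements"
  shows "unreduce (reduce a) = a"
proof -
  have "unreduce (reduce a) = reduce a * f + lower a * reduce a * (1 - f)"
    unfolding unreduce_def lower_reduce ..
  also have "\<dots> = a"
    unfolding reduce_def using assms by (simp add: algebra_simps pair_simps)
  finally show ?thesis .
qed

lemma reduce_unreduce:
  assumes "lower x \<in> invertible_elements"
  shows "reduce (unreduce x) = x"
proof -
  have "reduce (unreduce x) = unreduce x * f + inverse_of (lower x) * unreduce x * (1 - f)"
    unfolding reduce_def lower_unreduce ..
  also have "\<dots> = x"
    unfolding unreduce_def using assms by (simp add: algebra_simps pair_simps)
  finally show ?thesis .
qed

lemma upper_upper': "upper x * upper' x = 1" "upper' x * upper x = 1"
  unfolding upper_def upper'_def by (simp_all add: algebra_simps pair_simps)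

lemma flat_unflat: "flat (unflat y) = y"
  unfolding flat_def unflat_def by (simp add: algebra_simps pair_simps)

lemma unflat_flat: "unflat (flat b) = b"
  unfolding flat_def unflat_def by (simp add: algebra_simps pair_simps)

lemma unreduce_factor: "unreduce x = lower x * (a0 + excess x) * upper x"
  unfolding unreduce_def excess_def upper_def lower_def
  by (simp add: algebra_simps pair_simps)

text \<open>Compressing \<open>(a0 + d) b (a0 + d) = a0 + d\<close> to the complementary block gives \<open>d b d = d\<close>, that is
\<open>d (1 - b d) = 0\<close>. Near the base point \<open>b d\<close> is close to \<open>0\<close>. Some such condition is needed: an
element of larger rank than \<open>a0\<close> also has partners \<open>b\<close>.\<close>

lemma excess_eq_0:
  assumes G: "(a0 + excess x, b) \<in> inverse_pairs" and inv: "1 - b * excess x \<in> invertible_elements"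
  shows "excess x = 0"
proof -
  define d where "d = excess x"
  have d: "(1 - e) * d = d" "d * (1 - f) = d"
    unfolding d_def excess_def by (simp_all add: algebra_simps pair_simps)
  have "d * b * d = ((1 - e) * (a0 + d)) * b * ((a0 + d) * (1 - f))"
    by (simp only: distrib_left distrib_right d) (simp add: algebra_simps pair_simps)
  also have "\<dots> = (1 - e) * ((a0 + d) * b * (a0 + d)) * (1 - f)" by (simp only: mult.assoc)
  also have "\<dots> = (1 - e) * (a0 + d) * (1 - f)" using G by (simp add: inverse_pairs_iff d_def)
  also have "\<dots> = d"
    by (simp only: distrib_left distrib_right d) (simp add: algebra_simps pair_simps)
  finally have "d * (1 - b * d) = 0" by (simp add: algebra_simps)
  then have "d * (1 - b * d) * inverse_of (1 - b * d) = 0" by simp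
  then show ?thesis using inv by (simp add: d_def mult.assoc)
qed

text \<open>The partners of \<open>a0\<close> itself: the two off-diagonal blocks of \<open>b\<close> are arbitrary, one diagonal block
is \<open>b0\<close>, and the other one is a quadratic function of the off-diagonal blocks.\<close>

lemma inverse_pairs_at_base_iff:
  "(a0, b) \<in> inverse_pairs \<longleftrightarrow> f * b * e = b0 \<and> (1 - f) * b * (1 - e) = (1 - f) * b * a0 * b * (1 - e)"
proof
  assume "(a0, b) \<in> inverse_pairs"
  then have *: "a0 * b * a0 = a0" "b * a0 * b = b" by (auto simp: inverse_pairs_iff)
  have "f * b * e = b0 * (a0 * b * a0) * b0" by (simp only: mult.assoc)
  also have "\<dots> = b0" unfolding *(1) using pair by (simp add: inverse_pairs_iff)
  finally have "f * b * e = b0" .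
  moreover have "(1 - f) * b * a0 * b * (1 - e) = (1 - f) * (b * a0 * b) * (1 - e)" by (simp only: mult.assoc)
  ultimately show "f * b * e = b0 \<and> (1 - f) * b * (1 - e) = (1 - f) * b * a0 * b * (1 - e)"
    unfolding *(2) by simp
next
  assume *: "f * b * e = b0 \<and> (1 - f) * b * (1 - e) = (1 - f) * b * a0 * b * (1 - e)"
  have "a0 * b * a0 = a0 * (f * b * e) * a0" by (simp add: mult.assoc pair_simps)
  also have "\<dots> = a0" using * pair by (simp add: inverse_pairs_iff)
  finally have 1: "a0 * b * a0 = a0" .
  have "f * b * a0 * b = (f * b * e) * (a0 * b)" by (simp add: mult.assoc pair_simps)
  also have "\<dots> = f * b" using * by (simp add: mult.assoc)
  finally have 2: "f * b * a0 * b = f * b" .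
  have "(1 - f) * b * a0 * b * e = (1 - f) * b * a0 * (f * b * e)" by (simp add: mult.assoc pair_simps)
  also have "\<dots> = (1 - f) * b * e" using * by (simp add: mult.assoc)
  finally have 3: "(1 - f) * b * a0 * b * e = (1 - f) * b * e" .
  have "b * a0 * b = f * b * a0 * b + ((1 - f) * b * a0 * b * e + (1 - f) * b * a0 * b * (1 - e))"
    by (simp add: algebra_simps)
  also have "\<dots> = f * b + ((1 - f) * b * e + (1 - f) * b * (1 - e))"
    using 2 3 * by simp
  also have "\<dots> = b" by (simp add: algebra_simps)
  finally show "(a0, b) \<in> inverse_pairs" using 1 by (simp add: inverse_pairs_iff)
qed

definition coord where "coord z = (reduce (fst z), flat (upper (reduce (fst z)) * snd z * lower (fst z)))"
definition coord_inv where
  "coord_inv z = (unreduce (fst z), upper' (fst z) * unflat (snd z) * inverse_of (lower (fst z)))"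
text \<open>The domain asks for the two inverses that the argument uses: the triangular factor must be
invertible, and the excess must be small enough to be forced to vanish on inverse pairs.\<close>

definition coord_dom where
  "coord_dom = {z. lower (fst z) \<in> invertible_elements \<and>
    1 - upper (reduce (fst z)) * snd z * lower (fst z) * excess (reduce (fst z)) \<in> invertible_elements}"
definition coord_range where
  "coord_range = {z. lower (fst z) \<in> invertible_elements \<and>
    1 - unflat (snd z) * excess (fst z) \<in> invertible_elements}"
text \<open>The first condition says that the excess vanishes; the others describe the partners of \<open>a0\<close> in the
coordinates given by \<open>flat\<close>. The smaller space corresponds to the arrows with the same target as
\<open>(a0, b0)\<close>.\<close>

definition arrow_space where
  "arrow_space = {(x, y). (1 - e) * x * (1 - f) = 0 \<and> f * y * e = 0 \<and> (1 - f) * y * (1 - e) = 0}"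
definition fibre_space where
  "fibre_space = {(x, y). (1 - e) * x = 0 \<and> f * y = 0 \<and> y * (1 - e) = 0}"

lemmas block_defs = lower_def upper_def upper'_def reduce_def unreduce_def excess_def flat_def unflat_def

lemma coord_inv_coord:
  assumes "lower (fst z) \<in> invertible_elements"
  shows "coord_inv (coord z) = z"
proof -
  have "upper' x * (upper x * w) = w" for x w using upper_upper'(2)[of x] by (simp add: mult.assoc[symmetric])
  then show ?thesis
    using assms by (simp add: coord_def coord_inv_def unreduce_reduce lower_reduce unflat_flat mult.assoc)
qed

lemma coord_coord_inv:
  assumes "lower (fst z) \<in> invertible_elements"
  shows "coord (coord_inv z) = z"
proof -
  have "upper x * (upper' x * w) = w" for x w using upper_upper'(1)[of x] by (simp add: mult.assoc[symmetric])
  then show ?thesis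
    using assms by (simp add: coord_def coord_inv_def reduce_unreduce lower_unreduce flat_unflat mult.assoc)
qed

lemma coord_diffeo: "analytic_diffeo coord_dom coord_range coord coord_inv"
proof (rule analytic_diffeoI)
  let ?A = "{z :: 'a \<times> 'a. lower (fst z) \<in> invertible_elements}"
  have "open {z \<in> (UNIV :: ('a \<times> 'a) set). lower (fst z) \<in> invertible_elements}"
    by (rule open_analytic_preimage[OF open_UNIV open_invertible_elements])
      (unfold block_defs, intro analytic_intros)
  then have A: "open ?A" by simp
  have "open {z \<in> ?A. 1 - upper (reduce (fst z)) * snd z * lower (fst z) * excess (reduce (fst z)) \<in> invertible_elements}"
    by (rule open_analytic_preimage[OF A open_invertible_elements])
      (unfold block_defs, intro analytic_intros, simp_all)
  then show "open coord_dom" by (simp add: coord_dom_def)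
  have "open {z \<in> ?A. 1 - unflat (snd z) * excess (fst z) \<in> invertible_elements}"
    by (rule open_analytic_preimage[OF A open_invertible_elements])
      (unfold block_defs, intro analytic_intros)
  then show "open coord_range" by (simp add: coord_range_def)
  show "coord z \<in> coord_range" if "z \<in> coord_dom" for z
    using that by (simp add: coord_dom_def coord_range_def coord_def lower_reduce unflat_flat)
  show "coord_inv z \<in> coord_dom" if "z \<in> coord_range" for z
  proof -
    have "coord (coord_inv z) = z" using that coord_coord_inv by (simp add: coord_range_def)
    then have "reduce (fst (coord_inv z)) = fst z"
      "unflat (flat (upper (reduce (fst (coord_inv z))) * snd (coord_inv z) * lower (fst (coord_inv z)))) = unflat (snd z)"
      unfolding coord_def by (metis fst_conv, metis snd_conv)
    then show ?thesis
      using that by (simp add: coord_dom_def coord_range_def unflat_flat) (simp add: coord_inv_def lower_unreduce)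
  qed
  show "coord_inv (coord z) = z" if "z \<in> coord_dom" for z using that coord_inv_coord by (simp add: coord_dom_def)
  show "coord (coord_inv z) = z" if "z \<in> coord_range" for z using that coord_coord_inv by (simp add: coord_range_def)
  show "analytic_at UNIV coord z" if "z \<in> coord_dom" for z
    using that unfolding coord_def[abs_def] coord_dom_def block_defs
    by (intro analytic_intros) simp_all
  show "analytic_at UNIV coord_inv z" if "z \<in> coord_range" for z
    using that unfolding coord_inv_def[abs_def] coord_range_def block_defs
    by (intro analytic_intros) simp_all
qed

lemma base_in_coord_dom: "(a0, b0) \<in> coord_dom"
proof -
  have "lower a0 = 1" by (simp add: lower_def)
  moreover from this have "reduce a0 = a0" by (simp add: reduce_def algebra_simps)
  moreover have "excess a0 = 0" by (simp add: excess_def algebra_simps pair_simps)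
  ultimately show ?thesis by (simp add: coord_dom_def)
qed

lemma coord_arrows:
  assumes z: "z \<in> coord_dom"
  shows "z \<in> inverse_pairs \<longleftrightarrow> coord z \<in> arrow_space"
proof -
  define x where "x = reduce (fst z)"
  define b where "b = upper x * snd z * lower (fst z)"
  have inv: "lower x \<in> invertible_elements" "1 - b * excess x \<in> invertible_elements"
    using z by (simp_all add: coord_dom_def x_def b_def lower_reduce)
  have b_eq: "snd z = upper' x * b * inverse_of (lower x)"
  proof -
    have "upper' x * (upper x * w) = w" for w using upper_upper'(2)[of x] by (simp add: mult.assoc[symmetric])
    then show ?thesis using inv by (simp add: b_def x_def lower_reduce mult.assoc)
  qed
  have "fst z = lower x * (a0 + excess x) * upper x"
    using unreduce_reduce[of "fst z"] inv unreduce_factor[of x] by (simp add: x_def lower_reduce)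
  then have "z \<in> inverse_pairs \<longleftrightarrow> (a0 + excess x, b) \<in> inverse_pairs"
    using inverse_pairs_equivalent_iff[OF inverse_of[OF inv(1)] upper_upper'[of x], of "a0 + excess x" b] b_eq
    by (metis prod.collapse)
  also have "\<dots> \<longleftrightarrow> excess x = 0 \<and> (a0, b) \<in> inverse_pairs"
    using excess_eq_0[OF _ inv(2)] by auto
  also have "\<dots> \<longleftrightarrow> excess x = 0 \<and> f * flat b * e = 0 \<and> (1 - f) * flat b * (1 - e) = 0"
  proof -
    have "f * flat b * e = f * b * e - b0" unfolding flat_def by (simp add: algebra_simps pair_simps)
    moreover have "(1 - f) * flat b * (1 - e) = (1 - f) * b * (1 - e) - (1 - f) * b * a0 * b * (1 - e)"
      unfolding flat_def by (simp add: algebra_simps pair_simps)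
    ultimately show ?thesis unfolding inverse_pairs_at_base_iff by simp
  qed
  finally show ?thesis by (simp add: arrow_space_def coord_def x_def b_def excess_def)
qed

lemma fibre_space_subset: "fibre_space \<subseteq> arrow_space"
proof (clarsimp simp: fibre_space_def arrow_space_def)
  fix x y assume *: "(1 - e) * x = 0" "f * y = 0" "y * (1 - e) = 0"
  have "(1 - f) * y * (1 - e) = (1 - f) * (y * (1 - e))" by (simp only: mult.assoc)
  then show "(1 - f) * y * (1 - e) = 0" using * by simp
qed

text \<open>On arrows, \<open>a b = u (e + a0 y) u\<^sup>-\<^sup>1\<close> with \<open>u\<close> the lower triangular factor. This equals \<open>e\<close> if and only
if \<open>u (e + a0 y) = e u\<close>, an equation whose two columns separate into linear conditions on \<open>x\<close> and
on \<open>y\<close>.\<close>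

lemma coord_fibre:
  assumes z: "z \<in> coord_dom" "z \<in> inverse_pairs"
  shows "fst z * snd z = e \<longleftrightarrow> coord z \<in> fibre_space"
proof -
  define x where "x = reduce (fst z)"
  define b where "b = upper x * snd z * lower (fst z)"
  define y where "y = flat b"
  have cz: "coord z = (x, y)" by (simp add: coord_def x_def b_def y_def)
  have inv: "lower x \<in> invertible_elements" using z by (simp add: coord_dom_def x_def lower_reduce)
  have as: "(1 - e) * x * (1 - f) = 0" "f * y * e = 0" "(1 - f) * y * (1 - e) = 0"
    using coord_arrows[OF z(1)] z(2) by (auto simp: cz arrow_space_def)
  have ex: "excess x = 0" using as(1) by (simp add: excess_def)
  have z1: "fst z = lower x * a0 * upper x"
    using unreduce_reduce[of "fst z"] inv unreduce_factor[of x] ex by (simp add: x_def lower_reduce)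
  have "fst z * snd z = lower x * (a0 * b) * inverse_of (lower x)"
    unfolding z1 using inv by (simp add: b_def x_def lower_reduce mult.assoc)
  also have "a0 * b = e + a0 * y"
    unfolding y_def flat_def by (simp add: algebra_simps pair_simps)
  finally have "fst z * snd z = lower x * (e + a0 * y) * inverse_of (lower x)" .
  moreover have "p * inverse_of (lower x) = e \<longleftrightarrow> p = e * lower x" for p
  proof
    assume "p * inverse_of (lower x) = e"
    then have "p * inverse_of (lower x) * lower x = e * lower x" by simp
    then show "p = e * lower x" using inv by (simp add: mult.assoc)
  qed (use inv in \<open>simp add: mult.assoc\<close>)
  moreover have "lower x * (e + a0 * y) = x * b0 + lower x * a0 * y"
    by (simp add: lower_def algebra_simps pair_simps)
  moreover have "e * lower x = e * x * b0" by (simp add: lower_def algebra_simps pair_simps)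
  ultimately have eq: "fst z * snd z = e \<longleftrightarrow> x * b0 + lower x * a0 * y = e * x * b0" by simp
  show ?thesis
    unfolding eq cz
  proof
    assume *: "x * b0 + lower x * a0 * y = e * x * b0"
    have "lower x * a0 * y * a0 = lower x * a0 * (f * y * e) * a0" by (simp add: mult.assoc pair_simps)
    then have "(x * b0 + lower x * a0 * y) * a0 = x * b0 * a0" using as(2) by (simp add: distrib_right)
    then have "x * f = e * x * f" unfolding * by (simp add: mult.assoc)
    then have "(1 - e) * x * f = 0" by (simp add: algebra_simps)
    then have x0: "(1 - e) * x = 0" using as(1) by (simp add: right_diff_distrib)
    then have "e * x = x" by (simp add: algebra_simps)
    then have "lower x * (a0 * y) = 0" using * by (simp add: mult.assoc)
    then have "inverse_of (lower x) * (lower x * (a0 * y)) = 0" by simp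
    then have "a0 * y = 0" using inv by simp
    then have y0: "f * y = 0" by (simp add: mult.assoc)
    then have "y * (1 - e) = 0" using as(3) by (simp add: left_diff_distrib)
    then show "(x, y) \<in> fibre_space" using x0 y0 by (simp add: fibre_space_def)
  next
    assume "(x, y) \<in> fibre_space"
    then have *: "(1 - e) * x = 0" "f * y = 0" by (auto simp: fibre_space_def)
    have "a0 * y = a0 * (f * y)" by (simp add: mult.assoc pair_simps)
    then have "a0 * y = 0" using * by simp
    moreover have "e * x = x" using *(1) by (simp add: algebra_simps)
    ultimately show "x * b0 + lower x * a0 * y = e * x * b0" by (simp add: mult.assoc)
  qed
qed

lemma arrow_space_projection: "\<exists>P. projection_onto P arrow_space"
proof
  show "projection_onto (\<lambda>z. (fst z - (1 - e) * fst z * (1 - f),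
      snd z - f * snd z * e - (1 - f) * snd z * (1 - e))) arrow_space"
    unfolding projection_onto_def
  proof (intro conjI allI ballI)
    show "bounded_linear (\<lambda>z. (fst z - (1 - e) * fst z * (1 - f),
      snd z - f * snd z * e - (1 - f) * snd z * (1 - e)))"
      by (intro bounded_linear_Pair bounded_linear_sub bounded_linear_fst bounded_linear_snd
          bounded_linear_mult_left[THEN bounded_linear_compose]
          bounded_linear_mult_right[THEN bounded_linear_compose])
  qed (auto simp: arrow_space_def algebra_simps pair_simps)
qed

lemma fibre_space_projection: "\<exists>P. projection_onto P fibre_space"
proof
  show "projection_onto (\<lambda>z. (e * fst z, (1 - f) * snd z * e)) fibre_space"
    unfolding projection_onto_def
  proof (intro conjI allI ballI)
    show "bounded_linear (\<lambda>z. (e * fst z, (1 - f) * snd z * e))"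
      by (intro bounded_linear_Pair bounded_linear_fst bounded_linear_snd
          bounded_linear_mult_left[THEN bounded_linear_compose]
          bounded_linear_mult_right[THEN bounded_linear_compose])
    show "(e * fst z, (1 - f) * snd z * e) = z" if "z \<in> fibre_space" for z
    proof -
      obtain x y where z: "z = (x, y)" by fastforce
      have "e * x = x" "y * e = y" "f * y = 0"
        using that by (auto simp: z fibre_space_def algebra_simps)
      then show ?thesis by (simp add: z left_diff_distrib mult.assoc)
    qed
  qed (auto simp: fibre_space_def algebra_simps pair_simps)
qed

lemma straightens_arrows: "straightens coord_dom coord_range coord coord_inv inverse_pairs arrow_space"
  unfolding straightens_def using coord_diffeo arrow_space_projection coord_arrows by blast

lemma straightens_fibre:
  "straightens coord_dom coord_range coord coord_inv {g \<in> inverse_pairs. fst g * snd g = e} fibre_space"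
  unfolding straightens_def
  using coord_diffeo fibre_space_projection coord_arrows coord_fibre fibre_space_subset by blast

end

lemma inverse_pairs_straightened:
  fixes g :: "'a::{real_normed_algebra, monoid_mult, banach} \<times> 'a"
  assumes "g \<in> inverse_pairs"
  shows "\<exists>U U' \<Phi> \<Psi> V W. g \<in> U \<and> W \<subseteq> V \<and> straightens U U' \<Phi> \<Psi> inverse_pairs V \<and>
    straightens U U' \<Phi> \<Psi> {h \<in> inverse_pairs. fst h * snd h = fst g * snd g} (W :: ('a \<times> 'a) set)"
proof -
  obtain a b where g: "g = (a, b)" by fastforce
  interpret inverse_pair a b by standard (use assms g in simp)
  show ?thesis
    using base_in_coord_dom straightens_arrows straightens_fibre fibre_space_subset unfolding g fst_conv snd_conv by blast
qed

section \<open>Composable pairs\<close>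

lemma algebra_groupoid_simps:
  "arrows algebra_groupoid = inverse_pairs" "objects algebra_groupoid = idempotents"
  "src algebra_groupoid = (\<lambda>g. snd g * fst g)" "tgt algebra_groupoid = (\<lambda>g. fst g * snd g)"
  "gmult algebra_groupoid = (\<lambda>g h. (fst g * fst h, snd h * snd g))"
  "gid algebra_groupoid = (\<lambda>q. (q, q))" "ginv algebra_groupoid = (\<lambda>g. (snd g, fst g))"
  by (simp_all add: algebra_groupoid_def case_prod_unfold)

lemma composable_algebra_groupoid:
  "composable algebra_groupoid =
    {(g, h). g \<in> inverse_pairs \<and> h \<in> inverse_pairs \<and> snd g * fst g = fst h * snd h}"
  by (simp add: composable_def algebra_groupoid_simps)

text \<open>Near \<open>(g0, h0)\<close>, the transporter from \<open>q = s(g0)\<close> to \<open>s(g)\<close> may be used to twist \<open>h\<close> into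
\<open>tw g h\<close>, whose target is conjugated back. Then \<open>(g, h)\<close> is composable if and only if the target
of \<open>tw g h\<close> is the constant \<open>q\<close>, and the coordinates near \<open>h0\<close> straighten the fibre of the target
map over \<open>q\<close> together with the space of arrows.\<close>

lemma composable_straightened:
  fixes z0 :: "('a::{real_normed_algebra, monoid_mult, banach} \<times> 'a) \<times> ('a \<times> 'a)"
  assumes z0: "z0 \<in> composable algebra_groupoid"
  shows "\<exists>U U' \<Phi> \<Psi> V W. z0 \<in> U \<and> W \<subseteq> V \<and>
    straightens U U' \<Phi> \<Psi> (inverse_pairs \<times> inverse_pairs) V \<and>
    straightens U U' \<Phi> \<Psi> (composable algebra_groupoid) (W :: (('a \<times> 'a) \<times> ('a \<times> 'a)) set)"
proof -
  obtain g0 h0 where gh0: "z0 = (g0, h0)" by (rule prod.exhaust)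
  define q where "q = snd g0 * fst g0"
  have g0: "g0 \<in> inverse_pairs" and h0: "h0 \<in> inverse_pairs" and q2: "q = fst h0 * snd h0"
    using z0 by (auto simp: gh0 composable_algebra_groupoid q_def)
  have qQ: "q \<in> idempotents"
    using inverse_pairs_idempotents(2)[of "fst g0" "snd g0"] g0 by (simp add: q_def)
  obtain U1 U1' \<Phi>1 \<Psi>1 and V1 :: "('a \<times> 'a) set" where 1: "g0 \<in> U1"
    "straightens U1 U1' \<Phi>1 \<Psi>1 inverse_pairs V1"
    using inverse_pairs_straightened[OF g0] by blast
  obtain U2 U2' \<Phi>2 \<Psi>2 V2 and W2 :: "('a \<times> 'a) set" where 2: "h0 \<in> U2" "W2 \<subseteq> V2"
    "straightens U2 U2' \<Phi>2 \<Psi>2 inverse_pairs V2"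
    "straightens U2 U2' \<Phi>2 \<Psi>2 {h \<in> inverse_pairs. fst h * snd h = q} W2"
    using inverse_pairs_straightened[OF h0] unfolding q2 by blast
  have d1: "analytic_diffeo U1 U1' \<Phi>1 \<Psi>1" and d2: "analytic_diffeo U2 U2' \<Phi>2 \<Psi>2"
    using 1(2) 2(3) unfolding straightens_def by auto
  note D1 = analytic_diffeoD[OF d1] and D2 = analytic_diffeoD[OF d2]
  obtain P1 P2 Q2 where P: "projection_onto P1 V1" "projection_onto P2 V2" "projection_onto Q2 W2"
    using 1(2) 2(3,4) unfolding straightens_def by blast
  have S1: "\<And>g. g \<in> U1 \<Longrightarrow> g \<in> inverse_pairs \<longleftrightarrow> \<Phi>1 g \<in> V1" using 1(2) unfolding straightens_def by blast
  have S2: "\<And>g. g \<in> U2 \<Longrightarrow> g \<in> inverse_pairs \<longleftrightarrow> \<Phi>2 g \<in> V2" using 2(3) unfolding straightens_def by blast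
  have T2: "\<And>g. g \<in> U2 \<Longrightarrow> g \<in> inverse_pairs \<and> fst g * snd g = q \<longleftrightarrow> \<Phi>2 g \<in> W2"
    using 2(4) unfolding straightens_def by blast
  define c where "c g = transporter q (snd g * fst g)" for g :: "'a \<times> 'a"
  define tw where "tw g h = (inverse_of (c g) * fst h, snd h * c g)" for g h :: "'a \<times> 'a"
  define untw where "untw g h = (c g * fst h, snd h * inverse_of (c g))" for g h :: "'a \<times> 'a"
  \<comment> \<open>The twist depends on the first arrow only, which is unchanged, so it can be undone.\<close>
  define U where "U = {z. fst z \<in> U1 \<and> c (fst z) \<in> invertible_elements \<and> tw (fst z) (snd z) \<in> U2}"
  define U' where "U' = {z. fst z \<in> U1' \<and> c (\<Psi>1 (fst z)) \<in> invertible_elements \<and> snd z \<in> U2'}"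
  define \<Phi> where "\<Phi> z = (\<Phi>1 (fst z), \<Phi>2 (tw (fst z) (snd z)))" for z
  define \<Psi> where "\<Psi> z = (\<Psi>1 (fst z), untw (\<Psi>1 (fst z)) (\<Psi>2 (snd z)))" for z
  have tw_untw: "tw g (untw g h) = h" "untw g (tw g h) = h" if "c g \<in> invertible_elements" for g h
    using that by (simp_all add: tw_def untw_def mult.assoc)
  have c_an: "analytic_at UNIV c g" for g
    unfolding c_def[abs_def] transporter_def by (intro analytic_intros)
  have c_fst: "analytic_at UNIV (\<lambda>z. c (fst z)) z" for z :: "('a \<times> 'a) \<times> 'a \<times> 'a"
    unfolding c_def[abs_def] transporter_def by (intro analytic_intros)
  have tw_an: "analytic_at UNIV (\<lambda>z. tw (fst z) (snd z)) z" if "c (fst z) \<in> invertible_elements" for z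
    unfolding tw_def[abs_def] by (intro analytic_intros c_fst that)
  have \<Psi>1_an: "analytic_at UNIV (\<lambda>z. \<Psi>1 (fst z)) z" if "fst z \<in> U1'" for z :: "('a \<times> 'a) \<times> 'a \<times> 'a"
    using analytic_at_UNIV_compose[of \<Psi>1 fst z] D1(8)[OF that] analytic_at_fst[OF analytic_at_ident] by blast
  have \<Psi>2_an: "analytic_at UNIV (\<lambda>z. \<Psi>2 (snd z)) z" if "snd z \<in> U2'" for z :: "('a \<times> 'a) \<times> 'a \<times> 'a"
    using analytic_at_UNIV_compose[of \<Psi>2 snd z] D2(8)[OF that] analytic_at_snd[OF analytic_at_ident] by blast
  have c\<Psi>_an: "analytic_at UNIV (\<lambda>z. c (\<Psi>1 (fst z))) z" if "fst z \<in> U1'" for z :: "('a \<times> 'a) \<times> 'a \<times> 'a"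
    using analytic_at_UNIV_compose[of c "\<lambda>z. \<Psi>1 (fst z)" z] c_an \<Psi>1_an[OF that] by blast
  have diffeo: "analytic_diffeo U U' \<Phi> \<Psi>"
  proof (rule analytic_diffeoI)
    let ?A = "U1 \<times> (UNIV :: ('a \<times> 'a) set)"
    have A: "open ?A" using D1(1) by (simp add: open_Times)
    have B: "open {z \<in> ?A. c (fst z) \<in> invertible_elements}"
      by (rule open_analytic_preimage[OF A open_invertible_elements c_fst])
    have "open {z \<in> {z \<in> ?A. c (fst z) \<in> invertible_elements}. tw (fst z) (snd z) \<in> U2}"
      by (rule open_analytic_preimage[OF B D2(1) tw_an]) simp
    also have "{z \<in> {z \<in> ?A. c (fst z) \<in> invertible_elements}. tw (fst z) (snd z) \<in> U2} = U"
      by (auto simp: U_def)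
    finally show "open U" .
    let ?A' = "U1' \<times> U2'"
    have "open {z \<in> ?A'. c (\<Psi>1 (fst z)) \<in> invertible_elements}"
      by (rule open_analytic_preimage[OF _ open_invertible_elements c\<Psi>_an])
        (use D1(2) D2(2) in \<open>auto simp: open_Times\<close>)
    also have "{z \<in> ?A'. c (\<Psi>1 (fst z)) \<in> invertible_elements} = U'" by (auto simp: U'_def)
    finally show "open U'" .
    show "\<Phi> z \<in> U'" if "z \<in> U" for z
      using that D1(3,4) D2(3) by (simp add: U_def U'_def \<Phi>_def)
    show "\<Psi> (\<Phi> z) = z" if "z \<in> U" for z
      using that D1(4) D2(4) tw_untw by (simp add: U_def \<Phi>_def \<Psi>_def)
    show "\<Psi> z \<in> U" if "z \<in> U'" for z
      using that D1(6) D2(6) tw_untw by (simp add: U_def U'_def \<Psi>_def)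
    show "\<Phi> (\<Psi> z) = z" if "z \<in> U'" for z
      using that D1(7) D2(7) tw_untw by (simp add: U'_def \<Phi>_def \<Psi>_def)
    show "analytic_at UNIV \<Phi> z" if z: "z \<in> U" for z
    proof -
      have "analytic_at UNIV (\<lambda>z. \<Phi>1 (fst z)) z"
        using analytic_at_UNIV_compose[of \<Phi>1 fst z] D1(5)[of "fst z"] z analytic_at_fst[OF analytic_at_ident]
        unfolding U_def by blast
      moreover have "analytic_at UNIV (\<lambda>z. \<Phi>2 (tw (fst z) (snd z))) z"
        using analytic_at_UNIV_compose[of \<Phi>2 "\<lambda>z. tw (fst z) (snd z)" z]
          D2(5)[of "tw (fst z) (snd z)"] tw_an[of z] z unfolding U_def by blast
      ultimately show ?thesis unfolding \<Phi>_def[abs_def] by (rule analytic_at_Pair)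
    qed
    show "analytic_at UNIV \<Psi> z" if z: "z \<in> U'" for z
      unfolding \<Psi>_def[abs_def] untw_def
      by (intro analytic_intros \<Psi>1_an \<Psi>2_an c\<Psi>_an) (use z in \<open>auto simp: U'_def\<close>)
  qed
  have tw_pairs: "tw g h \<in> inverse_pairs \<longleftrightarrow> h \<in> inverse_pairs" if "c g \<in> invertible_elements" for g h
    using inverse_pairs_equivalent_iff[of "inverse_of (c g)" "c g" 1 1 "fst h" "snd h"] that
    by (simp add: tw_def)
  have SV: "z \<in> inverse_pairs \<times> inverse_pairs \<longleftrightarrow> \<Phi> z \<in> V1 \<times> V2" if z: "z \<in> U" for z
    using z S1[of "fst z"] S2[of "tw (fst z) (snd z)"] tw_pairs[of "fst z" "snd z"]
    unfolding U_def \<Phi>_def mem_Times_iff fst_conv snd_conv by blast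
  have TW: "z \<in> composable algebra_groupoid \<longleftrightarrow> \<Phi> z \<in> V1 \<times> W2" if z: "z \<in> U" for z
  proof -
    obtain g h where gh: "z = (g, h)" by (rule prod.exhaust)
    have inv: "c g \<in> invertible_elements" and U: "g \<in> U1" "tw g h \<in> U2" using z by (auto simp: U_def gh)
    define p where "p = snd g * fst g"
    \<comment> \<open>The transporter intertwines \<open>q\<close> and \<open>p\<close> only if \<open>p\<close> is idempotent, which needs \<open>g\<close> to be an arrow.\<close>
    have target: "fst (tw g h) * snd (tw g h) = q \<longleftrightarrow> p = fst h * snd h" if "g \<in> inverse_pairs"
    proof -
      have "p \<in> idempotents" using inverse_pairs_idempotents(2)[of "fst g" "snd g"] that by (simp add: p_def)
      note cq = transporter_conjugates[OF qQ this, folded p_def]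
      have cg: "c g = transporter q p" by (simp add: c_def p_def)
      have t: "fst (tw g h) * snd (tw g h) = inverse_of (c g) * (fst h * snd h) * c g"
        by (simp add: tw_def mult.assoc)
      show ?thesis
      proof
        assume "fst (tw g h) * snd (tw g h) = q"
        then have "c g * (inverse_of (c g) * (fst h * snd h) * c g) * inverse_of (c g) = c g * q * inverse_of (c g)"
          unfolding t by simp
        then show "p = fst h * snd h" using inv cq(1) by (simp add: cg mult.assoc)
      next
        assume "p = fst h * snd h"
        then show "fst (tw g h) * snd (tw g h) = q" unfolding t using cq(2) inv by (simp add: cg)
      qed
    qed
    have "z \<in> composable algebra_groupoid \<longleftrightarrow> g \<in> inverse_pairs \<and> h \<in> inverse_pairs \<and> p = fst h * snd h"
      by (simp add: gh composable_algebra_groupoid p_def)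
    also have "\<dots> \<longleftrightarrow> g \<in> inverse_pairs \<and> tw g h \<in> inverse_pairs \<and> fst (tw g h) * snd (tw g h) = q"
      using target tw_pairs[OF inv] by auto
    also have "\<dots> \<longleftrightarrow> \<Phi>1 g \<in> V1 \<and> \<Phi>2 (tw g h) \<in> W2" using S1[OF U(1)] T2[OF U(2)] by blast
    finally show ?thesis by (simp add: gh \<Phi>_def)
  qed
  have ex: "\<exists>P. projection_onto P (V1 \<times> V2)" "\<exists>P. projection_onto P (V1 \<times> W2)"
    by (rule exI, rule projection_onto_prod[OF P(1,2)]) (rule exI, rule projection_onto_prod[OF P(1,3)])
  have "straightens U U' \<Phi> \<Psi> (inverse_pairs \<times> inverse_pairs) (V1 \<times> V2)"
    unfolding straightens_def by (intro conjI ballI diffeo ex SV)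
  moreover have "straightens U U' \<Phi> \<Psi> (composable algebra_groupoid) (V1 \<times> W2)"
    unfolding straightens_def by (intro conjI ballI diffeo ex TW)
  moreover have "V1 \<times> W2 \<subseteq> V1 \<times> V2" using 2(2) by auto
  moreover have "z0 \<in> U"
  proof -
    have "c g0 = 1" using transporter_self[OF qQ] by (simp add: c_def q_def)
    then show ?thesis using 1(1) 2(1) by (simp add: U_def tw_def gh0)
  qed
  ultimately show ?thesis by blast
qed

section \<open>Manifold structures\<close>

lemma idempotents_embedded:
  "is_submanifold banach_space_manifold (idempotents :: 'a::{real_normed_algebra, monoid_mult, banach} set)"
  "embedded_manifold idempotents_manifold (idempotents :: 'a set)"
  unfolding idempotents_manifold_def
  by (rule straightened_submanifold_banach[OF idempotents_straightened]; assumption)+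

lemma inverse_pairs_embedded:
  "is_submanifold banach_space_manifold
    (inverse_pairs :: ('a::{real_normed_algebra, monoid_mult, banach} \<times> 'a) set)"
  "embedded_manifold inverse_pairs_manifold (inverse_pairs :: ('a \<times> 'a) set)"
proof -
  have "\<exists>U U' \<Phi> \<Psi> V. g \<in> U \<and> straightens U U' \<Phi> \<Psi> inverse_pairs (V :: ('a \<times> 'a) set)"
    if g: "g \<in> inverse_pairs" for g :: "'a \<times> 'a"
    using inverse_pairs_straightened[OF g] by blast
  from straightened_submanifold_banach[OF this]
  show "is_submanifold banach_space_manifold (inverse_pairs :: ('a \<times> 'a) set)"
    "embedded_manifold inverse_pairs_manifold (inverse_pairs :: ('a \<times> 'a) set)"
    unfolding inverse_pairs_manifold_def by auto
qed

lemma composable_embedded: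
  fixes G :: "('a::{real_normed_algebra, monoid_mult, banach} \<times> 'a, 'a \<times> 'a) manifold"
  assumes "G = inverse_pairs_manifold"
  shows "is_submanifold (prod_manifold G G) (composable algebra_groupoid)"
  "embedded_manifold (submanifold (prod_manifold G G) (composable algebra_groupoid)) (composable algebra_groupoid)"
proof -
  have "composable algebra_groupoid \<subseteq> inverse_pairs \<times> (inverse_pairs :: ('a \<times> 'a) set)"
    by (auto simp: composable_algebra_groupoid)
  note * = straightened_submanifold[OF embedded_manifold_prod[OF inverse_pairs_embedded(2) inverse_pairs_embedded(2)]
      this composable_straightened]
  show "is_submanifold (prod_manifold G G) (composable algebra_groupoid)"
    "embedded_manifold (submanifold (prod_manifold G G) (composable algebra_groupoid)) (composable algebra_groupoid)"
    unfolding assms by (rule *; assumption)+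
qed

lemma invertible_elements_straightened:
  "\<exists>U U' \<Phi> \<Psi> V. a \<in> U \<and>
    straightens U U' \<Phi> \<Psi> invertible_elements (V :: 'a::{real_normed_algebra, monoid_mult, banach} set)"
  if "a \<in> (invertible_elements :: 'a set)"
proof -
  have "analytic_diffeo invertible_elements (invertible_elements :: 'a set) (\<lambda>x. x) (\<lambda>x. x)"
    by (rule analytic_diffeoI) (auto intro: open_invertible_elements analytic_at_ident)
  then have "straightens invertible_elements (invertible_elements :: 'a set) (\<lambda>x. x) (\<lambda>x. x) invertible_elements UNIV"
    unfolding straightens_def projection_onto_def
    by (auto intro!: exI[of _ "\<lambda>x. x"] bounded_linear_ident)
  then show ?thesis using that by blast
qed

lemma carrier_unit_group: "carrier unit_group = invertible_elements"
  by (simp add: unit_group_def invertible_elements_def)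

lemma unit_group_embedded:
  "embedded_manifold unit_group_manifold
    (invertible_elements :: 'a::{real_normed_algebra, monoid_mult, banach} set)"
  unfolding unit_group_manifold_def carrier_unit_group
  by (rule straightened_submanifold_banach(2)[OF invertible_elements_straightened])

definition mutual_inverses :: "('a::{real_normed_algebra, monoid_mult, banach} \<times> 'a) set" where
  "mutual_inverses = {(a, b). a * b = 1 \<and> b * a = 1}"

lemma mutual_inverses_iff: "(a, b) \<in> mutual_inverses \<longleftrightarrow> a \<in> invertible_elements \<and> b = inverse_of a"
  using inverse_of_eqI[of a b] by (auto simp: mutual_inverses_def)

lemma mutual_inverses_subset: "mutual_inverses \<subseteq> inverse_pairs"
  by (auto simp: mutual_inverses_def inverse_pairs_iff)

lemma carrier_isotropy_group_one: "carrier isotropy_group_one = mutual_inverses"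
  by (auto simp: isotropy_group_one_def isotropy_group_def algebra_groupoid_simps mutual_inverses_def
      inverse_pairs_iff)

text \<open>If one component is invertible, then an inverse pair consists of mutual inverses. So the isotropy
group at \<open>1\<close> is open in the space of arrows, and its model space is that of the arrows.\<close>

lemma mutual_inverses_straightened:
  fixes g :: "'a::{real_normed_algebra, monoid_mult, banach} \<times> 'a"
  assumes g: "g \<in> mutual_inverses"
  shows "\<exists>U U' \<Phi> \<Psi> V W. g \<in> U \<and> W \<subseteq> V \<and> straightens U U' \<Phi> \<Psi> inverse_pairs V \<and>
    straightens U U' \<Phi> \<Psi> mutual_inverses (W :: ('a \<times> 'a) set)"
proof -
  have gG: "g \<in> inverse_pairs" using g mutual_inverses_subset by blast
  obtain U U' \<Phi> \<Psi> and V :: "('a \<times> 'a) set" where *: "g \<in> U" "straightens U U' \<Phi> \<Psi> inverse_pairs V"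
    using inverse_pairs_straightened[OF gG] by blast
  have d: "analytic_diffeo U U' \<Phi> \<Psi>" and P: "\<exists>P. projection_onto P V"
    and SV: "\<And>x. x \<in> U \<Longrightarrow> x \<in> inverse_pairs \<longleftrightarrow> \<Phi> x \<in> V"
    using *(2) unfolding straightens_def by auto
  note D = analytic_diffeoD[OF d]
  define A where "A = {z \<in> U. fst z \<in> (invertible_elements :: 'a set)}"
  define A' where "A' = {z \<in> U'. fst (\<Psi> z) \<in> (invertible_elements :: 'a set)}"
  have "analytic_diffeo A A' \<Phi> \<Psi>"
  proof (rule analytic_diffeoI)
    show "open A" unfolding A_def
      by (rule open_analytic_preimage[OF D(1) open_invertible_elements]) (intro analytic_intros)
    show "open A'" unfolding A'_def
      by (rule open_analytic_preimage[OF D(2) open_invertible_elements]) (intro analytic_at_fst D(8))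
  qed (use D in \<open>auto simp: A_def A'_def\<close>)
  moreover have "x \<in> mutual_inverses \<longleftrightarrow> x \<in> inverse_pairs" if x: "x \<in> A" for x
  proof
    assume xG: "x \<in> inverse_pairs"
    obtain a b where ab: "x = (a, b)" by fastforce
    have inv: "a \<in> invertible_elements" and aba: "a * b * a = a" using x xG by (auto simp: A_def ab inverse_pairs_iff)
    have "a * b = (a * b * a) * inverse_of a" using inv by (simp add: mult.assoc)
    moreover have "b * a = inverse_of a * (a * b * a)" using inv by (simp add: mult.assoc)
    ultimately have "a * b = 1" "b * a = 1" unfolding aba using inv by simp_all
    then show "x \<in> mutual_inverses" by (simp add: ab mutual_inverses_def)
  qed (use mutual_inverses_subset in blast)
  then have "x \<in> mutual_inverses \<longleftrightarrow> \<Phi> x \<in> V" "x \<in> inverse_pairs \<longleftrightarrow> \<Phi> x \<in> V" if "x \<in> A" for x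
    using SV[of x] that by (auto simp: A_def)
  ultimately have "straightens A A' \<Phi> \<Psi> inverse_pairs V" "straightens A A' \<Phi> \<Psi> mutual_inverses V"
    unfolding straightens_def using P by auto
  moreover have "g \<in> A" using *(1) g by (cases g) (auto simp: A_def mutual_inverses_iff)
  ultimately show ?thesis by blast
qed

lemma isotropy_group_one_embedded:
  "is_submanifold inverse_pairs_manifold
    (mutual_inverses :: ('a::{real_normed_algebra, monoid_mult, banach} \<times> 'a) set)"
  "embedded_manifold isotropy_group_one_manifold (mutual_inverses :: ('a \<times> 'a) set)"
  unfolding isotropy_group_one_manifold_def carrier_isotropy_group_one
  by (rule straightened_submanifold[OF inverse_pairs_embedded(2) mutual_inverses_subset mutual_inverses_straightened];
      assumption)+

section \<open>The Banach-Lie groupoid\<close>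

lemma composable_product:
  fixes a1 b1 a2 b2 :: "'a::{real_normed_algebra, monoid_mult, banach}"
  assumes "(a1, b1) \<in> inverse_pairs" "(a2, b2) \<in> inverse_pairs" "b1 * a1 = a2 * b2"
  shows "(a1 * a2, b2 * b1) \<in> inverse_pairs"
    "(b2 * b1) * (a1 * a2) = b2 * a2" "(a1 * a2) * (b2 * b1) = a1 * b1"
proof -
  have p: "a1 * (b1 * a1) = a1" "b1 * (a1 * b1) = b1" "b1 * (a1 * (b1 * z)) = b1 * z"
    "b2 * (a2 * b2) = b2" "a2 * (b2 * (a2 * z)) = a2 * z" "a2 * (b2 * a2) = a2" for z
    using assms(1,2) by (simp_all add: inverse_pairs_iff mult.assoc[symmetric])
  have c: "b1 * (a1 * z) = a2 * (b2 * z)" for z using assms(3) by (simp add: mult.assoc[symmetric])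
  show s: "(b2 * b1) * (a1 * a2) = b2 * a2" by (simp add: mult.assoc c p)
  have "(a1 * a2) * (b2 * b1) = a1 * (a2 * b2) * b1" by (simp only: mult.assoc)
  also have "\<dots> = a1 * b1" using p by (simp add: assms(3)[symmetric] mult.assoc)
  finally show t: "(a1 * a2) * (b2 * b1) = a1 * b1" .
  have "(a1 * a2) * (b2 * b1) * (a1 * a2) = a1 * (b1 * a1) * a2" unfolding t by (simp only: mult.assoc)
  moreover have "(b2 * b1) * (a1 * a2) * (b2 * b1) = b2 * (a2 * b2) * b1" unfolding s by (simp only: mult.assoc)
  ultimately show "(a1 * a2, b2 * b1) \<in> inverse_pairs" unfolding inverse_pairs_iff using p by simp
qed

lemma is_groupoid_algebra_groupoid: "is_groupoid algebra_groupoid"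
  unfolding is_groupoid_def composable_algebra_groupoid algebra_groupoid_simps
proof (intro conjI)
  show "\<forall>g\<in>inverse_pairs. snd g * fst g \<in> idempotents \<and> fst g * snd g \<in> idempotents"
    using inverse_pairs_idempotents by auto
  show "\<forall>(g, h)\<in>{(g, h). g \<in> inverse_pairs \<and> h \<in> inverse_pairs \<and> snd g * fst g = fst h * snd h}.
      (fst g * fst h, snd h * snd g) \<in> inverse_pairs \<and>
      snd (fst g * fst h, snd h * snd g) * fst (fst g * fst h, snd h * snd g) = snd h * fst h \<and>
      fst (fst g * fst h, snd h * snd g) * snd (fst g * fst h, snd h * snd g) = fst g * snd g"
    using composable_product by auto
qed (auto simp: inverse_pairs_iff idempotents_iff mult.assoc)

text \<open>The arrow \<open>(a, b)\<close> is continued to nearby targets by the transporter, which leaves the source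
fixed. The latter shows that orbits are open.\<close>

lemma target_has_local_section:
  assumes g: "g \<in> inverse_pairs"
  shows "has_local_section {h \<in> inverse_pairs. snd h * fst h = snd g * fst g} idempotents (\<lambda>g. fst g * snd g) g"
proof -
  obtain a b where ab: "g = (a, b)" by fastforce
  have Q: "a * b \<in> idempotents" using g inverse_pairs_idempotents ab by blast
  define c where "c = transporter (a * b)"
  have c1: "c (a * b) = 1" using transporter_self[OF Q] by (simp add: c_def)
  have an: "analytic_at UNIV (\<lambda>p. (c p * a, b * inverse_of (c p))) (a * b)"
    unfolding c_def transporter_def
    by (intro analytic_intros) (simp add: c1[unfolded c_def transporter_def])
  show ?thesis
    unfolding has_local_section_def
  proof (intro exI conjI)
    show "extends_analytically idempotents (\<lambda>p. (c p * a, b * inverse_of (c p))) (fst g * snd g)"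
      using an by (simp add: ab extends_analyticallyI)
    show "(c (fst g * snd g) * a, b * inverse_of (c (fst g * snd g))) = g" by (simp add: ab c1)
    have "\<forall>\<^sub>F p in nhds (a * b). c p \<in> invertible_elements"
      using transporter_eventually_invertible[OF Q] by (simp add: c_def)
    then show "\<forall>\<^sub>F p in nhds (fst g * snd g). p \<in> idempotents \<longrightarrow>
        (c p * a, b * inverse_of (c p)) \<in> {h \<in> inverse_pairs. snd h * fst h = snd g * fst g} \<and>
        fst (c p * a, b * inverse_of (c p)) * snd (c p * a, b * inverse_of (c p)) = p"
      unfolding ab fst_conv snd_conv
    proof eventually_elim
      case (elim p)
      show ?case
      proof (intro impI conjI)
        assume p: "p \<in> idempotents"
        show "(c p * a, b * inverse_of (c p)) \<in> {h \<in> inverse_pairs. snd h * fst h = b * a}"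
          using inverse_pairs_equivalent_iff[of "c p" "inverse_of (c p)" 1 1 a b] elim g ab
          by (simp add: mult.assoc)
        show "c p * a * (b * inverse_of (c p)) = p"
          using transporter_conjugates(1)[OF Q p] elim by (simp add: c_def mult.assoc)
      qed
    qed
  qed
qed

lemma has_local_section_mono:
  assumes "has_local_section S T f p" "S \<subseteq> S'"
  shows "has_local_section S' T f p"
proof -
  obtain \<sigma> where \<sigma>: "extends_analytically T \<sigma> (f p)" "\<sigma> (f p) = p"
    "\<forall>\<^sub>F y in nhds (f p). y \<in> T \<longrightarrow> \<sigma> y \<in> S \<and> f (\<sigma> y) = y"
    using assms(1) unfolding has_local_section_def by blast
  have "\<forall>\<^sub>F y in nhds (f p). y \<in> T \<longrightarrow> \<sigma> y \<in> S' \<and> f (\<sigma> y) = y"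
    using \<sigma>(3) by eventually_elim (use assms(2) in auto)
  then show ?thesis unfolding has_local_section_def using \<sigma> by blast
qed

text \<open>Inversion exchanges source and target.\<close>

lemma source_has_local_section:
  fixes g :: "'a::{real_normed_algebra, monoid_mult, banach} \<times> 'a"
  assumes g: "g \<in> inverse_pairs"
  shows "has_local_section inverse_pairs idempotents (\<lambda>g. snd g * fst g) g"
proof -
  let ?t = "\<lambda>g :: 'a \<times> 'a. fst g * snd g"
  have swap: "(snd h, fst h) \<in> inverse_pairs \<longleftrightarrow> h \<in> inverse_pairs" for h :: "'a \<times> 'a"
    by (cases h) (auto simp: inverse_pairs_iff)
  have "has_local_section inverse_pairs idempotents ?t (snd g, fst g)"
    using has_local_section_mono[OF target_has_local_section[of "(snd g, fst g)"]] g swap by auto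
  then obtain \<sigma> where \<sigma>: "extends_analytically idempotents \<sigma> (snd g * fst g)"
    "\<sigma> (snd g * fst g) = (snd g, fst g)"
    "\<forall>\<^sub>F q in nhds (snd g * fst g). q \<in> idempotents \<longrightarrow> \<sigma> q \<in> inverse_pairs \<and> ?t (\<sigma> q) = q"
    unfolding has_local_section_def fst_conv snd_conv by blast
  have q: "snd g * fst g \<in> idempotents" using inverse_pairs_idempotents(2)[of "fst g" "snd g"] g by simp
  have "analytic_at UNIV (\<lambda>h. (snd h, fst h)) (\<sigma> (snd g * fst g))" by (intro analytic_intros)
  from extends_analytically_compose[OF \<sigma>(1) extends_analyticallyI[OF this, of UNIV] q]
  have "extends_analytically idempotents (\<lambda>q. (snd (\<sigma> q), fst (\<sigma> q))) (snd g * fst g)" by simp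
  moreover have "\<forall>\<^sub>F q in nhds (snd g * fst g). q \<in> idempotents \<longrightarrow>
      (snd (\<sigma> q), fst (\<sigma> q)) \<in> inverse_pairs \<and> fst (\<sigma> q) * snd (\<sigma> q) = q"
    using \<sigma>(3) by eventually_elim (use swap in blast)
  ultimately show ?thesis
    unfolding has_local_section_def
    by (intro exI[of _ "\<lambda>q. (snd (\<sigma> q), fst (\<sigma> q))"]) (simp add: \<sigma>(2))
qed

text \<open>On a fixed source fibre the target map still has local sections, so its image, the orbit, is open.\<close>

lemma locally_transitive_algebra_groupoid:
  "locally_transitive (algebra_groupoid :: ('a::{real_normed_algebra, monoid_mult, banach} \<times> 'a, 'a) groupoid)
    (mtop idempotents_manifold)"
  unfolding locally_transitive_def
proof
  fix x :: 'a assume "x \<in> objects algebra_groupoid"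
  let ?F = "{h \<in> inverse_pairs. snd h * fst h = x}"
  have "open_map (top_of_set ?F) (top_of_set idempotents) (\<lambda>g. fst g * snd g)"
  proof (rule local_sections_open_map)
    show "fst p * snd p \<in> idempotents" if "p \<in> ?F" for p
      using that inverse_pairs_idempotents(1)[of "fst p" "snd p"] by simp
    show "has_local_section ?F idempotents (\<lambda>g. fst g * snd g) p" if "p \<in> ?F" for p
      using that target_has_local_section[of p] by simp
  qed
  from this[unfolded open_map_def, rule_format, of ?F]
  have "openin (top_of_set idempotents) ((\<lambda>g. fst g * snd g) ` ?F)" by simp
  then show "openin (mtop idempotents_manifold) (orbit algebra_groupoid x)"
    by (simp add: embedded_manifoldD(1)[OF idempotents_embedded(2)] orbit_def algebra_groupoid_simps)
qed

lemma real_analytic_Lie_groupoid_algebra_groupoid: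
  "real_analytic_Lie_groupoid
    (algebra_groupoid :: ('a::{real_normed_algebra, monoid_mult, banach} \<times> 'a, 'a) groupoid)
    inverse_pairs_manifold idempotents_manifold"
proof -
  let ?\<Gamma> = "algebra_groupoid :: ('a \<times> 'a, 'a) groupoid"
  let ?G = "inverse_pairs_manifold :: ('a \<times> 'a, 'a \<times> 'a) manifold"
  let ?Q = "idempotents_manifold :: ('a, 'a) manifold"
  note G = inverse_pairs_embedded(2) and Q = idempotents_embedded(2)
  note GG = composable_embedded[OF refl]
  note topG = embedded_manifoldD(1)[OF G] and topQ = embedded_manifoldD(1)[OF Q]
  have st: "snd g * fst g \<in> idempotents" "fst g * snd g \<in> idempotents" if "g \<in> inverse_pairs" for g :: "'a \<times> 'a"
    using inverse_pairs_idempotents[of "fst g" "snd g"] that by auto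
  have src: "real_analytic_map ?G ?Q (src ?\<Gamma>)"
    unfolding algebra_groupoid_simps
    by (intro embedded_real_analytic_map[OF G Q] extends_analyticallyI analytic_intros st)
  have tgt: "real_analytic_map ?G ?Q (tgt ?\<Gamma>)"
    unfolding algebra_groupoid_simps
    by (intro embedded_real_analytic_map[OF G Q] extends_analyticallyI analytic_intros st)
  have gid: "real_analytic_map ?Q ?G (gid ?\<Gamma>)"
    unfolding algebra_groupoid_simps
    by (intro embedded_real_analytic_map[OF Q G] extends_analyticallyI analytic_intros)
      (simp add: inverse_pairs_iff idempotents_iff)
  have ginv: "real_analytic_map ?G ?G (ginv ?\<Gamma>)"
    unfolding algebra_groupoid_simps
    by (intro embedded_real_analytic_map[OF G G] extends_analyticallyI analytic_intros)
      (auto simp: inverse_pairs_iff)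
  have gmult: "real_analytic_map (submanifold (prod_manifold ?G ?G) (composable ?\<Gamma>)) ?G (\<lambda>(g, h). gmult ?\<Gamma> g h)"
    unfolding algebra_groupoid_simps case_prod_unfold
  proof (intro embedded_real_analytic_map[OF GG(2) G] extends_analyticallyI analytic_intros)
    show "(fst (fst z) * fst (snd z), snd (snd z) * snd (fst z)) \<in> inverse_pairs"
      if "z \<in> composable ?\<Gamma>" for z
      using that composable_product(1) by (auto simp: composable_algebra_groupoid)
  qed
  have sec: "has_local_section inverse_pairs idempotents (src ?\<Gamma>) g" if "g \<in> inverse_pairs" for g
    using source_has_local_section[OF that] by (simp add: algebra_groupoid_simps)
  have "topological_groupoid ?\<Gamma> (mtop ?G) (mtop ?Q)"
    unfolding topological_groupoid_def
  proof (intro conjI)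
    show "is_groupoid ?\<Gamma>" by (rule is_groupoid_algebra_groupoid)
    show "topspace (mtop ?G) = arrows ?\<Gamma>" "topspace (mtop ?Q) = objects ?\<Gamma>"
      by (simp_all add: topG topQ algebra_groupoid_simps)
    show s: "continuous_map (mtop ?G) (mtop ?Q) (src ?\<Gamma>)"
      and "continuous_map (mtop ?G) (mtop ?Q) (tgt ?\<Gamma>)" and i: "continuous_map (mtop ?Q) (mtop ?G) (gid ?\<Gamma>)"
      and "continuous_map (mtop ?G) (mtop ?G) (ginv ?\<Gamma>)"
      using src tgt gid ginv unfolding real_analytic_map_def by auto
    show "continuous_map (subtopology (prod_topology (mtop ?G) (mtop ?G)) (composable ?\<Gamma>)) (mtop ?G)
        (\<lambda>(g, h). gmult ?\<Gamma> g h)"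
      using gmult unfolding real_analytic_map_def submanifold_def prod_manifold_def by simp
    show "open_map (mtop ?G) (mtop ?Q) (src ?\<Gamma>)"
      unfolding topG topQ by (rule local_sections_open_map) (use st sec in \<open>auto simp: algebra_groupoid_simps\<close>)
    show "open_map (mtop ?G) (mtop ?Q) (tgt ?\<Gamma>)"
      unfolding topG topQ algebra_groupoid_simps
      by (rule local_sections_open_map)
        (auto intro: st has_local_section_mono[OF target_has_local_section])
    have id: "(q, q) \<in> inverse_pairs \<and> q * q = q" if "q \<in> idempotents" for q :: 'a
      using that by (simp add: inverse_pairs_iff idempotents_iff)
    show "src ?\<Gamma> ` arrows ?\<Gamma> = objects ?\<Gamma>"
      unfolding algebra_groupoid_simps
    proof (intro equalityI subsetI)
      fix q :: 'a assume "q \<in> idempotents"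
      then show "q \<in> (\<lambda>g. snd g * fst g) ` inverse_pairs" using id[of q] by (intro image_eqI[of _ _ "(q, q)"]) auto
    qed (use st in auto)
    show "tgt ?\<Gamma> ` arrows ?\<Gamma> = objects ?\<Gamma>"
      unfolding algebra_groupoid_simps
    proof (intro equalityI subsetI)
      fix q :: 'a assume "q \<in> idempotents"
      then show "q \<in> (\<lambda>g. fst g * snd g) ` inverse_pairs" using id[of q] by (intro image_eqI[of _ _ "(q, q)"]) auto
    qed (use st in auto)
    have "retraction_maps (mtop ?G) (mtop ?Q) (src ?\<Gamma>) (gid ?\<Gamma>)"
      unfolding retraction_maps_def using s i id by (auto simp: topQ algebra_groupoid_simps)
    then show "embedding_map (mtop ?Q) (mtop ?G) (gid ?\<Gamma>)"
      by (intro section_imp_embedding_map) (auto simp: section_map_def)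
  qed
  moreover have "submersion ?G ?Q (src ?\<Gamma>)"
    by (rule local_sections_submersion[OF G Q])
      (use st sec in \<open>auto simp: algebra_groupoid_simps intro!: extends_analyticallyI analytic_intros\<close>)
  ultimately show ?thesis
    unfolding real_analytic_Lie_groupoid_def
    using embedded_manifold_real_analytic[OF G] embedded_manifold_real_analytic[OF Q]
      src tgt gid ginv GG(1) gmult by blast
qed

section \<open>The unit group and the isotropy group at the unit\<close>

lemma group_unit_group: "group (unit_group :: 'a::{real_normed_algebra, monoid_mult, banach} monoid)"
proof (rule groupI)
  fix x :: 'a assume "x \<in> carrier unit_group"
  then have "inverse_of x \<in> carrier unit_group" "inverse_of x \<otimes>\<^bsub>unit_group\<^esub> x = \<one>\<^bsub>unit_group\<^esub>"
    unfolding carrier_unit_group using inverse_of_inverse_of by (auto simp: unit_group_def)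
  then show "\<exists>y\<in>carrier unit_group. y \<otimes>\<^bsub>unit_group\<^esub> x = \<one>\<^bsub>unit_group\<^esub>" by blast
qed (unfold carrier_unit_group, auto simp: unit_group_def mult.assoc intro: invertible_elements_mult)

lemma inv_unit_group:
  assumes "x \<in> invertible_elements"
  shows "inv\<^bsub>unit_group\<^esub> x = inverse_of x"
proof (rule group.inv_equality[OF group_unit_group])
  show "x \<in> carrier unit_group" "inverse_of x \<in> carrier unit_group"
    using assms inverse_of_inverse_of by (auto simp: carrier_unit_group)
  show "inverse_of x \<otimes>\<^bsub>unit_group\<^esub> x = \<one>\<^bsub>unit_group\<^esub>" using assms by (simp add: unit_group_def)
qed

lemma extends_analytically_on:
  assumes "analytic_at UNIV F p" "\<And>y. y \<in> S \<Longrightarrow> f y = F y"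
  shows "extends_analytically S f p"
  by (rule extends_analytically_cong[OF extends_analyticallyI[OF assms(1)]])
    (use assms(2) in \<open>auto intro: always_eventually\<close>)

lemma real_analytic_Lie_group_unit_group:
  "real_analytic_Lie_group (unit_group :: 'a::{real_normed_algebra, monoid_mult, banach} monoid) unit_group_manifold"
proof -
  note M = unit_group_embedded
  show ?thesis
    unfolding real_analytic_Lie_group_def
  proof (intro conjI group_unit_group embedded_manifold_real_analytic[OF M])
    show "topspace (mtop unit_group_manifold) = carrier (unit_group :: 'a monoid)"
      by (simp add: embedded_manifoldD(1)[OF M] carrier_unit_group)
    show "real_analytic_map (prod_manifold unit_group_manifold unit_group_manifold)
        (unit_group_manifold :: ('a, 'a) manifold) (\<lambda>(x, y). x \<otimes>\<^bsub>unit_group\<^esub> y)"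
      unfolding case_prod_unfold unit_group_def monoid.simps
      by (intro embedded_real_analytic_map[OF embedded_manifold_prod[OF M M] M]
          extends_analyticallyI analytic_intros) (auto intro: invertible_elements_mult)
    show "real_analytic_map unit_group_manifold (unit_group_manifold :: ('a, 'a) manifold) (\<lambda>x. inv\<^bsub>unit_group\<^esub> x)"
    proof (rule embedded_real_analytic_map[OF M M])
      show "extends_analytically invertible_elements (\<lambda>x. inv\<^bsub>unit_group\<^esub> x) p"
        if "p \<in> invertible_elements" for p :: 'a
        by (rule extends_analytically_on[OF analytic_at_inverse_of[OF that]]) (rule inv_unit_group)
    qed (simp add: inv_unit_group inverse_of_inverse_of)
  qed
qed

lemma isotropy_group_one_simps:
  "x \<otimes>\<^bsub>isotropy_group_one\<^esub> y = (fst x * fst y, snd y * snd x)"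
  "\<one>\<^bsub>isotropy_group_one\<^esub> = (1, 1)"
  by (simp_all add: isotropy_group_one_def isotropy_group_def algebra_groupoid_simps)

lemma mutual_inverses_mult:
  assumes "(a1, b1) \<in> mutual_inverses" "(a2, b2) \<in> mutual_inverses"
  shows "(a1 * a2, b2 * b1) \<in> mutual_inverses"
proof -
  have "a1 * a2 * (b2 * b1) = a1 * (a2 * b2) * b1" "b2 * b1 * (a1 * a2) = b2 * (b1 * a1) * a2"
    by (simp_all only: mult.assoc)
  then show ?thesis using assms by (simp add: mutual_inverses_def)
qed

lemma mutual_inverses_swap: "(a, b) \<in> mutual_inverses \<Longrightarrow> (b, a) \<in> mutual_inverses"
  by (simp add: mutual_inverses_def)

lemma group_isotropy_group_one:
  "group (isotropy_group_one :: ('a::{real_normed_algebra, monoid_mult, banach} \<times> 'a) monoid)"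
proof (rule groupI)
  fix x :: "'a \<times> 'a" assume "x \<in> carrier isotropy_group_one"
  then have "(snd x, fst x) \<in> carrier isotropy_group_one"
    "(snd x, fst x) \<otimes>\<^bsub>isotropy_group_one\<^esub> x = \<one>\<^bsub>isotropy_group_one\<^esub>"
    unfolding carrier_isotropy_group_one isotropy_group_one_simps by (auto simp: mutual_inverses_def)
  then show "\<exists>y\<in>carrier isotropy_group_one. y \<otimes>\<^bsub>isotropy_group_one\<^esub> x = \<one>\<^bsub>isotropy_group_one\<^esub>" by blast
next
  show "\<one>\<^bsub>isotropy_group_one\<^esub> \<in> carrier (isotropy_group_one :: ('a \<times> 'a) monoid)"
    unfolding carrier_isotropy_group_one isotropy_group_one_simps by (simp add: mutual_inverses_def)
qed (unfold carrier_isotropy_group_one isotropy_group_one_simps, auto simp: mult.assoc intro: mutual_inverses_mult)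

lemma inv_isotropy_group_one:
  assumes "x \<in> mutual_inverses"
  shows "inv\<^bsub>isotropy_group_one\<^esub> x = (snd x, fst x)"
proof (rule group.inv_equality[OF group_isotropy_group_one])
  show "x \<in> carrier isotropy_group_one" "(snd x, fst x) \<in> carrier isotropy_group_one"
    using assms mutual_inverses_swap[of "fst x" "snd x"] by (auto simp: carrier_isotropy_group_one)
  show "(snd x, fst x) \<otimes>\<^bsub>isotropy_group_one\<^esub> x = \<one>\<^bsub>isotropy_group_one\<^esub>"
    using assms unfolding isotropy_group_one_simps by (auto simp: mutual_inverses_def)
qed

lemma real_analytic_Lie_group_isotropy_group_one:
  "real_analytic_Lie_group (isotropy_group_one :: ('a::{real_normed_algebra, monoid_mult, banach} \<times> 'a) monoid)
    isotropy_group_one_manifold"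
proof -
  note M = isotropy_group_one_embedded(2)
  show ?thesis
    unfolding real_analytic_Lie_group_def
  proof (intro conjI group_isotropy_group_one embedded_manifold_real_analytic[OF M])
    show "topspace (mtop isotropy_group_one_manifold) = carrier (isotropy_group_one :: ('a \<times> 'a) monoid)"
      by (simp add: embedded_manifoldD(1)[OF M] carrier_isotropy_group_one)
    show "real_analytic_map (prod_manifold isotropy_group_one_manifold isotropy_group_one_manifold)
        (isotropy_group_one_manifold :: ('a \<times> 'a, 'a \<times> 'a) manifold) (\<lambda>(x, y). x \<otimes>\<^bsub>isotropy_group_one\<^esub> y)"
      unfolding case_prod_unfold isotropy_group_one_simps
      by (intro embedded_real_analytic_map[OF embedded_manifold_prod[OF M M] M]
          extends_analyticallyI analytic_intros) (auto intro: mutual_inverses_mult)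
    show "real_analytic_map isotropy_group_one_manifold
        (isotropy_group_one_manifold :: ('a \<times> 'a, 'a \<times> 'a) manifold) (\<lambda>x. inv\<^bsub>isotropy_group_one\<^esub> x)"
    proof (rule embedded_real_analytic_map[OF M M])
      have an: "analytic_at UNIV (\<lambda>x. (snd x, fst x)) p" for p :: "'a \<times> 'a" by (intro analytic_intros)
      show "extends_analytically mutual_inverses (\<lambda>x. inv\<^bsub>isotropy_group_one\<^esub> x) p" for p :: "'a \<times> 'a"
        by (rule extends_analytically_on[OF an]) (rule inv_isotropy_group_one)
      show "inv\<^bsub>isotropy_group_one\<^esub> p \<in> mutual_inverses" if "p \<in> mutual_inverses" for p :: "'a \<times> 'a"
        using that mutual_inverses_swap[of "fst p" "snd p"] by (simp add: inv_isotropy_group_one)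
    qed
  qed
qed

lemma Lie_group_iso_isotropy_unit_group:
  "Lie_group_iso (isotropy_group_one :: ('a::{real_normed_algebra, monoid_mult, banach} \<times> 'a) monoid)
    isotropy_group_one_manifold unit_group unit_group_manifold fst"
proof -
  note M = isotropy_group_one_embedded(2) and N = unit_group_embedded
  have inj: "inj_on fst (mutual_inverses :: ('a \<times> 'a) set)"
    by (auto simp: inj_on_def mutual_inverses_iff)
  have pair: "(a, inverse_of a) \<in> mutual_inverses" if "a \<in> invertible_elements" for a :: 'a
    using that by (simp add: mutual_inverses_iff)
  have inv: "inv_into mutual_inverses fst a = (a, inverse_of a)" if "a \<in> invertible_elements" for a :: 'a
    using inv_into_f_f[OF inj pair[OF that]] by simp
  have im: "fst ` mutual_inverses = (invertible_elements :: 'a set)"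
  proof (intro equalityI subsetI)
    fix a :: 'a assume "a \<in> invertible_elements"
    then show "a \<in> fst ` mutual_inverses" using pair by (intro image_eqI[of _ _ "(a, inverse_of a)"]) auto
  qed (auto simp: mutual_inverses_iff)
  show ?thesis
    unfolding Lie_group_iso_def
  proof (intro conjI)
    show "fst \<in> iso isotropy_group_one (unit_group :: 'a monoid)"
      unfolding iso_def hom_def bij_betw_def carrier_isotropy_group_one carrier_unit_group
      using inj im by (auto simp: isotropy_group_one_simps unit_group_def)
    show "real_analytic_map isotropy_group_one_manifold (unit_group_manifold :: ('a, 'a) manifold) fst"
    proof (rule embedded_real_analytic_map[OF M N])
      show "extends_analytically mutual_inverses fst p" for p :: "'a \<times> 'a"
        by (intro extends_analyticallyI analytic_at_bounded_linear bounded_linear_fst)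
    qed (use im in auto)
    show "real_analytic_map (unit_group_manifold :: ('a, 'a) manifold) isotropy_group_one_manifold
        (inv_into (carrier isotropy_group_one) fst)"
      unfolding carrier_isotropy_group_one
    proof (rule embedded_real_analytic_map[OF N M])
      fix p :: 'a assume p: "p \<in> invertible_elements"
      have "analytic_at UNIV (\<lambda>a. (a, inverse_of a)) p" by (intro analytic_intros p)
      then show "extends_analytically invertible_elements (inv_into mutual_inverses fst) p"
        by (rule extends_analytically_on) (rule inv)
      show "inv_into mutual_inverses fst p \<in> mutual_inverses" using p inv pair by simp
    qed
  qed
qed

theorem theorem7p3:
  shows "is_submanifold banach_space_manifold
           (idempotents :: 'a::{real_normed_algebra, monoid_mult, banach} set) \<and>
         is_submanifold banach_space_manifold (inverse_pairs :: ('a \<times> 'a) set) \<and>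
         real_analytic_Lie_groupoid (algebra_groupoid :: ('a \<times> 'a, 'a) groupoid)
           inverse_pairs_manifold idempotents_manifold \<and>
         locally_transitive (algebra_groupoid :: ('a \<times> 'a, 'a) groupoid)
           (mtop idempotents_manifold) \<and>
         open (carrier (unit_group :: 'a monoid)) \<and>
         real_analytic_Lie_group (unit_group :: 'a monoid) unit_group_manifold \<and>
         is_submanifold (inverse_pairs_manifold :: ('a \<times> 'a, 'a \<times> 'a) manifold)
           (carrier isotropy_group_one) \<and>
         real_analytic_Lie_group (isotropy_group_one :: ('a \<times> 'a) monoid)
           isotropy_group_one_manifold \<and>
         Lie_group_iso (isotropy_group_one :: ('a \<times> 'a) monoid) isotropy_group_one_manifold
           unit_group unit_group_manifold fst"
  unfolding carrier_isotropy_group_one carrier_unit_group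
  by (intro conjI idempotents_embedded(1) inverse_pairs_embedded(1)
      real_analytic_Lie_groupoid_algebra_groupoid locally_transitive_algebra_groupoid
      open_invertible_elements real_analytic_Lie_group_unit_group isotropy_group_one_embedded(1)
      real_analytic_Lie_group_isotropy_group_one Lie_group_iso_isotropy_unit_group)

end
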